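(* (i) Any special symplectic manifold $(M,J,\nabla,\omega)$ admits a real special coordinate system near any point $p\in M$. A real special coordinate system is unique up to an affine symplectic transformation. (ii) Any affine local coordinate system $(x^1,\dots,x^n,y_1,\dots,y_n)$ on a special complex manifold admits a holomorphic extension, i.e. there exist holomorphic functions $z^i$ and $w_j$ with $\mathrm{Re}\,z^i=x^i$ and $\mathrm{Re}\,w_j=y_j$. The extension is unique up to (purely imaginary) translations. (iii) Near any point of a special Kähler manifold there exists a real special coordinate system which admits a holomorphic extension to a conjugate pair of special coordinates.
   Context: A special complex manifold $(M,J,\nabla)$ is a complex manifold $(M,J)$ together with a flat torsionfree connection $\nabla$ on its real tangent bundle such that $d^\nabla J=0$, i.e. $(\nabla_XJ)Y=(\nabla_YJ)X$ for all $X,Y$. A special symplectic manifold $(M,J,\nabla,\omega)$ is a special complex manifold together with a $\nabla$-parallel symplectic form $\omega$; it is a special Kähler manifold if $\omega$ is $J$-invariant. Here $n=\dim_{\mathbb{C}}M$. A local function $f$ on $M$ is affine if $\nabla df=0$; a local coordinate system is affine if it consists of affine functions. Local coordinate systems are considered near points as germs, i.e. up to restriction of the coordinate domain. On a special symplectic manifold, an affine local coordinate system $(x^1,\dots,x^n,y_1,\dots,y_n)$ is a real special coordinate system if $\omega=2\sum dx^i\wedge dy_i$. A conjugate pair of special coordinates is a pair of holomorphic local coordinate systems $(z^1,\dots,z^n)$ and $(w_1,\dots,w_n)$ such that $(\mathrm{Re}\,z^1,\dots,\mathrm{Re}\,z^n,\mathrm{Re}\,w_1,\dots,\mathrm{Re}\,w_n)$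 is a real special coordinate system. *)

theory Defs
  imports "HOL-Analysis.Analysis"
begin

section \<open>Smooth and holomorphic maps between open subsets of vector spaces\<close>

primrec Ck_on :: "nat \<Rightarrow> 'v::real_normed_vector set \<Rightarrow> ('v \<Rightarrow> 'w::real_normed_vector) \<Rightarrow> bool" where
  "Ck_on 0 S f \<longleftrightarrow> continuous_on S f"
| "Ck_on (Suc k) S f \<longleftrightarrow> (\<forall>x\<in>S. f differentiable (at x)) \<and>
     (\<forall>v. Ck_on k S (\<lambda>x. frechet_derivative f (at x) v))"

definition smooth_on :: "'v::real_normed_vector set \<Rightarrow> ('v \<Rightarrow> 'w::real_normed_vector) \<Rightarrow> bool" where
  "smooth_on S f \<longleftrightarrow> (\<forall>k. Ck_on k S f)"

text \<open>
  A function of several complex variables is holomorphic if it is \<open>C\<^sup>\<infinity>\<close> and satisfies the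
  Cauchy-Riemann equations, i.e. its real differential is complex linear. A map into
  \<open>\<complex>\<^sup>m\<close> is holomorphic if its components are.
\<close>

definition Cn_holomorphic_on :: "(complex^'n) set \<Rightarrow> (complex^'n \<Rightarrow> complex) \<Rightarrow> bool" where
  "Cn_holomorphic_on S f \<longleftrightarrow> smooth_on S f \<and>
     (\<forall>u\<in>S. \<forall>v. frechet_derivative f (at u) (\<i> *s v) = \<i> * frechet_derivative f (at u) v)"

definition holomorphic_map_on :: "(complex^'n) set \<Rightarrow> (complex^'n \<Rightarrow> complex^'m) \<Rightarrow> bool" where
  "holomorphic_map_on S F \<longleftrightarrow> (\<forall>i. Cn_holomorphic_on S (\<lambda>u. F u $ i))"


section \<open>Complex manifolds\<close>

text \<open>
  The underlying set of the manifold is a topological type \<^typ>\<open>'a\<close>; a chart is a pair of its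
  domain and its coordinate map. The complex dimension is \<open>CARD('n)\<close>.
\<close>

type_synonym ('a, 'n) chart = "'a set \<times> ('a \<Rightarrow> complex^'n)"

abbreviation chart_inv :: "('a, 'n::finite) chart \<Rightarrow> complex^'n \<Rightarrow> 'a" where
  "chart_inv c \<equiv> inv_into (fst c) (snd c)"

text \<open>The coordinate image of the part of \<open>U\<close> that is covered by the chart \<open>c\<close>.\<close>

abbreviation chart_image :: "('a, 'n::finite) chart \<Rightarrow> 'a set \<Rightarrow> (complex^'n) set" where
  "chart_image c U \<equiv> snd c ` (U \<inter> fst c)"

text \<open>The atlas is not required to be maximal.\<close>

definition complex_manifold ::
    "('a::{t2_space,second_countable_topology}, 'n::finite) chart set \<Rightarrow> bool" where
  "complex_manifold A \<longleftrightarrow>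
     (\<Union>c\<in>A. fst c) = UNIV \<and>
     (\<forall>c\<in>A. open (fst c) \<and> open (snd c ` fst c) \<and>
        homeomorphism (fst c) (snd c ` fst c) (snd c) (chart_inv c)) \<and>
     (\<forall>c\<in>A. \<forall>d\<in>A. holomorphic_map_on (chart_image c (fst d)) (snd d \<circ> chart_inv c))"

definition smooth_fun ::
    "('a::topological_space, 'n::finite) chart set \<Rightarrow> 'a set \<Rightarrow> ('a \<Rightarrow> 'b::real_normed_vector) \<Rightarrow> bool" where
  "smooth_fun A U f \<longleftrightarrow> (\<forall>c\<in>A. smooth_on (chart_image c U) (f \<circ> chart_inv c))"

definition holomorphic_fun ::
    "('a::topological_space, 'n::finite) chart set \<Rightarrow> 'a set \<Rightarrow> ('a \<Rightarrow> complex) \<Rightarrow> bool" where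
  "holomorphic_fun A U f \<longleftrightarrow> (\<forall>c\<in>A. Cn_holomorphic_on (chart_image c U) (f \<circ> chart_inv c))"


section \<open>Real tangent bundle and complex structure\<close>

text \<open>
  A real tangent vector at \<open>p\<close> is a family of coordinate vectors, one for each chart around \<open>p\<close>,
  which transform by the differentials of the coordinate changes. As a convention, its entry is \<open>0\<close>
  at every other argument, so that \<open>tangent_space A p\<close> is a real vector space of dimension
  \<open>2 * CARD('n)\<close> under the pointwise operations.
\<close>

type_synonym ('a, 'n) tvec = "('a, 'n) chart \<Rightarrow> complex^'n"
type_synonym ('a, 'n) vfield = "'a \<Rightarrow> ('a, 'n) tvec"

definition tangent_space :: "('a, 'n::finite) chart set \<Rightarrow> 'a \<Rightarrow> ('a, 'n) tvec set" where
  "tangent_space A p = {v.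
     (\<forall>c. \<not> (c \<in> A \<and> p \<in> fst c) \<longrightarrow> v c = 0) \<and>
     (\<forall>c\<in>A. \<forall>d\<in>A. p \<in> fst c \<and> p \<in> fst d \<longrightarrow>
        v d = frechet_derivative (snd d \<circ> chart_inv c) (at (snd c p)) (v c))}"

definition J_vec :: "('a, 'n::finite) tvec \<Rightarrow> ('a, 'n) tvec" where
  "J_vec v = (\<lambda>c. \<i> *s v c)"

text \<open>
  Local objects on an open set \<open>U\<close> are represented by total functions whose values outside \<open>U\<close> are
  irrelevant. \<open>smooth_vfields A U\<close> are the smooth vector fields on \<open>U\<close>.
\<close>

definition smooth_vfields ::
    "('a::topological_space, 'n::finite) chart set \<Rightarrow> 'a set \<Rightarrow> ('a, 'n) vfield set" where
  "smooth_vfields A U = {X.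
     (\<forall>p\<in>U. X p \<in> tangent_space A p) \<and>
     (\<forall>c\<in>A. smooth_on (chart_image c U) (\<lambda>u. X (chart_inv c u) c))}"

definition vf_add :: "('a, 'n::finite) vfield \<Rightarrow> ('a, 'n) vfield \<Rightarrow> ('a, 'n) vfield" where
  "vf_add X Y = (\<lambda>p c. X p c + Y p c)"

definition vf_minus :: "('a, 'n::finite) vfield \<Rightarrow> ('a, 'n) vfield \<Rightarrow> ('a, 'n) vfield" where
  "vf_minus X Y = (\<lambda>p c. X p c - Y p c)"

definition vf_smult :: "('a \<Rightarrow> real) \<Rightarrow> ('a, 'n::finite) vfield \<Rightarrow> ('a, 'n) vfield" where
  "vf_smult f X = (\<lambda>p c. f p *\<^sub>R X p c)"

definition J_field :: "('a, 'n::finite) vfield \<Rightarrow> ('a, 'n) vfield" where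
  "J_field X = (\<lambda>p. J_vec (X p))"

definition some_chart :: "('a, 'n::finite) chart set \<Rightarrow> 'a \<Rightarrow> ('a, 'n) chart" where
  "some_chart A p = (SOME c. c \<in> A \<and> p \<in> fst c)"

text \<open>The differential \<open>df\<^sub>p(v)\<close>; by the chain rule it does not depend on the chosen chart.\<close>

definition differential ::
    "('a, 'n::finite) chart set \<Rightarrow> ('a \<Rightarrow> real) \<Rightarrow> 'a \<Rightarrow> ('a, 'n) tvec \<Rightarrow> real" where
  "differential A f p v = (let c = some_chart A p in
     frechet_derivative (f \<circ> chart_inv c) (at (snd c p)) (v c))"

definition lie_deriv ::
    "('a, 'n::finite) chart set \<Rightarrow> ('a, 'n) vfield \<Rightarrow> ('a \<Rightarrow> real) \<Rightarrow> 'a \<Rightarrow> real" where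
  "lie_deriv A X f = (\<lambda>p. differential A f p (X p))"

text \<open>In each chart, \<open>[X,Y] = DY(X) - DX(Y)\<close>, which is the commutator of derivations.\<close>

definition lie_bracket ::
    "('a, 'n::finite) chart set \<Rightarrow> ('a, 'n) vfield \<Rightarrow> ('a, 'n) vfield \<Rightarrow> ('a, 'n) vfield" where
  "lie_bracket A X Y = (\<lambda>p c.
     if c \<in> A \<and> p \<in> fst c then
       frechet_derivative (\<lambda>u. Y (chart_inv c u) c) (at (snd c p)) (X p c) -
       frechet_derivative (\<lambda>u. X (chart_inv c u) c) (at (snd c p)) (Y p c)
     else 0)"


section \<open>Connections\<close>

text \<open>
  A connection on the real tangent bundle acts on the local smooth vector fields over every open
  set, compatibly with restriction (second clause).
\<close>

definition connection ::
    "('a::topological_space, 'n::finite) chart set \<Rightarrow>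
     (('a, 'n) vfield \<Rightarrow> ('a, 'n) vfield \<Rightarrow> ('a, 'n) vfield) \<Rightarrow> bool" where
  "connection A nabla \<longleftrightarrow> (\<forall>U. open U \<longrightarrow>
     (\<forall>X\<in>smooth_vfields A U. \<forall>Y\<in>smooth_vfields A U. nabla X Y \<in> smooth_vfields A U) \<and>
     (\<forall>X\<in>smooth_vfields A U. \<forall>Y\<in>smooth_vfields A U.
      \<forall>X'\<in>smooth_vfields A U. \<forall>Y'\<in>smooth_vfields A U.
        (\<forall>p\<in>U. X p = X' p \<and> Y p = Y' p) \<longrightarrow> (\<forall>p\<in>U. nabla X Y p = nabla X' Y' p)) \<and>
     (\<forall>X\<in>smooth_vfields A U. \<forall>X'\<in>smooth_vfields A U. \<forall>Y\<in>smooth_vfields A U. \<forall>p\<in>U.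
        nabla (vf_add X X') Y p = vf_add (nabla X Y) (nabla X' Y) p) \<and>
     (\<forall>f. \<forall>X\<in>smooth_vfields A U. \<forall>Y\<in>smooth_vfields A U. smooth_fun A U f \<longrightarrow> (\<forall>p\<in>U.
        nabla (vf_smult f X) Y p = vf_smult f (nabla X Y) p)) \<and>
     (\<forall>X\<in>smooth_vfields A U. \<forall>Y\<in>smooth_vfields A U. \<forall>Y'\<in>smooth_vfields A U. \<forall>p\<in>U.
        nabla X (vf_add Y Y') p = vf_add (nabla X Y) (nabla X Y') p) \<and>
     (\<forall>f. \<forall>X\<in>smooth_vfields A U. \<forall>Y\<in>smooth_vfields A U. smooth_fun A U f \<longrightarrow> (\<forall>p\<in>U.
        nabla X (vf_smult f Y) p =
          vf_add (vf_smult (lie_deriv A X f) Y) (vf_smult f (nabla X Y)) p)))"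

definition flat ::
    "('a::topological_space, 'n::finite) chart set \<Rightarrow>
     (('a, 'n) vfield \<Rightarrow> ('a, 'n) vfield \<Rightarrow> ('a, 'n) vfield) \<Rightarrow> bool" where
  "flat A nabla \<longleftrightarrow> (\<forall>U. open U \<longrightarrow>
     (\<forall>X\<in>smooth_vfields A U. \<forall>Y\<in>smooth_vfields A U. \<forall>Z\<in>smooth_vfields A U. \<forall>p\<in>U.
        vf_minus (vf_minus (nabla X (nabla Y Z)) (nabla Y (nabla X Z)))
          (nabla (lie_bracket A X Y) Z) p = (\<lambda>c. 0)))"

definition torsionfree ::
    "('a::topological_space, 'n::finite) chart set \<Rightarrow>
     (('a, 'n) vfield \<Rightarrow> ('a, 'n) vfield \<Rightarrow> ('a, 'n) vfield) \<Rightarrow> bool" where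
  "torsionfree A nabla \<longleftrightarrow> (\<forall>U. open U \<longrightarrow>
     (\<forall>X\<in>smooth_vfields A U. \<forall>Y\<in>smooth_vfields A U. \<forall>p\<in>U.
        vf_minus (vf_minus (nabla X Y) (nabla Y X)) (lie_bracket A X Y) p = (\<lambda>c. 0)))"

text \<open>\<open>(\<nabla>\<^sub>X J) Y = \<nabla>\<^sub>X (J Y) - J (\<nabla>\<^sub>X Y)\<close>.\<close>

definition nabla_J ::
    "(('a, 'n::finite) vfield \<Rightarrow> ('a, 'n) vfield \<Rightarrow> ('a, 'n) vfield) \<Rightarrow>
     ('a, 'n) vfield \<Rightarrow> ('a, 'n) vfield \<Rightarrow> ('a, 'n) vfield" where
  "nabla_J nabla X Y = vf_minus (nabla X (J_field Y)) (J_field (nabla X Y))"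


section \<open>Special complex, special symplectic and special Kaehler manifolds\<close>

definition special_complex_manifold ::
    "('a::{t2_space,second_countable_topology}, 'n::finite) chart set \<Rightarrow>
     (('a, 'n) vfield \<Rightarrow> ('a, 'n) vfield \<Rightarrow> ('a, 'n) vfield) \<Rightarrow> bool" where
  "special_complex_manifold A nabla \<longleftrightarrow>
     complex_manifold A \<and> connection A nabla \<and> flat A nabla \<and> torsionfree A nabla \<and>
     (\<forall>U. open U \<longrightarrow>
        (\<forall>X\<in>smooth_vfields A U. \<forall>Y\<in>smooth_vfields A U. \<forall>p\<in>U.
           nabla_J nabla X Y p = nabla_J nabla Y X p))"

text \<open>
  Skew-symmetry makes linearity in the first argument sufficient. The last clause is \<open>d\<omega> = 0\<close>.
\<close>

definition symplectic_form ::
    "('a::topological_space, 'n::finite) chart set \<Rightarrow>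
     ('a \<Rightarrow> ('a, 'n) tvec \<Rightarrow> ('a, 'n) tvec \<Rightarrow> real) \<Rightarrow> bool" where
  "symplectic_form A \<omega> \<longleftrightarrow>
     (\<forall>p. \<forall>u\<in>tangent_space A p. \<forall>v\<in>tangent_space A p. \<forall>w\<in>tangent_space A p. \<forall>a b.
        \<omega> p (\<lambda>c. a *\<^sub>R u c + b *\<^sub>R v c) w = a * \<omega> p u w + b * \<omega> p v w) \<and>
     (\<forall>p. \<forall>u\<in>tangent_space A p. \<forall>v\<in>tangent_space A p. \<omega> p u v = - \<omega> p v u) \<and>
     (\<forall>p. \<forall>u\<in>tangent_space A p. (\<forall>v\<in>tangent_space A p. \<omega> p u v = 0) \<longrightarrow> u = (\<lambda>c. 0)) \<and>
     (\<forall>U. open U \<longrightarrow> (\<forall>X\<in>smooth_vfields A U. \<forall>Y\<in>smooth_vfields A U.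
        smooth_fun A U (\<lambda>p. \<omega> p (X p) (Y p)))) \<and>
     (\<forall>U. open U \<longrightarrow>
        (\<forall>X\<in>smooth_vfields A U. \<forall>Y\<in>smooth_vfields A U. \<forall>Z\<in>smooth_vfields A U. \<forall>p\<in>U.
           lie_deriv A X (\<lambda>q. \<omega> q (Y q) (Z q)) p - lie_deriv A Y (\<lambda>q. \<omega> q (X q) (Z q)) p
           + lie_deriv A Z (\<lambda>q. \<omega> q (X q) (Y q)) p
           - \<omega> p (lie_bracket A X Y p) (Z p) + \<omega> p (lie_bracket A X Z p) (Y p)
           - \<omega> p (lie_bracket A Y Z p) (X p) = 0))"

definition parallel_form ::
    "('a::topological_space, 'n::finite) chart set \<Rightarrow>
     (('a, 'n) vfield \<Rightarrow> ('a, 'n) vfield \<Rightarrow> ('a, 'n) vfield) \<Rightarrow>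
     ('a \<Rightarrow> ('a, 'n) tvec \<Rightarrow> ('a, 'n) tvec \<Rightarrow> real) \<Rightarrow> bool" where
  "parallel_form A nabla \<omega> \<longleftrightarrow> (\<forall>U. open U \<longrightarrow>
     (\<forall>X\<in>smooth_vfields A U. \<forall>Y\<in>smooth_vfields A U. \<forall>Z\<in>smooth_vfields A U. \<forall>p\<in>U.
        lie_deriv A X (\<lambda>q. \<omega> q (Y q) (Z q)) p
          - \<omega> p (nabla X Y p) (Z p) - \<omega> p (Y p) (nabla X Z p) = 0))"

definition special_symplectic_manifold ::
    "('a::{t2_space,second_countable_topology}, 'n::finite) chart set \<Rightarrow>
     (('a, 'n) vfield \<Rightarrow> ('a, 'n) vfield \<Rightarrow> ('a, 'n) vfield) \<Rightarrow>
     ('a \<Rightarrow> ('a, 'n) tvec \<Rightarrow> ('a, 'n) tvec \<Rightarrow> real) \<Rightarrow> bool" where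
  "special_symplectic_manifold A nabla \<omega> \<longleftrightarrow>
     special_complex_manifold A nabla \<and> symplectic_form A \<omega> \<and> parallel_form A nabla \<omega>"

definition special_kaehler_manifold ::
    "('a::{t2_space,second_countable_topology}, 'n::finite) chart set \<Rightarrow>
     (('a, 'n) vfield \<Rightarrow> ('a, 'n) vfield \<Rightarrow> ('a, 'n) vfield) \<Rightarrow>
     ('a \<Rightarrow> ('a, 'n) tvec \<Rightarrow> ('a, 'n) tvec \<Rightarrow> real) \<Rightarrow> bool" where
  "special_kaehler_manifold A nabla \<omega> \<longleftrightarrow>
     special_symplectic_manifold A nabla \<omega> \<and>
     (\<forall>p. \<forall>u\<in>tangent_space A p. \<forall>v\<in>tangent_space A p. \<omega> p (J_vec u) (J_vec v) = \<omega> p u v)"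


section \<open>Affine, real special and holomorphic coordinates\<close>

text \<open>\<open>(\<nabla>df)(X,Y) = X(Y f) - (\<nabla>\<^sub>X Y) f\<close>.\<close>

definition affine_fun ::
    "('a::topological_space, 'n::finite) chart set \<Rightarrow>
     (('a, 'n) vfield \<Rightarrow> ('a, 'n) vfield \<Rightarrow> ('a, 'n) vfield) \<Rightarrow>
     'a set \<Rightarrow> ('a \<Rightarrow> real) \<Rightarrow> bool" where
  "affine_fun A nabla U f \<longleftrightarrow> smooth_fun A U f \<and>
     (\<forall>V. open V \<and> V \<subseteq> U \<longrightarrow> (\<forall>X\<in>smooth_vfields A V. \<forall>Y\<in>smooth_vfields A V. \<forall>p\<in>V.
        lie_deriv A X (lie_deriv A Y f) p - lie_deriv A (nabla X Y) f p = 0))"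

text \<open>
  Real local coordinate systems \<open>(x\<^sup>1,\<dots>,x\<^sup>n,y\<^sub>1,\<dots>,y\<^sub>n)\<close> and holomorphic ones
  \<open>(z\<^sup>1,\<dots>,z\<^sup>n)\<close>: diffeomorphisms, respectively biholomorphic maps, from \<open>U\<close> onto an open set.
\<close>

definition real_coords ::
    "('a::topological_space, 'n::finite) chart set \<Rightarrow> 'a set \<Rightarrow>
     ('a \<Rightarrow> real^'n) \<Rightarrow> ('a \<Rightarrow> real^'n) \<Rightarrow> bool" where
  "real_coords A U x y \<longleftrightarrow> (let h = (\<lambda>p. (x p, y p)) in
     open U \<and> inj_on h U \<and> open (h ` U) \<and> smooth_fun A U h \<and>
     (\<forall>c\<in>A. smooth_on (h ` (U \<inter> fst c)) (snd c \<circ> inv_into U h)))"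

definition holomorphic_coords ::
    "('a::topological_space, 'n::finite) chart set \<Rightarrow> 'a set \<Rightarrow> ('a \<Rightarrow> complex^'n) \<Rightarrow> bool" where
  "holomorphic_coords A U z \<longleftrightarrow>
     open U \<and> inj_on z U \<and> open (z ` U) \<and> (\<forall>i. holomorphic_fun A U (\<lambda>p. z p $ i)) \<and>
     (\<forall>c\<in>A. holomorphic_map_on (z ` (U \<inter> fst c)) (snd c \<circ> inv_into U z))"

definition affine_coords ::
    "('a::topological_space, 'n::finite) chart set \<Rightarrow>
     (('a, 'n) vfield \<Rightarrow> ('a, 'n) vfield \<Rightarrow> ('a, 'n) vfield) \<Rightarrow>
     'a set \<Rightarrow> ('a \<Rightarrow> real^'n) \<Rightarrow> ('a \<Rightarrow> real^'n) \<Rightarrow> bool" where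
  "affine_coords A nabla U x y \<longleftrightarrow> real_coords A U x y \<and>
     (\<forall>i. affine_fun A nabla U (\<lambda>p. x p $ i) \<and> affine_fun A nabla U (\<lambda>p. y p $ i))"

text \<open>
  \<open>\<omega> = 2 \<Sum> dx\<^sup>i \<and> dy\<^sub>i\<close>, where \<open>(\<alpha> \<and> \<beta>)(u,v) = \<alpha>(u) \<beta>(v) - \<alpha>(v) \<beta>(u)\<close>.
\<close>

definition real_special_coords ::
    "('a::topological_space, 'n::finite) chart set \<Rightarrow>
     (('a, 'n) vfield \<Rightarrow> ('a, 'n) vfield \<Rightarrow> ('a, 'n) vfield) \<Rightarrow>
     ('a \<Rightarrow> ('a, 'n) tvec \<Rightarrow> ('a, 'n) tvec \<Rightarrow> real) \<Rightarrow>
     'a set \<Rightarrow> ('a \<Rightarrow> real^'n) \<Rightarrow> ('a \<Rightarrow> real^'n) \<Rightarrow> bool" where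
  "real_special_coords A nabla \<omega> U x y \<longleftrightarrow> affine_coords A nabla U x y \<and>
     (\<forall>p\<in>U. \<forall>u\<in>tangent_space A p. \<forall>v\<in>tangent_space A p.
        \<omega> p u v = 2 * (\<Sum>i\<in>UNIV.
          differential A (\<lambda>q. x q $ i) p u * differential A (\<lambda>q. y q $ i) p v -
          differential A (\<lambda>q. x q $ i) p v * differential A (\<lambda>q. y q $ i) p u))"

definition Re_vec :: "complex^'n \<Rightarrow> real^'n" where
  "Re_vec a = (\<chi> i. Re (a $ i))"

definition holomorphic_extension ::
    "('a::topological_space, 'n::finite) chart set \<Rightarrow> 'a set \<Rightarrow>
     ('a \<Rightarrow> real^'n) \<Rightarrow> ('a \<Rightarrow> real^'n) \<Rightarrow> ('a \<Rightarrow> complex^'n) \<Rightarrow> ('a \<Rightarrow> complex^'n) \<Rightarrow> bool" where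
  "holomorphic_extension A U x y z w \<longleftrightarrow>
     (\<forall>i. holomorphic_fun A U (\<lambda>q. z q $ i) \<and> holomorphic_fun A U (\<lambda>q. w q $ i)) \<and>
     (\<forall>q\<in>U. Re_vec (z q) = x q \<and> Re_vec (w q) = y q)"

definition conjugate_pair ::
    "('a::topological_space, 'n::finite) chart set \<Rightarrow>
     (('a, 'n) vfield \<Rightarrow> ('a, 'n) vfield \<Rightarrow> ('a, 'n) vfield) \<Rightarrow>
     ('a \<Rightarrow> ('a, 'n) tvec \<Rightarrow> ('a, 'n) tvec \<Rightarrow> real) \<Rightarrow>
     'a set \<Rightarrow> ('a \<Rightarrow> complex^'n) \<Rightarrow> ('a \<Rightarrow> complex^'n) \<Rightarrow> bool" where
  "conjugate_pair A nabla \<omega> U z w \<longleftrightarrow>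
     holomorphic_coords A U z \<and> holomorphic_coords A U w \<and>
     real_special_coords A nabla \<omega> U (\<lambda>q. Re_vec (z q)) (\<lambda>q. Re_vec (w q))"

definition std_symplectic :: "(real^'n) \<times> (real^'n) \<Rightarrow> (real^'n) \<times> (real^'n) \<Rightarrow> real" where
  "std_symplectic u v = fst u \<bullet> snd v - fst v \<bullet> snd u"

definition affine_symplectic ::
    "((real^'n) \<times> (real^'n) \<Rightarrow> (real^'n) \<times> (real^'n)) \<Rightarrow> bool" where
  "affine_symplectic g \<longleftrightarrow> (\<exists>L b. linear L \<and>
     (\<forall>u v. std_symplectic (L u) (L v) = std_symplectic u v) \<and> g = (\<lambda>u. L u + b))"

end

theory Submission
  imports Defs
begin

text \<open>
  In a complex chart a flat torsionfree connection is given by its Christoffel symbols \<open>\<Gamma>\<close>, and the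
  affine functions are the solutions of \<open>\<partial>\<^sub>a \<partial>\<^sub>b f = df (\<Gamma> a b)\<close>. This is a linear system of total
  differential equations for \<open>(df, f)\<close>, integrable since the curvature and the torsion vanish, so
  \<open>df\<close> can be prescribed at a point and then determines \<open>f\<close> up to a constant near it. Prescribing a
  symplectic coframe there gives \<open>\<omega> = 2 \<Sum> dx\<^sup>i \<and> dy\<^sub>i\<close> at the point, hence nearby, because both
  sides are parallel. The equation \<open>d\<^sup>\<nabla> J = 0\<close> says that \<open>\<Gamma> a (J b)\<close> is symmetric, so that
  \<open>df \<circ> J\<close> is closed for affine \<open>f\<close>; a primitive of \<open>- df \<circ> J\<close> is the imaginary part of the
  holomorphic extension. In the Kaehler case the coframe is dual to a frame \<open>(e\<^sub>i, f\<^sub>i)\<close> with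
  \<open>f\<^sub>i\<close> a multiple of \<open>J e\<^sub>i\<close>; both Lagrangian subspaces are then totally real, so the two
  holomorphic extensions are local coordinates.
\<close>

section \<open>Smooth maps\<close>

text \<open>The definitions quantify over all charts, all open sets and all smooth fields, and their
  objects are total functions that matter only on a domain. Everything is therefore carried to a
  single chart around the given point, where the connection reads
  \<open>DY X + \<Gamma> X Y\<close>, and carried back at the end; on a set inside one chart domain
  the quantifier over charts collapses by the chain rule. The local analysis then rests on one
  existence theorem and one uniqueness lemma for linear systems. Linearity matters twice: the ball
  on which solutions exist does not depend on the initial value, so finitely many affine functions
  share a domain and form one vector-valued map; and on short rays or small balls an estimate of the
  form \<open>M \<le> M / 2 + e\<close> replaces an exponential one. The uniqueness lemma yields
  both the rigidity of affine functions and the passage from an identity of parallel forms at a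
  point to one nearby. In the Kaehler case \<open>\<omega> a (J a)\<close> may be negative, so that
  no rescaling of \<open>a\<close> makes \<open>J a\<close> itself its partner; this is why only a
  multiple of \<open>J e\<^sub>i\<close> is asked for.\<close>

abbreviation FD :: "('v::real_normed_vector \<Rightarrow> 'w::real_normed_vector) \<Rightarrow> 'v \<Rightarrow> 'v \<Rightarrow> 'w" where
  "FD f x \<equiv> frechet_derivative f (at x)"

lemma FD_eqI: "(f has_derivative f') (at x) \<Longrightarrow> FD f x = f'"
  using frechet_derivative_at by metis

lemma FD_works: "f differentiable (at x) \<Longrightarrow> (f has_derivative FD f x) (at x)"
  by (simp add: frechet_derivative_works)

lemma has_derivative_cong_open:
  assumes "open S" "x \<in> S" "\<And>y. y \<in> S \<Longrightarrow> f y = g y"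
  shows "(f has_derivative f') (at x) \<longleftrightarrow> (g has_derivative f') (at x)"
  using assms has_derivative_transform_within_open[of f f' x UNIV S g]
    has_derivative_transform_within_open[of g f' x UNIV S f] by fastforce

lemma FD_cong_open:
  assumes "open S" "x \<in> S" "\<And>y. y \<in> S \<Longrightarrow> f y = g y"
  shows "FD f x = FD g x"
  unfolding frechet_derivative_def using has_derivative_cong_open[OF assms] by simp

lemma differentiable_cong_open:
  assumes "open S" "x \<in> S" "\<And>y. y \<in> S \<Longrightarrow> f y = g y"
  shows "f differentiable (at x) \<longleftrightarrow> g differentiable (at x)"
  unfolding differentiable_def using has_derivative_cong_open[OF assms] by simp

lemma Ck_on_cong:
  assumes "open S" "\<And>x. x \<in> S \<Longrightarrow> f x = g x"
  shows "Ck_on k S f \<longleftrightarrow> Ck_on k S g"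
  using assms(2)
proof (induction k arbitrary: f g)
  case 0
  then show ?case by (simp cong: continuous_on_cong)
next
  case (Suc k)
  have "Ck_on k S (\<lambda>x. FD f x v) = Ck_on k S (\<lambda>x. FD g x v)" for v
    by (rule Suc.IH) (metis FD_cong_open Suc.prems assms(1))
  then show ?case
    using differentiable_cong_open[OF assms(1) _ Suc.prems] by auto
qed

lemma Ck_on_subset: "Ck_on k S f \<Longrightarrow> T \<subseteq> S \<Longrightarrow> Ck_on k T f"
  by (induction k arbitrary: f) (auto intro: continuous_on_subset)

text \<open>\<open>Ck_on (Suc k)\<close> asks for differentiability and for \<open>C^k\<close>
  directional derivatives, not for continuity of the function itself; continuity has to come from
  differentiability, which is the base case.\<close>

lemma Ck_on_SucD: "Ck_on (Suc k) S f \<Longrightarrow> Ck_on k S f"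
proof (induction k arbitrary: f)
  case 0
  then show ?case
    by (auto intro!: continuous_at_imp_continuous_on differentiable_imp_continuous_within)
next
  case (Suc k)
  then show ?case by (metis Ck_on.simps(2))
qed

text \<open>Any explicit formula for the derivative may replace \<open>FD\<close>. Openness enters
  because the recursion differentiates again and has to see the formula on a whole
  neighbourhood.\<close>

lemma Ck_on_SucI:
  assumes "\<And>x. x \<in> S \<Longrightarrow> (f has_derivative f' x) (at x)"
    and "\<And>v. Ck_on k S (\<lambda>x. f' x v)" "open S"
  shows "Ck_on (Suc k) S f"
proof -
  have "Ck_on k S (\<lambda>x. FD f x v)" for v
    using Ck_on_cong[OF assms(3), of "\<lambda>x. FD f x v" "\<lambda>x. f' x v" k] assms(2) FD_eqI[OF assms(1)]
    by simp
  moreover have "f differentiable (at x)" if "x \<in> S" for x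
    using assms(1)[OF that] by (rule differentiableI)
  ultimately show ?thesis by simp
qed

lemma Ck_on_const [simp]: "Ck_on k S (\<lambda>x. c)"
  by (induction k arbitrary: c) (auto simp: FD_eqI[OF has_derivative_const])

lemma Ck_on_bounded_linear:
  assumes "bounded_linear L"
  shows "Ck_on k S L"
proof (cases k)
  case 0
  then show ?thesis by (simp add: assms linear_continuous_on)
next
  case (Suc j)
  have d: "(L has_derivative L) (at x)" for x
    by (simp add: assms bounded_linear_imp_has_derivative)
  then have "L differentiable (at x)" for x by (rule differentiableI)
  then show ?thesis using Suc FD_eqI[OF d] by simp
qed

lemma Ck_on_linear_compose:
  assumes "open S" "bounded_linear L" "Ck_on k S f"
  shows "Ck_on k S (\<lambda>x. L (f x))"
  using assms(3)
proof (induction k arbitrary: f)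
  case 0
  then show ?case using bounded_linear.continuous_on[OF assms(2)] by auto
next
  case (Suc k)
  show ?case
  proof (rule Ck_on_SucI[OF _ _ assms(1)])
    show "((\<lambda>x. L (f x)) has_derivative (\<lambda>v. L (FD f x v))) (at x)" if "x \<in> S" for x
      using that Suc.prems by (intro bounded_linear.has_derivative[OF assms(2)] FD_works) auto
  qed (use Suc in auto)
qed

lemma Ck_on_add:
  assumes "open S" "Ck_on k S f" "Ck_on k S g"
  shows "Ck_on k S (\<lambda>x. f x + g x)"
  using assms(2,3)
proof (induction k arbitrary: f g)
  case 0
  then show ?case by (auto intro: continuous_intros)
next
  case (Suc k)
  show ?case
  proof (rule Ck_on_SucI[OF _ _ assms(1)])
    show "((\<lambda>x. f x + g x) has_derivative (\<lambda>v. FD f x v + FD g x v)) (at x)" if "x \<in> S" for x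
      using that Suc.prems by (intro has_derivative_add FD_works) auto
  qed (use Suc in auto)
qed

lemma Ck_on_bilinear:
  assumes "open S" "bounded_bilinear B" "Ck_on k S f" "Ck_on k S g"
  shows "Ck_on k S (\<lambda>x. B (f x) (g x))"
  using assms(3,4)
proof (induction k arbitrary: f g)
  case 0
  then show ?case using bounded_bilinear.continuous_on[OF assms(2)] by auto
next
  case (Suc k)
  show ?case
  proof (rule Ck_on_SucI[OF _ _ assms(1)])
    show "((\<lambda>x. B (f x) (g x)) has_derivative (\<lambda>v. B (f x) (FD g x v) + B (FD f x v) (g x))) (at x)"
      if "x \<in> S" for x
      using that Suc.prems by (intro bounded_bilinear.FDERIV[OF assms(2)] FD_works) auto
    show "Ck_on k S (\<lambda>x. B (f x) (FD g x v) + B (FD f x v) (g x))" for v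
      using Suc.prems Ck_on_SucD[OF Suc.prems(1)] Ck_on_SucD[OF Suc.prems(2)]
      by (intro Ck_on_add[OF assms(1)] Suc.IH) auto
  qed
qed

lemma Ck_on_sum:
  assumes "open S" "\<And>i. i \<in> I \<Longrightarrow> Ck_on k S (f i)"
  shows "Ck_on k S (\<lambda>x. \<Sum>i\<in>I. f i x)"
  using assms(2)
proof (induction I rule: infinite_finite_induct)
  case (insert i I)
  then show ?case using Ck_on_add[OF assms(1), of k "f i" "\<lambda>x. sum (\<lambda>i. f i x) I"] by auto
qed auto

lemma linear_basis_expansion:
  fixes L :: "'v::euclidean_space \<Rightarrow> 'w::real_vector"
  assumes "linear L"
  shows "L v = (\<Sum>b\<in>Basis. (v \<bullet> b) *\<^sub>R L b)"
proof -
  have "L v = L (\<Sum>b\<in>Basis. (v \<bullet> b) *\<^sub>R b)" by (simp add: euclidean_representation)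
  then show ?thesis using assms by (simp add: linear_sum linear_scale)
qed

text \<open>In the chain rule the direction \<open>FD f x v\<close> moves with \<open>x\<close>,
  while the induction hypothesis, like \<open>Ck_on\<close> itself, speaks of fixed directions.
  Expanding in a basis leaves fixed directions \<open>b\<close> with scalar coefficients, which is
  why the intermediate space is euclidean.\<close>

lemma Ck_on_compose:
  fixes f :: "'u::real_normed_vector \<Rightarrow> 'v::euclidean_space" and g :: "'v \<Rightarrow> 'w::real_normed_vector"
  assumes "open S" "Ck_on k S f" "Ck_on k T g" "f ` S \<subseteq> T"
  shows "Ck_on k S (\<lambda>x. g (f x))"
  using assms(2,3)
proof (induction k arbitrary: g)
  case 0
  then show ?case using assms(4) continuous_on_compose2 by auto
next
  case (Suc k)
  have fT: "f x \<in> T" if "x \<in> S" for x using that assms(4) by auto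
  show ?case
  proof (rule Ck_on_SucI[OF _ _ assms(1)])
    fix x assume x: "x \<in> S"
    have d: "(f has_derivative FD f x) (at x)" "(g has_derivative FD g (f x)) (at (f x))"
      using x fT[OF x] Suc.prems by (simp_all add: FD_works)
    have "((\<lambda>x. g (f x)) has_derivative (\<lambda>v. FD g (f x) (FD f x v))) (at x)"
      using diff_chain_at[OF d] by (simp add: o_def)
    moreover have "FD g (f x) (FD f x v) = (\<Sum>b\<in>Basis. (FD f x v \<bullet> b) *\<^sub>R FD g (f x) b)" for v
      by (rule linear_basis_expansion[OF has_derivative_linear[OF d(2)]])
    ultimately show "((\<lambda>x. g (f x)) has_derivative
        (\<lambda>v. \<Sum>b\<in>Basis. (FD f x v \<bullet> b) *\<^sub>R FD g (f x) b)) (at x)"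
      by simp
  next
    fix v
    have "Ck_on k S (\<lambda>x. FD g (f x) b)" for b
      using Suc.prems by (intro Suc.IH Ck_on_SucD[OF Suc.prems(1)]) auto
    then show "Ck_on k S (\<lambda>x. \<Sum>b\<in>Basis. (FD f x v \<bullet> b) *\<^sub>R FD g (f x) b)"
      using Suc.prems
      by (intro Ck_on_sum[OF assms(1)] Ck_on_bilinear[OF assms(1) bounded_bilinear_scaleR]
          Ck_on_linear_compose[OF assms(1) bounded_linear_inner_left]) auto
  qed
qed

lemma smooth_on_cong:
  "open S \<Longrightarrow> (\<And>x. x \<in> S \<Longrightarrow> f x = g x) \<Longrightarrow> smooth_on S f \<longleftrightarrow> smooth_on S g"
  using Ck_on_cong[of S f g] by (simp add: smooth_on_def)

lemma smooth_on_subset: "smooth_on S f \<Longrightarrow> T \<subseteq> S \<Longrightarrow> smooth_on T f"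
  using Ck_on_subset[of _ S f T] by (simp add: smooth_on_def)

lemma smooth_on_const [simp]: "smooth_on S (\<lambda>x. c)"
  by (simp add: smooth_on_def)

lemma smooth_on_bounded_linear: "bounded_linear L \<Longrightarrow> smooth_on S L"
  by (simp add: smooth_on_def Ck_on_bounded_linear)

lemma smooth_on_linear_compose:
  "open S \<Longrightarrow> bounded_linear L \<Longrightarrow> smooth_on S f \<Longrightarrow> smooth_on S (\<lambda>x. L (f x))"
  by (simp add: smooth_on_def Ck_on_linear_compose)

lemma smooth_on_add:
  "open S \<Longrightarrow> smooth_on S f \<Longrightarrow> smooth_on S g \<Longrightarrow> smooth_on S (\<lambda>x. f x + g x)"
  by (simp add: smooth_on_def Ck_on_add)

lemma smooth_on_bilinear:
  "open S \<Longrightarrow> bounded_bilinear B \<Longrightarrow> smooth_on S f \<Longrightarrow> smooth_on S g \<Longrightarrow>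
    smooth_on S (\<lambda>x. B (f x) (g x))"
  by (simp add: smooth_on_def Ck_on_bilinear)

lemma smooth_on_diff:
  assumes "open S" "smooth_on S f" "smooth_on S g"
  shows "smooth_on S (\<lambda>x. f x - g x)"
  using smooth_on_add[OF assms(1,2) smooth_on_linear_compose[OF assms(1) _ assms(3), of uminus]]
  by (simp add: bounded_linear_minus[OF bounded_linear_ident])

lemma smooth_on_sum:
  "open S \<Longrightarrow> (\<And>i. i \<in> I \<Longrightarrow> smooth_on S (f i)) \<Longrightarrow> smooth_on S (\<lambda>x. \<Sum>i\<in>I. f i x)"
  by (simp add: smooth_on_def Ck_on_sum)

lemma smooth_on_compose:
  fixes f :: "'u::real_normed_vector \<Rightarrow> 'v::euclidean_space"
  shows "open S \<Longrightarrow> smooth_on S f \<Longrightarrow> smooth_on T g \<Longrightarrow> f ` S \<subseteq> T \<Longrightarrow>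
    smooth_on S (\<lambda>x. g (f x))"
  using Ck_on_compose[of S _ f T g] by (simp add: smooth_on_def)

lemma smooth_on_differentiable: "smooth_on S f \<Longrightarrow> x \<in> S \<Longrightarrow> f differentiable (at x)"
  using Ck_on.simps(2)[of 0 S f] unfolding smooth_on_def by blast

lemma smooth_on_has_derivative: "smooth_on S f \<Longrightarrow> x \<in> S \<Longrightarrow> (f has_derivative FD f x) (at x)"
  by (simp add: smooth_on_differentiable FD_works)

lemma smooth_on_linear_FD: "smooth_on S f \<Longrightarrow> x \<in> S \<Longrightarrow> linear (FD f x)"
  by (rule has_derivative_linear[OF smooth_on_has_derivative])

lemma smooth_on_FD: "smooth_on S f \<Longrightarrow> smooth_on S (\<lambda>x. FD f x v)"
  by (simp add: smooth_on_def del: Ck_on.simps) (metis Ck_on.simps(2))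

lemma smooth_on_continuous: "smooth_on S f \<Longrightarrow> continuous_on S f"
  using Ck_on.simps(1)[of S f] unfolding smooth_on_def by metis

lemma smooth_onI_FD:
  assumes "\<And>x. x \<in> S \<Longrightarrow> (f has_derivative f' x) (at x)" "\<And>v. smooth_on S (\<lambda>x. f' x v)" "open S"
  shows "smooth_on S f"
  unfolding smooth_on_def
proof
  fix k
  have "Ck_on (Suc k) S f"
    using assms by (intro Ck_on_SucI) (auto simp: smooth_on_def)
  then show "Ck_on k S f" by (rule Ck_on_SucD)
qed

section \<open>Families of linear maps depending on a point\<close>

lemma Ck_on_apply:
  fixes L :: "'u::real_normed_vector \<Rightarrow> 'v::euclidean_space \<Rightarrow> 'w::real_normed_vector"
  assumes "open S" "\<And>u. u \<in> S \<Longrightarrow> linear (L u)" "\<And>b. Ck_on k S (\<lambda>u. L u b)" "Ck_on k S Y"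
  shows "Ck_on k S (\<lambda>u. L u (Y u))"
proof -
  have "Ck_on k S (\<lambda>u. \<Sum>b\<in>Basis. (Y u \<bullet> b) *\<^sub>R L u b)"
    using assms
    by (intro Ck_on_sum Ck_on_bilinear[OF _ bounded_bilinear_scaleR]
          Ck_on_linear_compose[OF _ bounded_linear_inner_left])
  then show ?thesis
    by (rule Ck_on_cong[OF assms(1), THEN iffD2, rotated]) (rule linear_basis_expansion[OF assms(2)])
qed

lemma smooth_on_apply:
  fixes L :: "'u::real_normed_vector \<Rightarrow> 'v::euclidean_space \<Rightarrow> 'w::real_normed_vector"
  shows "open S \<Longrightarrow> (\<And>u. u \<in> S \<Longrightarrow> linear (L u)) \<Longrightarrow> (\<And>b. smooth_on S (\<lambda>u. L u b)) \<Longrightarrow>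
    smooth_on S Y \<Longrightarrow> smooth_on S (\<lambda>u. L u (Y u))"
  by (simp add: smooth_on_def Ck_on_apply)

text \<open>Families of linear maps are described by their values on fixed vectors, not as points of
  an operator space. Expanding \<open>Y u\<close> in a basis reduces the product rule to scalars
  times such values; linearity of \<open>L' b a\<close> in \<open>b\<close> reassembles the
  sum.\<close>

lemma has_derivative_apply_within:
  fixes L :: "'u::real_normed_vector \<Rightarrow> 'v::euclidean_space \<Rightarrow> 'w::real_normed_vector"
  assumes lin: "\<And>u. u \<in> S \<Longrightarrow> linear (L u)" and lin': "\<And>a. linear (\<lambda>b. L' b a)" and x: "x \<in> S"
    and L: "\<And>b. ((\<lambda>u. L u b) has_derivative L' b) (at x within S)"
    and Y: "(Y has_derivative Y') (at x within S)"
  shows "((\<lambda>u. L u (Y u)) has_derivative (\<lambda>a. L' (Y x) a + L x (Y' a))) (at x within S)"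
proof -
  have D: "((\<lambda>u. \<Sum>b\<in>Basis. (Y u \<bullet> b) *\<^sub>R L u b) has_derivative
      (\<lambda>a. \<Sum>b\<in>Basis. (Y x \<bullet> b) *\<^sub>R L' b a + (Y' a \<bullet> b) *\<^sub>R L x b)) (at x within S)"
    by (intro has_derivative_sum has_derivative_scaleR has_derivative_inner_left Y L)
  have "L' (Y x) a + L x (Y' a) = (\<Sum>b\<in>Basis. (Y x \<bullet> b) *\<^sub>R L' b a + (Y' a \<bullet> b) *\<^sub>R L x b)" for a
    unfolding sum.distrib
    by (intro arg_cong2[where f="(+)"] linear_basis_expansion[OF lin[OF x]]
        linear_basis_expansion[OF lin'])
  then have "((\<lambda>u. \<Sum>b\<in>Basis. (Y u \<bullet> b) *\<^sub>R L u b) has_derivative (\<lambda>a. L' (Y x) a + L x (Y' a)))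
      (at x within S)"
    using D by simp
  then show ?thesis
    by (rule has_derivative_transform[OF x, rotated]) (rule linear_basis_expansion[OF lin])
qed

text \<open>Linear relations between the functions \<open>\<lambda>u. L u b\<close> hold for all
  \<open>u\<close> near \<open>x\<close>, so they may be differentiated in \<open>u\<close>. This
  supplies the linearity of the derivative family that the product rule and the bilinear estimates
  ask for.\<close>

lemma linear_FD_param:
  fixes L :: "'u::real_normed_vector \<Rightarrow> 'v::real_vector \<Rightarrow> 'w::real_normed_vector"
  assumes "open S" "\<And>u. u \<in> S \<Longrightarrow> linear (L u)" "x \<in> S" "\<And>b. (\<lambda>u. L u b) differentiable (at x)"
  shows "linear (\<lambda>b. FD (\<lambda>u. L u b) x a)"
proof (rule linearI)
  note D = FD_works[OF assms(4)]
  fix b c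
  have "((\<lambda>u. L u (b + c)) has_derivative (\<lambda>a. FD (\<lambda>u. L u b) x a + FD (\<lambda>u. L u c) x a)) (at x)"
    by (rule has_derivative_cong_open[OF assms(1,3), THEN iffD1, OF _ has_derivative_add[OF D D]])
      (simp add: linear_add[OF assms(2)])
  then show "FD (\<lambda>u. L u (b + c)) x a = FD (\<lambda>u. L u b) x a + FD (\<lambda>u. L u c) x a"
    by (simp add: FD_eqI)
next
  note D = FD_works[OF assms(4)]
  fix r b
  have "((\<lambda>u. L u (r *\<^sub>R b)) has_derivative (\<lambda>a. r *\<^sub>R FD (\<lambda>u. L u b) x a)) (at x)"
    by (rule has_derivative_cong_open[OF assms(1,3), THEN iffD1, OF _ has_derivative_scaleR_right[OF D]])
      (simp add: linear_scale[OF assms(2)])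
  then show "FD (\<lambda>u. L u (r *\<^sub>R b)) x a = r *\<^sub>R FD (\<lambda>u. L u b) x a"
    by (simp add: FD_eqI)
qed

lemma has_derivative_apply:
  fixes L :: "'u::real_normed_vector \<Rightarrow> 'v::euclidean_space \<Rightarrow> 'w::real_normed_vector"
  assumes "open S" "\<And>u. u \<in> S \<Longrightarrow> linear (L u)" "x \<in> S"
    and L: "\<And>b. (\<lambda>u. L u b) differentiable (at x)" and Y: "(Y has_derivative Y') (at x)"
  shows "((\<lambda>u. L u (Y u)) has_derivative (\<lambda>a. FD (\<lambda>u. L u (Y x)) x a + L x (Y' a))) (at x)"
proof -
  have "((\<lambda>u. L u (Y u)) has_derivative (\<lambda>a. FD (\<lambda>u. L u (Y x)) x a + L x (Y' a))) (at x within S)"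
    by (rule has_derivative_apply_within[OF assms(2) linear_FD_param[OF assms(1-3) L] assms(3)])
      (auto intro!: has_derivative_at_withinI FD_works L Y)
  then show ?thesis using at_within_open[OF assms(3,1)] by simp
qed

lemma smooth_on_euclidean:
  fixes f :: "'u::real_normed_vector \<Rightarrow> 'v::euclidean_space"
  assumes "open S" "\<And>b. b \<in> Basis \<Longrightarrow> smooth_on S (\<lambda>x. f x \<bullet> b)"
  shows "smooth_on S f"
proof -
  have "smooth_on S (\<lambda>x. \<Sum>b\<in>Basis. (f x \<bullet> b) *\<^sub>R b)"
    using assms by (intro smooth_on_sum smooth_on_linear_compose[OF _ bounded_linear_scaleR_left])
  then show ?thesis by (simp add: euclidean_representation)
qed

lemma smooth_on_Pair:
  fixes f :: "'u::real_normed_vector \<Rightarrow> 'v::real_normed_vector" and g :: "'u \<Rightarrow> 'w::real_normed_vector"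
  assumes "open S" "smooth_on S f" "smooth_on S g"
  shows "smooth_on S (\<lambda>x. (f x, g x))"
proof -
  have "smooth_on S (\<lambda>x. (f x, 0) + (0, g x))"
    using assms
    by (intro smooth_on_add smooth_on_linear_compose[where L="\<lambda>x. (x,0)"]
          smooth_on_linear_compose[where L="\<lambda>x. (0,x)"] bounded_linear_Pair) auto
  then show ?thesis by simp
qed

lemma smooth_on_vec:
  fixes f :: "'u::real_normed_vector \<Rightarrow> 'v::euclidean_space ^ 'n"
  assumes "open S" "\<And>i. smooth_on S (\<lambda>x. f x $ i)"
  shows "smooth_on S f"
proof (rule smooth_on_euclidean[OF assms(1)])
  fix b :: "'v ^ 'n" assume "b \<in> Basis"
  then obtain i a where "b = axis i a" by (auto simp: Basis_vec_def)
  then show "smooth_on S (\<lambda>x. f x \<bullet> b)"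
    using smooth_on_linear_compose[OF assms(1) bounded_linear_inner_left[of a] assms(2)[of i]]
    by (simp add: inner_axis)
qed

section \<open>Local bounds for smooth families\<close>

lemma linear_norm_le_Basis:
  fixes L :: "'v::euclidean_space \<Rightarrow> 'w::real_normed_vector"
  assumes "linear L" "\<And>b. b \<in> Basis \<Longrightarrow> norm (L b) \<le> K b"
  shows "norm (L v) \<le> (\<Sum>b\<in>Basis. K b) * norm v"
proof -
  have "norm (L v) \<le> (\<Sum>b\<in>Basis. norm ((v \<bullet> b) *\<^sub>R L b))"
    by (subst linear_basis_expansion[OF assms(1)]) (rule norm_sum)
  also have "\<dots> \<le> (\<Sum>b\<in>Basis. K b * norm v)"
  proof (rule sum_mono)
    fix b :: 'v assume "b \<in> Basis"
    then show "norm ((v \<bullet> b) *\<^sub>R L b) \<le> K b * norm v"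
      using mult_mono[OF Basis_le_norm[of b v] assms(2)[of b]] by (simp add: mult.commute)
  qed
  finally show ?thesis by (simp add: sum_distrib_right)
qed

text \<open>Compactness of the ball bounds \<open>f\<close> and its directional derivatives, and
  convexity turns the latter bound into a Lipschitz estimate by the mean value inequality. The sum
  of the two bounds serves as a single constant.\<close>

lemma smooth_on_lipschitz_cball:
  fixes f :: "'v::euclidean_space \<Rightarrow> 'w::real_normed_vector"
  assumes f: "smooth_on S f" and S: "open S" "cball p R \<subseteq> S"
  obtains K where "K \<ge> 0" "\<And>u. u \<in> cball p R \<Longrightarrow> norm (f u) \<le> K"
    "\<And>u a. u \<in> cball p R \<Longrightarrow> norm (FD f u a) \<le> K * norm a"
    "\<And>u u'. u \<in> cball p R \<Longrightarrow> u' \<in> cball p R \<Longrightarrow> norm (f u' - f u) \<le> K * norm (u' - u)"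
proof -
  have bdd: "\<exists>K\<ge>0. \<forall>u\<in>cball p R. norm (g u) \<le> K" if "smooth_on S g" for g :: "'v \<Rightarrow> 'w"
  proof -
    have "compact (g ` cball p R)"
      using smooth_on_continuous[OF that] S(2) by (intro compact_continuous_image)
        (auto intro: continuous_on_subset)
    then obtain K where "\<forall>x\<in>g ` cball p R. norm x \<le> K"
      using compact_imp_bounded bounded_iff by metis
    then show ?thesis by (intro exI[of _ "max 0 K"]) auto
  qed
  obtain K0 where K0: "K0 \<ge> 0" "\<forall>u\<in>cball p R. norm (f u) \<le> K0" using bdd[OF f] by auto
  obtain k where k: "\<And>b. k b \<ge> 0" "\<And>b u. u \<in> cball p R \<Longrightarrow> norm (FD f u b) \<le> k b"
    using bdd[OF smooth_on_FD[OF f]] by metis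
  define K1 where "K1 = (\<Sum>b\<in>Basis. k b)"
  have K1: "K1 \<ge> 0" unfolding K1_def by (simp add: k(1) sum_nonneg)
  have d: "norm (FD f u a) \<le> K1 * norm a" if "u \<in> cball p R" for u a
    unfolding K1_def
    by (rule linear_norm_le_Basis[OF smooth_on_linear_FD[OF f subsetD[OF S(2) that]]]) (rule k(2)[OF that])
  have l: "norm (f u' - f u) \<le> K1 * norm (u' - u)" if "u \<in> cball p R" "u' \<in> cball p R" for u u'
  proof (rule differentiable_bound[OF convex_cball _ _ that(2,1), where f'="FD f"])
    fix x assume x: "x \<in> cball p R"
    show "(f has_derivative FD f x) (at x within cball p R)"
      by (rule has_derivative_at_withinI[OF smooth_on_has_derivative[OF f subsetD[OF S(2) x]]])
    show "onorm (FD f x) \<le> K1" using d[OF x] by (intro onorm_le) auto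
  qed
  show ?thesis
  proof (rule that[of "K0 + K1"])
    show "norm (f u) \<le> K0 + K1" if "u \<in> cball p R" for u
      using K0(2) K1 that by fastforce
    show "norm (FD f u a) \<le> (K0 + K1) * norm a" if "u \<in> cball p R" for u a
      using d[OF that, of a] K0(1) by (simp add: distrib_right add_increasing)
    show "norm (f u' - f u) \<le> (K0 + K1) * norm (u' - u)" if "u \<in> cball p R" "u' \<in> cball p R" for u u'
      using l[OF that] K0(1) by (simp add: distrib_right add_increasing)
  qed (use K0 K1 in simp)
qed

lemma smooth_on_taylor_cball:
  fixes f :: "'v::euclidean_space \<Rightarrow> 'w::real_normed_vector"
  assumes f: "smooth_on S f" and S: "open S" "cball p R \<subseteq> S"
  obtains K where "K \<ge> 0"
    "\<And>u u'. u \<in> cball p R \<Longrightarrow> u' \<in> cball p R \<Longrightarrow>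
      norm (f u' - f u - FD f u (u' - u)) \<le> K * (norm (u' - u))\<^sup>2"
proof -
  have "\<exists>K\<ge>0. \<forall>u\<in>cball p R. \<forall>u'\<in>cball p R. norm (FD f u' b - FD f u b) \<le> K * norm (u' - u)" for b
    using smooth_on_lipschitz_cball[OF smooth_on_FD[OF f] S] by metis
  then obtain k where k: "\<And>b. k b \<ge> 0" "\<And>b u u'. u \<in> cball p R \<Longrightarrow> u' \<in> cball p R \<Longrightarrow>
      norm (FD f u' b - FD f u b) \<le> k b * norm (u' - u)" by metis
  define K where "K = (\<Sum>b\<in>Basis. k b)"
  have K: "K \<ge> 0" unfolding K_def by (simp add: k(1) sum_nonneg)
  have "norm (f u' - f u - FD f u (u' - u)) \<le> K * (norm (u' - u))\<^sup>2"
    if u: "u \<in> cball p R" "u' \<in> cball p R" for u u'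
  proof -
    \<comment> \<open>Both balls are convex and contain \<open>u\<close> and \<open>u'\<close>. On
      their intersection the differentials at \<open>x\<close> and \<open>u\<close> differ by at
      most \<open>K * norm (u' - u)\<close>, so the mean value inequality for \<open>f\<close> minus
      its linearisation at \<open>u\<close> gives a quadratic remainder.\<close>
    define C where "C = cball p R \<inter> cball u (norm (u' - u))"
    note lin = smooth_on_linear_FD[OF f subsetD[OF S(2)]]
    note hd = smooth_on_has_derivative[OF f subsetD[OF S(2)]]
    have "norm ((f u' - FD f u u') - (f u - FD f u u)) \<le> (K * norm (u' - u)) * norm (u' - u)"
    proof (rule differentiable_bound[where S=C and f'="\<lambda>x v. FD f x v - FD f u v"])
      show "convex C" unfolding C_def by (intro convex_Int convex_cball)
      show "u' \<in> C" "u \<in> C" using u by (auto simp: C_def dist_norm norm_minus_commute)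
      fix x assume x: "x \<in> C"
      have xR: "x \<in> cball p R" using x by (simp add: C_def)
      show "((\<lambda>x. f x - FD f u x) has_derivative (\<lambda>v. FD f x v - FD f u v)) (at x within C)"
        by (rule has_derivative_diff[OF has_derivative_at_withinI[OF hd[OF xR]]
              bounded_linear_imp_has_derivative[OF has_derivative_bounded_linear[OF hd[OF u(1)]]]])
      show "onorm (\<lambda>v. FD f x v - FD f u v) \<le> K * norm (u' - u)"
      proof (rule onorm_le)
        fix v
        have "norm (FD f x v - FD f u v) \<le> (\<Sum>b\<in>Basis. k b * norm (x - u)) * norm v"
          by (rule linear_norm_le_Basis[OF linear_compose_sub[OF lin[OF xR] lin[OF u(1)]]]) (rule k(2)[OF u(1) xR])
        also have "\<dots> = K * norm (x - u) * norm v" by (simp add: K_def sum_distrib_right)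
        also have "\<dots> \<le> K * norm (u' - u) * norm v"
          using x K by (intro mult_right_mono mult_left_mono) (auto simp: C_def dist_norm norm_minus_commute)
        finally show "norm (FD f x v - FD f u v) \<le> K * norm (u' - u) * norm v" .
      qed
    qed
    moreover have "f u' - f u - FD f u (u' - u) = (f u' - FD f u u') - (f u - FD f u u)"
      by (simp add: linear_diff[OF lin[OF u(1)]])
    ultimately show ?thesis by (simp only: power2_eq_square mult.assoc)
  qed
  then show ?thesis using that[OF K] by blast
qed

lemma bilinear_norm_le_Basis:
  fixes B :: "'v::euclidean_space \<Rightarrow> 'f::euclidean_space \<Rightarrow> 'w::real_normed_vector"
  assumes "\<And>s. linear (\<lambda>a. B a s)" "\<And>a. linear (B a)"
    "\<And>b c. b \<in> Basis \<Longrightarrow> c \<in> Basis \<Longrightarrow> norm (B b c) \<le> K b c"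
  shows "norm (B a s) \<le> (\<Sum>b\<in>Basis. \<Sum>c\<in>Basis. K b c) * norm a * norm s"
proof -
  have "norm (B b s) \<le> (\<Sum>c\<in>Basis. K b c) * norm s" if "b \<in> Basis" for b
    using assms(3)[OF that] by (rule linear_norm_le_Basis[OF assms(2)])
  then have "norm (B a s) \<le> (\<Sum>b\<in>Basis. (\<Sum>c\<in>Basis. K b c) * norm s) * norm a"
    by (rule linear_norm_le_Basis[OF assms(1)])
  also have "(\<Sum>b\<in>Basis. (\<Sum>c\<in>Basis. K b c) * norm s) = (\<Sum>b\<in>Basis. \<Sum>c\<in>Basis. K b c) * norm s"
    by (rule sum_distrib_right[symmetric])
  finally show ?thesis by (simp add: mult_ac)
qed

text \<open>The estimates are obtained for basis vectors in both slots and extended bilinearly;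
  adding all constants gives one \<open>K\<close> that is uniform in the point, with the bounds
  homogeneous in \<open>a\<close> and \<open>s\<close>. These are the bounds that the error terms of
  the integrability argument consume.\<close>

lemma bilinear_family_bounds:
  fixes G :: "'v::euclidean_space \<Rightarrow> 'v \<Rightarrow> 'f::euclidean_space \<Rightarrow> 'w::real_normed_vector"
  assumes S: "open S" "cball p R \<subseteq> S"
    and lin: "\<And>u s. u \<in> S \<Longrightarrow> linear (\<lambda>a. G u a s)" "\<And>u a. u \<in> S \<Longrightarrow> linear (G u a)"
    and sm: "\<And>a s. smooth_on S (\<lambda>u. G u a s)"
  obtains K where "K \<ge> 0"
    "\<And>u a s. u \<in> cball p R \<Longrightarrow> norm (G u a s) \<le> K * norm a * norm s"
    "\<And>u h a s. u \<in> cball p R \<Longrightarrow> norm (FD (\<lambda>w. G w a s) u h) \<le> K * norm h * norm a * norm s"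
    "\<And>u u' a s. u \<in> cball p R \<Longrightarrow> u' \<in> cball p R \<Longrightarrow>
      norm (G u' a s - G u a s) \<le> K * norm (u' - u) * norm a * norm s"
    "\<And>u u' a s. u \<in> cball p R \<Longrightarrow> u' \<in> cball p R \<Longrightarrow>
      norm (G u' a s - G u a s - FD (\<lambda>w. G w a s) u (u' - u)) \<le> K * (norm (u' - u))\<^sup>2 * norm a * norm s"
proof -
  have "\<exists>K\<ge>0. \<forall>u\<in>cball p R. \<forall>u'\<in>cball p R. \<forall>h. norm (G u b c) \<le> K \<and>
      norm (FD (\<lambda>w. G w b c) u h) \<le> K * norm h \<and>
      norm (G u' b c - G u b c) \<le> K * norm (u' - u)" for b c
    using smooth_on_lipschitz_cball[OF sm S, of b c] by metis
  then obtain k where k: "\<And>b c. k b c \<ge> 0" "\<And>b c u. u \<in> cball p R \<Longrightarrow> norm (G u b c) \<le> k b c"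
      "\<And>b c u h. u \<in> cball p R \<Longrightarrow> norm (FD (\<lambda>w. G w b c) u h) \<le> k b c * norm h"
      "\<And>b c u u'. u \<in> cball p R \<Longrightarrow> u' \<in> cball p R \<Longrightarrow> norm (G u' b c - G u b c) \<le> k b c * norm (u' - u)"
    by metis
  have "\<exists>K\<ge>0. \<forall>u\<in>cball p R. \<forall>u'\<in>cball p R.
      norm (G u' b c - G u b c - FD (\<lambda>w. G w b c) u (u' - u)) \<le> K * (norm (u' - u))\<^sup>2" for b c
    using smooth_on_taylor_cball[OF sm S, of b c] by metis
  then obtain k' where k': "\<And>b c. k' b c \<ge> 0" "\<And>b c u u'. u \<in> cball p R \<Longrightarrow> u' \<in> cball p R \<Longrightarrow>
      norm (G u' b c - G u b c - FD (\<lambda>w. G w b c) u (u' - u)) \<le> k' b c * (norm (u' - u))\<^sup>2"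
    by metis
  define K where "K = (\<Sum>b\<in>Basis. \<Sum>c\<in>Basis. k b c + k' b c)"
  have "K \<ge> 0" unfolding K_def by (intro sum_nonneg add_nonneg_nonneg k k')
  have sc: "(\<Sum>b\<in>Basis. \<Sum>c\<in>Basis. (k b c + k' b c) * x) = K * x" for x :: real
    by (simp add: K_def sum_distrib_right)
  have linFD: "linear (\<lambda>a. FD (\<lambda>w. G w a s) u h)" "linear (\<lambda>s. FD (\<lambda>w. G w a s) u h)"
    if "u \<in> cball p R" for u a s h
  proof -
    have u: "u \<in> S" using that S by auto
    show "linear (\<lambda>a. FD (\<lambda>w. G w a s) u h)"
      by (rule linear_FD_param[OF S(1) lin(1) u smooth_on_differentiable[OF sm u]])
    show "linear (\<lambda>s. FD (\<lambda>w. G w a s) u h)"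
      by (rule linear_FD_param[OF S(1) lin(2) u smooth_on_differentiable[OF sm u]])
  qed
  note lins = lin[OF subsetD[OF S(2)]]
  show ?thesis
  proof (rule that[OF \<open>K \<ge> 0\<close>])
    fix u a s assume u: "u \<in> cball p R"
    have "norm (G u a s) \<le> (\<Sum>b\<in>Basis. \<Sum>c\<in>Basis. (k b c + k' b c) * 1) * norm a * norm s"
    proof (rule bilinear_norm_le_Basis)
      show "norm (G u b c) \<le> (k b c + k' b c) * 1" for b c
        using k(2)[OF u, of b c] k'(1)[of b c] by simp
    qed (use lins u in auto)
    then show "norm (G u a s) \<le> K * norm a * norm s" by (simp add: K_def)
    show "norm (FD (\<lambda>w. G w a s) u h) \<le> K * norm h * norm a * norm s" for h
    proof -
      have "norm (FD (\<lambda>w. G w a s) u h) \<le> (\<Sum>b\<in>Basis. \<Sum>c\<in>Basis. (k b c + k' b c) * norm h) * norm a * norm s"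
      proof (rule bilinear_norm_le_Basis)
        show "norm (FD (\<lambda>w. G w b c) u h) \<le> (k b c + k' b c) * norm h" for b c
          using k(3)[OF u, of b c h] mult_nonneg_nonneg[OF k'(1)[of b c], of "norm h"] by (simp add: algebra_simps)
      qed (use linFD u in auto)
      then show ?thesis using sc by simp
    qed
    fix u' assume u': "u' \<in> cball p R"
    have "norm (G u' a s - G u a s) \<le>
        (\<Sum>b\<in>Basis. \<Sum>c\<in>Basis. (k b c + k' b c) * norm (u' - u)) * norm a * norm s"
    proof (rule bilinear_norm_le_Basis)
      show "norm (G u' b c - G u b c) \<le> (k b c + k' b c) * norm (u' - u)" for b c
        using k(4)[OF u u', of b c] mult_nonneg_nonneg[OF k'(1)[of b c], of "norm (u' - u)"]
        by (simp add: algebra_simps)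
    qed (use lins u u' in \<open>auto intro: linear_compose_sub\<close>)
    then show "norm (G u' a s - G u a s) \<le> K * norm (u' - u) * norm a * norm s" using sc by simp
    have "norm (G u' a s - G u a s - FD (\<lambda>w. G w a s) u (u' - u)) \<le>
        (\<Sum>b\<in>Basis. \<Sum>c\<in>Basis. (k b c + k' b c) * (norm (u' - u))\<^sup>2) * norm a * norm s"
    proof (rule bilinear_norm_le_Basis)
      show "norm (G u' b c - G u b c - FD (\<lambda>w. G w b c) u (u' - u)) \<le> (k b c + k' b c) * (norm (u' - u))\<^sup>2"
        for b c
        using k'(2)[OF u u', of b c] mult_nonneg_nonneg[OF k(1)[of b c], of "(norm (u' - u))\<^sup>2"]
        by (simp add: algebra_simps)
    qed (use lins linFD u u' in \<open>auto intro!: linear_compose_sub\<close>)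
    then show "norm (G u' a s - G u a s - FD (\<lambda>w. G w a s) u (u' - u)) \<le>
        K * (norm (u' - u))\<^sup>2 * norm a * norm s" using sc by simp
  qed
qed

text \<open>Where \<open>norm (\<delta> t)\<close> is largest, with value \<open>M\<close>, the mean
  value inequality gives \<open>M \<le> M / 2 + e\<close>, so \<open>M \<le> 2 * e\<close>. The
  coefficient \<open>1 / 2\<close> on the unit interval is arranged by working on short
  rays.\<close>

lemma small_gronwall:
  fixes \<delta> :: "real \<Rightarrow> 'f::real_normed_vector"
  assumes d: "\<And>t. t \<in> {0..1} \<Longrightarrow> (\<delta> has_vector_derivative \<delta>' t) (at t within {0..1})"
    and b: "\<And>t. t \<in> {0..1} \<Longrightarrow> norm (\<delta>' t) \<le> norm (\<delta> t) / 2 + e"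
    and 0: "\<delta> 0 = 0"
  shows "norm (\<delta> 1) \<le> 2 * e"
proof -
  have "continuous_on {0..1} (\<lambda>t. norm (\<delta> t))"
    by (intro continuous_on_norm continuous_on_vector_derivative) (use d in auto)
  then obtain t0 where t0: "t0 \<in> {0..1}" "\<And>t. t \<in> {0..1} \<Longrightarrow> norm (\<delta> t) \<le> norm (\<delta> t0)"
    using continuous_attains_sup[of "{0..1::real}" "\<lambda>t. norm (\<delta> t)"] by auto
  define M where "M = norm (\<delta> t0)"
  have M: "M / 2 + e \<ge> 0"
    using order_trans[OF norm_ge_zero b[OF t0(1)]] by (simp add: M_def)
  have "norm (\<delta> t0 - \<delta> 0) \<le> (M / 2 + e) * norm (t0 - 0)"
  proof (rule differentiable_bound[where S="{0..1}"])
    show "(\<delta> has_derivative (\<lambda>h. h *\<^sub>R \<delta>' t)) (at t within {0..1})" if "t \<in> {0..1}" for t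
      using d[OF that] by (simp add: has_vector_derivative_def)
    show "onorm (\<lambda>h. h *\<^sub>R \<delta>' t) \<le> M / 2 + e" if "t \<in> {0..1}" for t
    proof (rule onorm_le)
      fix h :: real
      have "norm (\<delta>' t) \<le> M / 2 + e" using b[OF that] t0(2)[OF that] by (simp add: M_def)
      then show "norm (h *\<^sub>R \<delta>' t) \<le> (M / 2 + e) * norm h"
        by (simp add: mult.commute mult_left_mono)
    qed
  qed (use t0 in auto)
  also have "\<dots> \<le> M / 2 + e"
    using t0(1) M by (simp add: mult_left_le)
  finally have "M \<le> 2 * e" by (simp add: 0 M_def)
  then show ?thesis using t0(2)[of 1] by (simp add: M_def)
qed

lemma has_derivative_of_quadratic_remainder:
  fixes f :: "'v::euclidean_space \<Rightarrow> 'w::real_normed_vector"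
  assumes "open S" "x \<in> S" "linear L"
    and r: "\<And>y. y \<in> S \<Longrightarrow> norm (f y - f x - L (y - x)) \<le> C * (norm (y - x))\<^sup>2"
  shows "(f has_derivative L) (at x)"
  unfolding has_derivative_at_alt
proof (intro conjI allI impI)
  show "bounded_linear L" using assms(3) by (simp add: linear_conv_bounded_linear)
  fix e :: real assume "e > 0"
  obtain d where d: "d > 0" "ball x d \<subseteq> S" using assms(1,2) openE by blast
  show "\<exists>d>0. \<forall>y. norm (y - x) < d \<longrightarrow> norm (f y - f x - L (y - x)) \<le> e * norm (y - x)"
  proof (intro exI[of _ "min d (e / (\<bar>C\<bar> + 1))"] conjI allI impI)
    fix y assume y: "norm (y - x) < min d (e / (\<bar>C\<bar> + 1))"
    have "y \<in> S" using y d(2) by (auto simp: dist_norm norm_minus_commute)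
    then have "norm (f y - f x - L (y - x)) \<le> C * (norm (y - x))\<^sup>2" by (rule r)
    also have "\<dots> \<le> (\<bar>C\<bar> + 1) * norm (y - x) * norm (y - x)"
      by (simp add: power2_eq_square mult_right_mono flip: mult.assoc)
    also have "\<dots> \<le> e * norm (y - x)"
      using y by (intro mult_right_mono) (auto simp: field_simps)
    finally show "norm (f y - f x - L (y - x)) \<le> e * norm (y - x)" .
  qed (use d \<open>e > 0\<close> in auto)
qed

section \<open>Integrable linear Pfaffian systems\<close>

text \<open>All rays are solved at once by the fixed point of \<open>\<sigma> v = s0 + \<integral> G
  (p + t v) v (\<sigma> (t v)) dt\<close>, with \<open>t\<close> from \<open>0\<close> to
  \<open>1\<close>, in the space of bounded continuous functions of \<open>v\<close>. The condition
  \<open>K * r \<le> 1 / 2\<close> makes this a contraction with factor \<open>1 / 2\<close>;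
  linearity in \<open>s\<close> turns the difference of two images into an integral of the same
  kind.\<close>

lemma radial_solution:
  fixes G :: "'v::euclidean_space \<Rightarrow> 'v \<Rightarrow> 'f::euclidean_space \<Rightarrow> 'f"
  assumes r: "r > 0" "K \<ge> 0" "K * r \<le> 1 / 2"
    and cont: "\<And>a s. continuous_on (cball p r) (\<lambda>u. G u a s)"
    and lin: "\<And>u s. u \<in> cball p r \<Longrightarrow> linear (\<lambda>a. G u a s)" "\<And>u a. u \<in> cball p r \<Longrightarrow> linear (G u a)"
    and bound: "\<And>u a s. u \<in> cball p r \<Longrightarrow> norm (G u a s) \<le> K * norm a * norm s"
  obtains \<sigma> M where "M \<ge> 0" "\<And>v. norm (\<sigma> v) \<le> M" "\<sigma> 0 = s0"
    "\<And>v t. norm v \<le> r \<Longrightarrow> t \<in> {0..1} \<Longrightarrow>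
      ((\<lambda>t. \<sigma> (t *\<^sub>R v)) has_vector_derivative G (p + t *\<^sub>R v) v (\<sigma> (t *\<^sub>R v))) (at t within {0..1})"
proof -
  \<comment> \<open>Bounded continuous functions live on the whole space, while \<open>G\<close> is
    controlled only near \<open>p\<close>. The closest-point retraction onto the ball of radius
    \<open>r\<close> extends the equation continuously to every \<open>v\<close> without changing it
    inside the ball.\<close>
  define \<rho> where "\<rho> = closest_point (cball (0::'v) r)"
  have ne: "cball (0::'v) r \<noteq> {}" using r by simp
  have \<rho>_le: "norm (\<rho> v) \<le> r" for v
    using closest_point_in_set[OF closed_cball ne, of v] by (simp add: \<rho>_def)
  have \<rho>_id: "\<rho> v = v" if "norm v \<le> r" for v
    using that by (simp add: \<rho>_def closest_point_self)
  have \<rho>_cont: "continuous_on UNIV \<rho>"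
    unfolding \<rho>_def by (rule continuous_on_closest_point) (use ne in auto)
  have in_ball: "p + t *\<^sub>R \<rho> v \<in> cball p r" if "t \<in> {0..1}" for t v
  proof -
    have "t * norm (\<rho> v) \<le> 1 * r" using that \<rho>_le[of v] by (intro mult_mono) auto
    then show ?thesis using that by (simp add: dist_norm)
  qed
  define k where "k \<phi> v t = G (p + t *\<^sub>R \<rho> v) (\<rho> v) (\<phi> (t *\<^sub>R \<rho> v))"
    for \<phi> :: "'v \<Rightarrow> 'f" and v t
  have k_cont: "continuous_on (UNIV \<times> cbox 0 1) (\<lambda>(v, t). k \<phi> v t)"
    if \<phi>: "continuous_on UNIV \<phi>" for \<phi>
  proof -
    have 1: "continuous_on (UNIV \<times> cbox 0 1) (\<lambda>z. \<phi> (snd z *\<^sub>R \<rho> (fst z)))"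
      by (rule continuous_on_compose2[OF \<phi>])
        (auto intro!: continuous_intros continuous_on_compose2[OF \<rho>_cont])
    have 2: "continuous_on (UNIV \<times> cbox 0 1) (\<lambda>z. G (p + snd z *\<^sub>R \<rho> (fst z)) b c)" for b c
    proof (rule continuous_on_compose2[OF cont])
      show "continuous_on (UNIV \<times> cbox 0 1) (\<lambda>z. p + snd z *\<^sub>R \<rho> (fst z))"
        by (auto intro!: continuous_intros continuous_on_compose2[OF \<rho>_cont])
      show "(\<lambda>z. p + snd z *\<^sub>R \<rho> (fst z)) ` (UNIV \<times> cbox 0 1) \<subseteq> cball p r"
        using in_ball by (auto simp del: mem_cball)
    qed
    have 3: "continuous_on (UNIV \<times> cbox 0 1) (\<lambda>z. \<rho> (fst z))"
      by (rule continuous_on_compose2[OF \<rho>_cont]) (auto intro!: continuous_intros)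
    \<comment> \<open>\<open>G\<close> is assumed continuous in the point for fixed \<open>a\<close>
      and \<open>s\<close>; joint continuity of the integrand comes from expanding both linear
      arguments in a basis.\<close>
    have "continuous_on (UNIV \<times> cbox 0 1) (\<lambda>z. \<Sum>b\<in>Basis. (\<rho> (fst z) \<bullet> b) *\<^sub>R
        (\<Sum>c\<in>Basis. (\<phi> (snd z *\<^sub>R \<rho> (fst z)) \<bullet> c) *\<^sub>R G (p + snd z *\<^sub>R \<rho> (fst z)) b c))"
      by (intro continuous_intros 1 2 3)
    then show ?thesis
    proof (rule continuous_on_cong[THEN iffD1, OF refl, rotated])
      fix z :: "'v \<times> real" assume "z \<in> UNIV \<times> cbox 0 1"
      then obtain v t where z: "z = (v, t)" "t \<in> {0..1}" by auto
      note L = lin[OF in_ball[OF z(2), of v]]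
      have "k \<phi> v t = (\<Sum>b\<in>Basis. (\<rho> v \<bullet> b) *\<^sub>R G (p + t *\<^sub>R \<rho> v) b (\<phi> (t *\<^sub>R \<rho> v)))"
        unfolding k_def by (rule linear_basis_expansion[OF L(1)])
      also have "\<dots> = (\<Sum>b\<in>Basis. (\<rho> v \<bullet> b) *\<^sub>R
          (\<Sum>c\<in>Basis. (\<phi> (t *\<^sub>R \<rho> v) \<bullet> c) *\<^sub>R G (p + t *\<^sub>R \<rho> v) b c))"
        by (intro sum.cong refl arg_cong2[where f=scaleR] linear_basis_expansion[OF L(2)])
      finally show "(\<Sum>b\<in>Basis. (\<rho> (fst z) \<bullet> b) *\<^sub>R (\<Sum>c\<in>Basis. (\<phi> (snd z *\<^sub>R \<rho> (fst z)) \<bullet> c) *\<^sub>R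
            G (p + snd z *\<^sub>R \<rho> (fst z)) b c)) = (case z of (v, t) \<Rightarrow> k \<phi> v t)"
        by (simp add: z)
    qed
  qed
  have k_cont1: "continuous_on {0..1} (k \<phi> v)" if "continuous_on UNIV \<phi>" for \<phi> v
  proof -
    have "continuous_on {0..1} (Pair v)" by (intro continuous_intros)
    then show ?thesis
      using continuous_on_compose2[OF k_cont[OF that], of "{0..1}" "\<lambda>t. (v, t)"] by auto
  qed
  have k_bound: "norm (k \<phi> v t) \<le> K * r * B" if "t \<in> {0..1}" "\<And>v. norm (\<phi> v) \<le> B" for \<phi> v t B
  proof -
    have "norm (k \<phi> v t) \<le> K * norm (\<rho> v) * norm (\<phi> (t *\<^sub>R \<rho> v))"
      unfolding k_def by (rule bound[OF in_ball[OF that(1)]])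
    also have "\<dots> \<le> K * r * B"
      using \<rho>_le r that(2) by (intro mult_mono mult_nonneg_nonneg) auto
    finally show ?thesis .
  qed
  define T where "T \<phi> = Bcontfun (\<lambda>v. s0 + integral {0..1} (k (apply_bcontfun \<phi>) v))" for \<phi>
  have T: "apply_bcontfun (T \<phi>) = (\<lambda>v. s0 + integral {0..1} (k (apply_bcontfun \<phi>) v))" for \<phi>
    unfolding T_def
  proof (rule Bcontfun_inverse, unfold bcontfun_def, intro CollectI conjI)
    have c: "continuous_on UNIV (apply_bcontfun \<phi>)" by (simp add: continuous_on_apply_bcontfun)
    then show "continuous_on UNIV (\<lambda>v. s0 + integral {0..1} (k (apply_bcontfun \<phi>) v))"
      using integral_continuous_on_param[OF k_cont[OF c]] by (auto intro!: continuous_intros)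
    have "norm (s0 + integral {0..1} (k (apply_bcontfun \<phi>) v)) \<le> norm s0 + K * r * norm \<phi> * (1 - 0)" for v
      by (intro order_trans[OF norm_triangle_ineq] add_left_mono integral_bound k_cont1[OF c] k_bound
          norm_bounded) auto
    then show "bounded (range (\<lambda>v. s0 + integral {0..1} (k (apply_bcontfun \<phi>) v)))"
      unfolding bounded_iff by blast
  qed
  have "dist (T \<phi>) (T \<xi>) \<le> 1 / 2 * dist \<phi> \<xi>" for \<phi> \<xi>
  proof (rule dist_bound)
    fix v
    let ?f = "apply_bcontfun \<phi>" and ?g = "apply_bcontfun \<xi>"
    have c: "continuous_on {0..1} (k ?f v)" "continuous_on {0..1} (k ?g v)"
      by (auto intro!: k_cont1 simp: continuous_on_apply_bcontfun)
    have "integral {0..1} (k ?f v) - integral {0..1} (k ?g v) =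
        integral {0..1} (\<lambda>t. k ?f v t - k ?g v t)"
      by (rule integral_diff[symmetric]) (auto intro!: integrable_continuous_real c)
    moreover have "norm (integral {0..1} (\<lambda>t. k ?f v t - k ?g v t)) \<le> 1 / 2 * dist \<phi> \<xi> * (1 - 0)"
    proof (rule integral_bound)
      show "continuous_on {0..1} (\<lambda>t. k ?f v t - k ?g v t)" by (intro continuous_intros c)
      fix t :: real assume t: "t \<in> {0..1}"
      have "k ?f v t - k ?g v t = k (\<lambda>v. ?f v - ?g v) v t"
        unfolding k_def by (simp add: linear_diff[OF lin(2)[OF in_ball[OF t]]])
      then have "norm (k ?f v t - k ?g v t) \<le> K * r * dist \<phi> \<xi>"
        using k_bound[OF t, of "\<lambda>v. ?f v - ?g v"] dist_bounded[of \<phi> _ \<xi>] by (simp add: dist_norm)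
      also have "\<dots> \<le> 1 / 2 * dist \<phi> \<xi>" by (rule mult_right_mono[OF r(3)]) simp
      finally show "norm (k ?f v t - k ?g v t) \<le> 1 / 2 * dist \<phi> \<xi>" .
    qed simp
    ultimately show "dist (apply_bcontfun (T \<phi>) v) (apply_bcontfun (T \<xi>) v) \<le> 1 / 2 * dist \<phi> \<xi>"
      by (simp add: T dist_norm)
  qed
  then have "\<exists>!\<phi>. T \<phi> = \<phi>" by (intro banach_fix_type[of "1/2"]) auto
  then obtain \<phi> where \<phi>: "T \<phi> = \<phi>" by blast
  define \<sigma> where "\<sigma> = apply_bcontfun \<phi>"
  have \<sigma>: "\<sigma> v = s0 + integral {0..1} (k \<sigma> v)" for v
    using fun_cong[OF T[of \<phi>], of v] by (simp add: \<phi> \<sigma>_def)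
  have \<sigma>_cont: "continuous_on UNIV \<sigma>" by (simp add: \<sigma>_def continuous_on_apply_bcontfun)
  show ?thesis
  proof (rule that)
    show "norm (\<sigma> v) \<le> norm \<phi>" for v unfolding \<sigma>_def by (rule norm_bounded)
    have "k \<sigma> 0 t = 0" if "t \<in> {0..1}" for t
      using linear_0[OF lin(1)[OF in_ball[OF that, of 0]]] r \<rho>_id[of 0] by (simp add: k_def)
    then have "integral {0..1} (k \<sigma> 0) = 0" by (rule integral_unique[OF has_integral_is_0])
    then show "\<sigma> 0 = s0" using \<sigma>[of 0] by simp
    fix v :: 'v and t :: real assume v: "norm v \<le> r" and t: "t \<in> {0..1}"
    define g where "g y = G (p + y *\<^sub>R v) v (\<sigma> (y *\<^sub>R v))" for y
    define H where "H y = integral {0..y} g" for y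
    have "g = k \<sigma> v" by (simp add: g_def k_def \<rho>_id[OF v] fun_eq_iff)
    then have H: "(H has_vector_derivative g y) (at y within {0..1})" if "y \<in> {0..1}" for y
      unfolding H_def using k_cont1[OF \<sigma>_cont] that by (auto intro: integral_has_vector_derivative)
    \<comment> \<open>Replacing the integration variable by \<open>x * y\<close> turns the
      fixed-point equation on the shorter ray \<open>y v\<close> into
      \<open>\<sigma> (y v) = s0 + H y\<close>, where \<open>H\<close> integrates along the ray
      \<open>v\<close> up to time \<open>y\<close>. Differentiating in \<open>y\<close> then gives
      the radial equation.\<close>
    have ray: "\<sigma> (y *\<^sub>R v) = s0 + H y" if y: "y \<in> {0..1}" for y
    proof -
      have yv: "norm (y *\<^sub>R v) \<le> r"
        using y v mult_mono[of y 1 "norm v" r] by auto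
      have "((\<lambda>x. y *\<^sub>R g (x * y)) has_integral (H (1 * y) - H (0 * y))) {0..1}"
      proof (rule fundamental_theorem_of_calculus)
        fix x :: real assume x: "x \<in> {0..1}"
        have xy: "x * y \<in> {0..1}" using x y by (auto simp: mult_le_one)
        have "((H \<circ> (\<lambda>x. x * y)) has_vector_derivative y *\<^sub>R g (x * y)) (at x within {0..1})"
        proof (rule vector_diff_chain_within)
          show "((\<lambda>x. x * y) has_vector_derivative y) (at x within {0..1})"
            by (auto intro!: derivative_eq_intros)
          have "(\<lambda>x. x * y) ` {0..1} \<subseteq> {0..1}" using y by (auto simp: mult_le_one)
          then show "(H has_vector_derivative g (x * y)) (at (x * y) within (\<lambda>x. x * y) ` {0..1})"
            by (rule has_vector_derivative_within_subset[OF H[OF xy]])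
        qed
        then show "((\<lambda>x. H (x * y)) has_vector_derivative y *\<^sub>R g (x * y)) (at x within {0..1})"
          by (simp add: o_def)
      qed simp
      moreover have "k \<sigma> (y *\<^sub>R v) x = y *\<^sub>R g (x * y)" if "x \<in> {0..1}" for x
      proof -
        have "p + x *\<^sub>R (y *\<^sub>R v) \<in> cball p r" using in_ball[OF that, of "y *\<^sub>R v"] \<rho>_id[OF yv] by simp
        then show ?thesis
          using linear_scale[OF lin(1), of "p + x *\<^sub>R (y *\<^sub>R v)" y] by (simp add: k_def g_def \<rho>_id[OF yv])
      qed
      ultimately have "(k \<sigma> (y *\<^sub>R v) has_integral (H y - H 0)) {0..1}"
        by (subst has_integral_cong) auto
      then have "integral {0..1} (k \<sigma> (y *\<^sub>R v)) = H y - H 0" by (rule integral_unique)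
      then show ?thesis using \<sigma>[of "y *\<^sub>R v"] by (simp add: H_def)
    qed
    have "((\<lambda>y. s0 + H y) has_vector_derivative g t) (at t within {0..1})"
      using H[OF t] by (auto intro!: derivative_eq_intros)
    then show "((\<lambda>t. \<sigma> (t *\<^sub>R v)) has_vector_derivative G (p + t *\<^sub>R v) v (\<sigma> (t *\<^sub>R v))) (at t within {0..1})"
      unfolding g_def[symmetric] using has_vector_derivative_transform[OF t, of "\<lambda>y. \<sigma> (y *\<^sub>R v)"] ray by auto
  qed simp
qed


text \<open>
  The system is first solved along each ray from \<open>p\<close>. For neighbouring rays \<open>v\<close> and \<open>v + h\<close>, the
  error \<open>\<delta>\<close> of the linear prediction \<open>G (t h)\<close> satisfies, by integrability, a linear equation
  along the ray with inhomogeneity \<open>O(\<bar>h\<bar>\<^sup>2)\<close>, so the equation also holds transversally.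
\<close>

theorem linear_pfaffian_system:
  fixes G :: "'v::euclidean_space \<Rightarrow> 'v \<Rightarrow> 'f::euclidean_space \<Rightarrow> 'f"
  assumes S: "open S" "p \<in> S"
    and lin: "\<And>u s. u \<in> S \<Longrightarrow> linear (\<lambda>a. G u a s)" "\<And>u a. u \<in> S \<Longrightarrow> linear (G u a)"
    and sm: "\<And>a s. smooth_on S (\<lambda>u. G u a s)"
    and integrable: "\<And>u a b s. u \<in> S \<Longrightarrow>
      FD (\<lambda>w. G w b s) u a + G u b (G u a s) = FD (\<lambda>w. G w a s) u b + G u a (G u b s)"
  obtains r where "r > 0" "ball p r \<subseteq> S"
    "\<And>s0. \<exists>\<sigma>. \<sigma> p = s0 \<and> smooth_on (ball p r) \<sigma> \<and>
       (\<forall>u\<in>ball p r. (\<sigma> has_derivative (\<lambda>a. G u a (\<sigma> u))) (at u))"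
proof -
  obtain R where R: "R > 0" "cball p R \<subseteq> S" using S open_contains_cball by blast
  obtain K where K: "K \<ge> 0"
    "\<And>u a s. u \<in> cball p R \<Longrightarrow> norm (G u a s) \<le> K * norm a * norm s"
    "\<And>u h a s. u \<in> cball p R \<Longrightarrow> norm (FD (\<lambda>w. G w a s) u h) \<le> K * norm h * norm a * norm s"
    "\<And>u u' a s. u \<in> cball p R \<Longrightarrow> u' \<in> cball p R \<Longrightarrow>
      norm (G u' a s - G u a s) \<le> K * norm (u' - u) * norm a * norm s"
    "\<And>u u' a s. u \<in> cball p R \<Longrightarrow> u' \<in> cball p R \<Longrightarrow>
      norm (G u' a s - G u a s - FD (\<lambda>w. G w a s) u (u' - u)) \<le> K * (norm (u' - u))\<^sup>2 * norm a * norm s"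
    using bilinear_family_bounds[OF S(1) R(2) lin sm] by metis
  \<comment> \<open>\<open>K + 1\<close> instead of \<open>K\<close> avoids a division by zero. The
    radius depends on \<open>R\<close> and \<open>K\<close> and is chosen before \<open>s0\<close>,
    so one ball serves all initial values.\<close>
  define r where "r = min R (1 / (2 * (K + 1)))"
  have r: "r > 0" "r \<le> R" using R(1) K(1) by (auto simp: r_def)
  have "K * r \<le> K * (1 / (2 * (K + 1)))" using K(1) by (intro mult_left_mono) (auto simp: r_def)
  also have "\<dots> \<le> 1 / 2" using K(1) by (simp add: field_simps)
  finally have Kr: "K * r \<le> 1 / 2" .
  have rR: "cball p r \<subseteq> cball p R" using r(2) by (rule subset_cball)
  have rS: "cball p r \<subseteq> S" using rR R(2) by (rule order_trans)
  show ?thesis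
  proof (rule that[OF r(1)])
    show "ball p r \<subseteq> S" using rS ball_subset_cball by (rule order_trans[rotated])
    fix s0
    have cont: "continuous_on (cball p r) (\<lambda>u. G u a s)" for a s
      by (rule continuous_on_subset[OF smooth_on_continuous[OF sm] rS])
    obtain \<alpha> M where \<alpha>: "M \<ge> 0" "\<And>v. norm (\<alpha> v) \<le> M" "\<alpha> 0 = s0"
      "\<And>v t. norm v \<le> r \<Longrightarrow> t \<in> {0..1} \<Longrightarrow>
        ((\<lambda>t. \<alpha> (t *\<^sub>R v)) has_vector_derivative G (p + t *\<^sub>R v) v (\<alpha> (t *\<^sub>R v))) (at t within {0..1})"
      by (rule radial_solution[OF r(1) K(1) Kr cont lin[OF subsetD[OF rS]] K(2)[OF subsetD[OF rR]]]) auto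
    \<comment> \<open>The four summands are the factors of \<open>(norm h)\<^sup>2\<close> in the
      bounds \<open>n2\<close>, \<open>n3\<close>, \<open>n4\<close> and \<open>n5\<close> below, in
      this order.\<close>
    define C where "C = K * r * M + K * M + K * r * K * M + K * K * M"
    have quad: "norm (\<alpha> w - \<alpha> v - G (p + v) (w - v) (\<alpha> v)) \<le> 2 * (C * (norm (w - v))\<^sup>2)"
      if vw: "norm v \<le> r" "norm w \<le> r" for v w
    proof -
      define h where "h = w - v"
      define \<delta> where "\<delta> t = \<alpha> (t *\<^sub>R w) - \<alpha> (t *\<^sub>R v) - t *\<^sub>R G (p + t *\<^sub>R v) h (\<alpha> (t *\<^sub>R v))" for t
      define A where "A t = \<alpha> (t *\<^sub>R v)" for t
      define B where "B t = G (p + t *\<^sub>R v) h (A t)" for t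
      define \<delta>' where "\<delta>' t = G (p + t *\<^sub>R w) w (\<alpha> (t *\<^sub>R w)) - G (p + t *\<^sub>R v) v (A t)
        - (B t + t *\<^sub>R (FD (\<lambda>x. G x h (A t)) (p + t *\<^sub>R v) v
            + G (p + t *\<^sub>R v) h (G (p + t *\<^sub>R v) v (A t))))" for t
      have mem: "p + t *\<^sub>R v \<in> cball p r" "p + t *\<^sub>R w \<in> cball p r" if "t \<in> {0..1}" for t
        using that vw mult_mono[of t 1 "norm v" r] mult_mono[of t 1 "norm w" r] by (auto simp: dist_norm)
      have "norm (\<delta> 1) \<le> 2 * (C * (norm h)\<^sup>2)"
      proof (rule small_gronwall[where \<delta>'=\<delta>'])
        show "\<delta> 0 = 0" by (simp add: \<delta>_def)
        fix t :: real assume t: "t \<in> {0..1}"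
        define u where "u = p + t *\<^sub>R v"
        define u' where "u' = p + t *\<^sub>R w"
        have u: "u \<in> cball p r" "u' \<in> cball p r" using mem[OF t] by (auto simp: u_def u'_def)
        have uS: "u \<in> S" "u' \<in> S" using u rS by auto
        have uR: "u \<in> cball p R" "u' \<in> cball p R" using u rR by auto
        have "((\<lambda>t. G (p + t *\<^sub>R v) h (A t)) has_derivative
            (\<lambda>x. FD (\<lambda>y. G y h (A t)) u (x *\<^sub>R v) + G u h (x *\<^sub>R G u v (A t)))) (at t within {0..1})"
          unfolding u_def
        proof (rule has_derivative_apply_within[where L="\<lambda>t. G (p + t *\<^sub>R v) h" and
              L'="\<lambda>b x. FD (\<lambda>y. G y h b) (p + t *\<^sub>R v) (x *\<^sub>R v)"])
          show "linear (G (p + y *\<^sub>R v) h)" if "y \<in> {0..1}" for y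
            by (rule lin(2)[OF subsetD[OF rS mem(1)[OF that]]])
          show "linear (\<lambda>b. FD (\<lambda>y. G y h b) (p + t *\<^sub>R v) (x *\<^sub>R v))" for x
            by (rule linear_FD_param[OF S(1) lin(2) _ smooth_on_differentiable[OF sm]])
              (use uS in \<open>auto simp: u_def\<close>)
          show "((\<lambda>y. G (p + y *\<^sub>R v) h b) has_derivative
              (\<lambda>x. FD (\<lambda>y. G y h b) (p + t *\<^sub>R v) (x *\<^sub>R v))) (at t within {0..1})" for b
          proof (rule has_derivative_compose[where f="\<lambda>y. p + y *\<^sub>R v" and g="\<lambda>y. G y h b"])
            show "((\<lambda>y. p + y *\<^sub>R v) has_derivative (\<lambda>x. x *\<^sub>R v)) (at t within {0..1})"
              by (auto intro!: derivative_eq_intros)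
            show "((\<lambda>y. G y h b) has_derivative FD (\<lambda>y. G y h b) (p + t *\<^sub>R v)) (at (p + t *\<^sub>R v))"
              using smooth_on_has_derivative[OF sm uS(1)] by (simp add: u_def)
          qed
          show "(A has_derivative (\<lambda>x. x *\<^sub>R G (p + t *\<^sub>R v) v (A t))) (at t within {0..1})"
            unfolding A_def using \<alpha>(4)[OF vw(1) t] by (simp add: has_vector_derivative_def)
        qed (rule t)
        moreover have "(\<lambda>x. FD (\<lambda>y. G y h (A t)) u (x *\<^sub>R v) + G u h (x *\<^sub>R G u v (A t))) =
            (\<lambda>x. x *\<^sub>R (FD (\<lambda>y. G y h (A t)) u v + G u h (G u v (A t))))"
          using linear_scale[OF smooth_on_linear_FD[OF sm uS(1)]] linear_scale[OF lin(2)[OF uS(1)]]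
          by (simp add: scaleR_add_right)
        ultimately have B: "(B has_vector_derivative FD (\<lambda>y. G y h (A t)) u v + G u h (G u v (A t)))
            (at t within {0..1})"
          by (simp add: has_vector_derivative_def B_def[abs_def])
        have "((\<lambda>t. \<alpha> (t *\<^sub>R w) - A t - t *\<^sub>R B t) has_vector_derivative \<delta>' t) (at t within {0..1})"
          unfolding \<delta>'_def using \<alpha>(4)[OF vw(1) t] \<alpha>(4)[OF vw(2) t] B
          by (auto intro!: derivative_eq_intros simp: A_def u_def)
        then show "(\<delta> has_vector_derivative \<delta>' t) (at t within {0..1})"
          by (simp add: \<delta>_def[abs_def] A_def B_def)
        \<comment> \<open>With \<open>w = v + h\<close>, integrability (fact \<open>4\<close>)
          trades the derivative of \<open>G\<close> along \<open>v\<close> for one along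
          \<open>h\<close>, and the terms of first order in \<open>h\<close> cancel. Besides the
          linear term in \<open>\<delta> t\<close> there remain four terms of second order: a Taylor
          remainder, the derivative of \<open>G\<close> along \<open>h\<close> with \<open>h\<close>
          also as argument, and two terms in which \<open>B t\<close> carries one factor of
          \<open>h\<close>.\<close>
        have eq: "\<delta>' t = G u' w (\<delta> t) + (G u' w (A t) - G u w (A t) - FD (\<lambda>y. G y w (A t)) u (u' - u))
            + t *\<^sub>R FD (\<lambda>y. G y h (A t)) u h + t *\<^sub>R (G u' w (B t) - G u w (B t)) + t *\<^sub>R G u h (B t)"
        proof -
          have Bu: "B t = G u h (A t)" by (simp add: B_def u_def)
          have w: "w = v + h" by (simp add: h_def)
          have u'u: "u' - u = t *\<^sub>R h" by (simp add: u_def u'_def h_def scaleR_diff_right)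
          have \<alpha>w: "\<alpha> (t *\<^sub>R w) = \<delta> t + A t + t *\<^sub>R B t" by (simp add: \<delta>_def A_def B_def)
          have 1: "G u' w (\<alpha> (t *\<^sub>R w)) = G u' w (\<delta> t) + G u' w (A t) + t *\<^sub>R G u' w (B t)"
            by (simp add: \<alpha>w linear_add[OF lin(2)[OF uS(2)]] linear_scale[OF lin(2)[OF uS(2)]])
          have 2: "G u w s = G u v s + G u h s" for s
            unfolding w by (rule linear_add[OF lin(1)[OF uS(1)]])
          have 3: "FD (\<lambda>y. G y w s) u (u' - u) = t *\<^sub>R (FD (\<lambda>y. G y v s) u h + FD (\<lambda>y. G y h s) u h)" for s
            unfolding u'u w linear_scale[OF smooth_on_linear_FD[OF sm uS(1)]]
            using linear_add[OF linear_FD_param[OF S(1) lin(1) uS(1) smooth_on_differentiable[OF sm uS(1)]]]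
            by simp
          have 4: "FD (\<lambda>y. G y h (A t)) u v + G u h (G u v (A t)) =
              FD (\<lambda>y. G y v (A t)) u h + G u v (B t)"
            using integrable[OF uS(1), of h "A t" v] by (simp add: B_def u_def)
          have "\<delta>' t = G u' w (\<alpha> (t *\<^sub>R w)) - G u v (A t)
              - (B t + t *\<^sub>R (FD (\<lambda>y. G y h (A t)) u v + G u h (G u v (A t))))"
            by (simp add: \<delta>'_def u_def u'_def)
          then show ?thesis
            unfolding 1 4 3 by (simp add: 2 Bu algebra_simps)
        qed
        have nt: "\<bar>t\<bar> \<le> 1" using t by auto
        have nu: "norm (u' - u) \<le> norm h"
        proof -
          have "u' - u = t *\<^sub>R h" by (simp add: u_def u'_def h_def scaleR_diff_right)
          then show ?thesis using mult_right_mono[OF nt norm_ge_zero[of h]] by simp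
        qed
        have nA: "norm (A t) \<le> M" unfolding A_def by (rule \<alpha>(2))
        have nB: "norm (B t) \<le> K * norm h * M"
        proof -
          have "norm (B t) \<le> K * norm h * norm (A t)"
            using K(2)[OF uR(1), of h "A t"] by (simp add: B_def u_def)
          also have "\<dots> \<le> K * norm h * M" using nA K(1) by (intro mult_left_mono) auto
          finally show ?thesis .
        qed
        have n1: "norm (G u' w (\<delta> t)) \<le> norm (\<delta> t) / 2"
        proof -
          have "norm (G u' w (\<delta> t)) \<le> K * norm w * norm (\<delta> t)" by (rule K(2)[OF uR(2)])
          also have "\<dots> \<le> (K * r) * norm (\<delta> t)"
            using vw(2) K(1) by (intro mult_right_mono mult_left_mono) auto
          also have "\<dots> \<le> 1 / 2 * norm (\<delta> t)" by (rule mult_right_mono[OF Kr]) simp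
          finally show ?thesis by simp
        qed
        have n2: "norm (G u' w (A t) - G u w (A t) - FD (\<lambda>y. G y w (A t)) u (u' - u)) \<le> K * (norm h)\<^sup>2 * r * M"
        proof -
          have "norm (G u' w (A t) - G u w (A t) - FD (\<lambda>y. G y w (A t)) u (u' - u)) \<le>
              K * (norm (u' - u))\<^sup>2 * norm w * norm (A t)"
            by (rule K(5)[OF uR])
          also have "\<dots> \<le> K * (norm h)\<^sup>2 * r * M"
            using nu nA vw(2) K(1) \<alpha>(1) r(1) by (intro mult_mono mult_nonneg_nonneg power_mono) auto
          finally show ?thesis .
        qed
        have n3: "norm (t *\<^sub>R FD (\<lambda>y. G y h (A t)) u h) \<le> 1 * (K * norm h * norm h * M)"
        proof -
          have "norm (FD (\<lambda>y. G y h (A t)) u h) \<le> K * norm h * norm h * norm (A t)" by (rule K(3)[OF uR(1)])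
          also have "\<dots> \<le> K * norm h * norm h * M" using nA K(1) by (intro mult_left_mono) auto
          finally show ?thesis unfolding norm_scaleR using nt by (intro mult_mono) auto
        qed
        have n4: "norm (t *\<^sub>R (G u' w (B t) - G u w (B t))) \<le> 1 * (K * norm h * r * (K * norm h * M))"
        proof -
          have "norm (G u' w (B t) - G u w (B t)) \<le> K * norm (u' - u) * norm w * norm (B t)"
            by (rule K(4)[OF uR])
          also have "\<dots> \<le> K * norm h * r * (K * norm h * M)"
            using nu nB vw(2) K(1) \<alpha>(1) r(1) by (intro mult_mono mult_nonneg_nonneg) auto
          finally show ?thesis unfolding norm_scaleR using nt by (intro mult_mono) auto
        qed
        have n5: "norm (t *\<^sub>R G u h (B t)) \<le> 1 * (K * norm h * (K * norm h * M))"
        proof -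
          have "norm (G u h (B t)) \<le> K * norm h * norm (B t)" by (rule K(2)[OF uR(1)])
          also have "\<dots> \<le> K * norm h * (K * norm h * M)" using nB K(1) by (intro mult_left_mono) auto
          finally show ?thesis unfolding norm_scaleR using nt by (intro mult_mono) auto
        qed
        have "norm (\<delta>' t) \<le> norm (\<delta> t) / 2 + K * (norm h)\<^sup>2 * r * M + 1 * (K * norm h * norm h * M)
            + 1 * (K * norm h * r * (K * norm h * M)) + 1 * (K * norm h * (K * norm h * M))"
          unfolding eq by (intro norm_triangle_le add_mono n1 n2 n3 n4 n5)
        also have "\<dots> = norm (\<delta> t) / 2 + C * (norm h)\<^sup>2"
          by (simp add: C_def power2_eq_square algebra_simps)
        finally show "norm (\<delta>' t) \<le> norm (\<delta> t) / 2 + C * (norm h)\<^sup>2" .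
      qed
      then show ?thesis by (simp add: \<delta>_def h_def)
    qed
    define \<sigma> where "\<sigma> u = \<alpha> (u - p)" for u
    have d: "(\<sigma> has_derivative (\<lambda>a. G u a (\<sigma> u))) (at u)" if u: "u \<in> ball p r" for u
    proof (rule has_derivative_of_quadratic_remainder[OF open_ball u])
      show "linear (\<lambda>a. G u a (\<sigma> u))" using u rS by (intro lin) auto
      fix y assume y: "y \<in> ball p r"
      have "norm (u - p) \<le> r" "norm (y - p) \<le> r"
        using u y by (auto simp: dist_norm norm_minus_commute)
      from quad[OF this] show "norm (\<sigma> y - \<sigma> u - G u (y - u) (\<sigma> u)) \<le> (2 * C) * (norm (y - u))\<^sup>2"
        by (simp add: \<sigma>_def)
    qed
    \<comment> \<open>The right-hand side \<open>G u a (\<sigma> u)\<close> is as smooth as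
      \<open>\<sigma>\<close> itself, so each order of differentiability gives the next.\<close>
    have "Ck_on k (ball p r) \<sigma>" for k
    proof (induction k)
      case 0
      have "continuous_on (ball p r) \<sigma>"
        by (rule has_derivative_continuous_on[OF has_derivative_at_withinI[OF d]])
      then show ?case by simp
    next
      case (Suc k)
      have "Ck_on k (ball p r) (\<lambda>u. G u b c)" for b c
        using smooth_on_subset[OF sm order_trans[OF ball_subset_cball rS]] by (simp add: smooth_on_def)
      then have "Ck_on k (ball p r) (\<lambda>u. G u a (\<sigma> u))" for a
        using rS by (intro Ck_on_apply[where L="\<lambda>u. G u a" and Y=\<sigma>] Suc lin(2)) auto
      then show ?case by (intro Ck_on_SucI[OF d]) auto
    qed
    then show "\<exists>\<sigma>. \<sigma> p = s0 \<and> smooth_on (ball p r) \<sigma> \<and>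
        (\<forall>u\<in>ball p r. (\<sigma> has_derivative (\<lambda>a. G u a (\<sigma> u))) (at u))"
      using d \<alpha>(3) by (intro exI[of _ \<sigma>]) (auto simp: smooth_on_def \<sigma>_def)
  qed
qed

section \<open>Flat torsionfree connections in coordinates\<close>

text \<open>On a ball with \<open>n * c * r \<le> 1 / 2\<close>, where \<open>n\<close> is the
  number of unknowns, the maximum of the sum of all \<open>\<bar>\<sigma> j u\<bar>\<close> is at
  most half of itself. Finite families of real functions are used so that components of
  differentials and coefficients of bilinear forms fit alike.\<close>

lemma linear_system_unique:
  fixes \<sigma> :: "'i \<Rightarrow> 'v::euclidean_space \<Rightarrow> real"
  assumes S: "open S" "p \<in> S" and I: "finite I"
    and d: "\<And>i u. i \<in> I \<Longrightarrow> u \<in> S \<Longrightarrow> (\<sigma> i has_derivative \<sigma>' i u) (at u)"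
    and b: "\<And>i u a. i \<in> I \<Longrightarrow> u \<in> S \<Longrightarrow> \<bar>\<sigma>' i u a\<bar> \<le> C * norm a * (\<Sum>j\<in>I. \<bar>\<sigma> j u\<bar>)"
    and 0: "\<And>i. i \<in> I \<Longrightarrow> \<sigma> i p = 0"
  shows "\<forall>\<^sub>F u in nhds p. \<forall>i\<in>I. \<sigma> i u = 0"
proof -
  obtain R where R: "R > 0" "cball p R \<subseteq> S" using S open_contains_cball by blast
  define n where "n = real (card I)"
  define c where "c = \<bar>C\<bar>"
  define r where "r = min R (1 / (2 * (n * c + 1)))"
  have nc: "n * c \<ge> 0" by (simp add: n_def c_def)
  have r: "r > 0" "r \<le> R" using R(1) nc by (auto simp: r_def intro: add_nonneg_pos)
  have "n * c * r \<le> n * c * (1 / (2 * (n * c + 1)))" by (intro mult_left_mono nc) (simp add: r_def)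
  also have "\<dots> \<le> 1 / 2" using nc by (simp add: field_simps)
  finally have ncr: "n * c * r \<le> 1 / 2" .
  have rS: "cball p r \<subseteq> S" using subset_cball[OF r(2)] R(2) by (rule order_trans)
  define N where "N u = (\<Sum>j\<in>I. \<bar>\<sigma> j u\<bar>)" for u
  have "continuous_on (cball p r) (\<sigma> i)" if "i \<in> I" for i
    by (rule has_derivative_continuous_on[OF has_derivative_at_withinI[OF d[OF that subsetD[OF rS]]]])
  then have "continuous_on (cball p r) N"
    unfolding N_def by (intro continuous_intros) auto
  then obtain u0 where u0: "u0 \<in> cball p r" "\<And>u. u \<in> cball p r \<Longrightarrow> N u \<le> N u0"
    using continuous_attains_sup[of "cball p r" N] r(1) by auto
  have N0: "N u0 \<ge> 0" by (simp add: N_def sum_nonneg)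
  have "\<bar>\<sigma> i u0\<bar> \<le> c * N u0 * r" if i: "i \<in> I" for i
  proof -
    have "norm (\<sigma> i u0 - \<sigma> i p) \<le> c * N u0 * norm (u0 - p)"
    proof (rule differentiable_bound[OF convex_cball[of p r]])
      show "(\<sigma> i has_derivative \<sigma>' i u) (at u within cball p r)" if "u \<in> cball p r" for u
        by (rule has_derivative_at_withinI[OF d[OF i subsetD[OF rS that]]])
      show "onorm (\<sigma>' i u) \<le> c * N u0" if u: "u \<in> cball p r" for u
      proof (rule onorm_le)
        fix a
        have "norm (\<sigma>' i u a) \<le> C * norm a * N u"
          using b[OF i subsetD[OF rS u], of a] by (simp add: N_def)
        also have "\<dots> \<le> c * norm a * N u0"
          using u0(2)[OF u] by (intro mult_mono mult_right_mono) (auto simp: c_def N_def sum_nonneg)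
        finally show "norm (\<sigma>' i u a) \<le> c * N u0 * norm a" by (simp add: mult_ac)
      qed
    qed (use u0(1) r(1) in auto)
    also have "\<dots> \<le> c * N u0 * r"
      using u0(1) N0 by (intro mult_left_mono) (auto simp: dist_norm norm_minus_commute c_def)
    finally show ?thesis by (simp add: 0[OF i])
  qed
  then have "N u0 \<le> n * (c * N u0 * r)"
    using sum_bounded_above[of I "\<lambda>j. \<bar>\<sigma> j u0\<bar>" "c * N u0 * r"] by (simp add: N_def n_def)
  also have "\<dots> = (n * c * r) * N u0" by (simp add: mult_ac)
  also have "\<dots> \<le> 1 / 2 * N u0" by (rule mult_right_mono[OF ncr N0])
  finally have "N u0 = 0" using N0 by simp
  then have "\<sigma> i u = 0" if "u \<in> ball p r" "i \<in> I" for u i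
    using u0(2)[of u] that member_le_sum[OF that(2), of "\<lambda>j. \<bar>\<sigma> j u\<bar>"] I by (auto simp: N_def)
  then show ?thesis
    unfolding eventually_nhds using r(1) by (intro exI[of _ "ball p r"]) auto
qed

lemma locally_constant:
  fixes f :: "'v::euclidean_space \<Rightarrow> 'w::real_normed_vector"
  assumes "\<forall>\<^sub>F u in nhds p. (f has_derivative (\<lambda>a. 0)) (at u)"
  shows "\<forall>\<^sub>F u in nhds p. f u = f p"
proof -
  obtain T where T: "open T" "p \<in> T" "\<And>u. u \<in> T \<Longrightarrow> (f has_derivative (\<lambda>a. 0)) (at u)"
    using assms unfolding eventually_nhds by auto
  obtain r where r: "r > 0" "ball p r \<subseteq> T" using T openE by blast
  have "f u = f p" if "u \<in> ball p r" for u
  proof -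
    have "\<exists>c. \<forall>x\<in>ball p r. f x = c"
      by (rule has_derivative_zero_constant[OF convex_ball])
        (rule has_derivative_at_withinI[OF T(3)[OF subsetD[OF r(2)]]])
    then obtain c where c: "\<And>x. x \<in> ball p r \<Longrightarrow> f x = c" by blast
    show ?thesis using c[OF that] c[of p] r(1) by simp
  qed
  then show ?thesis
    unfolding eventually_nhds using r(1) by (metis centre_in_ball open_ball)
qed

text \<open>The inhomogeneous equation \<open>dg = \<beta>\<close> becomes linear with a second
  unknown \<open>\<tau>\<close>: \<open>dg = \<tau> \<beta>\<close> and \<open>d\<tau> = 0\<close>,
  started at \<open>\<tau> = 1\<close>. Closedness of \<open>\<beta>\<close> is then the
  integrability condition, and the Poincare lemma is a case of the linear theorem.\<close>

lemma closed_form_local_primitive: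
  fixes \<beta> :: "'v::euclidean_space \<Rightarrow> 'v \<Rightarrow> 'w::euclidean_space"
  assumes S: "open S" "p \<in> S" and lin: "\<And>u. u \<in> S \<Longrightarrow> linear (\<beta> u)"
    and sm: "\<And>a. smooth_on S (\<lambda>u. \<beta> u a)"
    and closed: "\<And>u a b. u \<in> S \<Longrightarrow> FD (\<lambda>w. \<beta> w b) u a = FD (\<lambda>w. \<beta> w a) u b"
  obtains r g where "r > 0" "ball p r \<subseteq> S" "\<And>u. u \<in> ball p r \<Longrightarrow> (g has_derivative \<beta> u) (at u)"
    "smooth_on (ball p r) g"
proof -
  define G :: "'v \<Rightarrow> 'v \<Rightarrow> 'w \<times> real \<Rightarrow> 'w \<times> real" where "G u a s = (snd s *\<^sub>R \<beta> u a, 0)" for u a s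
  have hd: "((\<lambda>w. G w a s) has_derivative (\<lambda>h. (snd s *\<^sub>R FD (\<lambda>w. \<beta> w a) u h, 0))) (at u)" if "u \<in> S" for u a s
    unfolding G_def using smooth_on_has_derivative[OF sm that]
    by (intro has_derivative_Pair has_derivative_scaleR_right has_derivative_const)
  obtain r where r: "r > 0" "ball p r \<subseteq> S"
    "\<And>s0. \<exists>\<sigma>. \<sigma> p = s0 \<and> smooth_on (ball p r) \<sigma> \<and>
       (\<forall>u\<in>ball p r. (\<sigma> has_derivative (\<lambda>a. G u a (\<sigma> u))) (at u))"
  proof (rule linear_pfaffian_system[OF S, of G])
    show "linear (\<lambda>a. G u a s)" if "u \<in> S" for u s
      unfolding G_def using lin[OF that] by (auto intro!: linearI simp: linear_add linear_scale scaleR_add_right)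
    show "linear (G u a)" for u a
      unfolding G_def by (auto intro!: linearI simp: scaleR_add_left)
    show "smooth_on S (\<lambda>u. G u a s)" for a s
      unfolding G_def
      by (intro smooth_on_Pair S smooth_on_const smooth_on_linear_compose[OF S(1) bounded_linear_scaleR_right] sm)
    show "FD (\<lambda>w. G w b s) u a + G u b (G u a s) = FD (\<lambda>w. G w a s) u b + G u a (G u b s)"
      if "u \<in> S" for u a b s
      unfolding FD_eqI[OF hd[OF that]] using closed[OF that, of a b] by (simp add: G_def)
  qed metis
  obtain \<sigma> where \<sigma>: "\<sigma> p = (0, 1)" "smooth_on (ball p r) \<sigma>"
    "\<And>u. u \<in> ball p r \<Longrightarrow> (\<sigma> has_derivative (\<lambda>a. G u a (\<sigma> u))) (at u)"
    using r(3)[of "(0, 1)"] by blast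
  have snd: "((\<lambda>u. snd (\<sigma> u)) has_derivative (\<lambda>a. 0)) (at u)" if "u \<in> ball p r" for u
    using has_derivative_snd[OF \<sigma>(3)[OF that]] by (simp add: G_def)
  have 1: "snd (\<sigma> u) = 1" if u: "u \<in> ball p r" for u
  proof -
    have "\<exists>c. \<forall>x\<in>ball p r. snd (\<sigma> x) = c"
      by (rule has_derivative_zero_constant[OF convex_ball]) (rule has_derivative_at_withinI[OF snd])
    then obtain c where c: "\<And>x. x \<in> ball p r \<Longrightarrow> snd (\<sigma> x) = c" by blast
    show ?thesis using c[OF u] c[of p] r(1) \<sigma>(1) by simp
  qed
  show ?thesis
  proof (rule that[OF r(1,2)])
    show "((\<lambda>u. fst (\<sigma> u)) has_derivative \<beta> u) (at u)" if "u \<in> ball p r" for u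
      using has_derivative_fst[OF \<sigma>(3)[OF that]] by (simp add: G_def 1[OF that])
    show "smooth_on (ball p r) (\<lambda>u. fst (\<sigma> u))"
      by (rule smooth_on_linear_compose[OF open_ball bounded_linear_fst \<sigma>(2)])
  qed
qed

text \<open>\<open>FD (\<lambda>w. FD F w b) u a\<close> is the second derivative in the directions
  \<open>a\<close> and \<open>b\<close>, so this is \<open>\<nabla> dF = 0\<close> in coordinates.
  Vector values are allowed so that a whole coordinate system is one map.\<close>

definition affine_eq :: "('v::real_normed_vector \<Rightarrow> 'v \<Rightarrow> 'v \<Rightarrow> 'v) \<Rightarrow> 'v set \<Rightarrow> ('v \<Rightarrow> 'w::real_normed_vector) \<Rightarrow> bool" where
  "affine_eq \<Gamma> S F \<longleftrightarrow> smooth_on S F \<and> (\<forall>u\<in>S. \<forall>a b. FD (\<lambda>w. FD F w b) u a = FD F u (\<Gamma> u a b))"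

lemma affine_eqI:
  assumes S: "open S" and sm: "smooth_on S F"
    and d: "\<And>u. u \<in> S \<Longrightarrow> (F has_derivative F' u) (at u)"
    and d2: "\<And>u b. u \<in> S \<Longrightarrow> ((\<lambda>w. F' w b) has_derivative (\<lambda>a. F' u (\<Gamma> u a b))) (at u)"
  shows "affine_eq \<Gamma> S F"
proof -
  have "FD (\<lambda>w. FD F w b) u a = FD F u (\<Gamma> u a b)" if u: "u \<in> S" for u a b
    using FD_cong_open[OF S u, of "\<lambda>w. FD F w b" "\<lambda>w. F' w b"] FD_eqI[OF d] FD_eqI[OF d2[OF u]] u
    by simp
  then show ?thesis by (simp add: affine_eq_def sm)
qed

lemma affine_eq_has_derivative2:
  assumes "affine_eq \<Gamma> S F" "u \<in> S"
  shows "((\<lambda>w. FD F w b) has_derivative (\<lambda>a. FD F u (\<Gamma> u a b))) (at u)"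
proof -
  have "FD (\<lambda>w. FD F w b) u = (\<lambda>a. FD F u (\<Gamma> u a b))" using assms by (auto simp: affine_eq_def)
  then show ?thesis
    using assms smooth_on_has_derivative[OF smooth_on_FD, of S F u b] by (simp add: affine_eq_def)
qed

lemma affine_eq_smooth: "affine_eq \<Gamma> S F \<Longrightarrow> smooth_on S F"
  by (simp add: affine_eq_def)

lemma affine_eq_subset: "affine_eq \<Gamma> S F \<Longrightarrow> T \<subseteq> S \<Longrightarrow> affine_eq \<Gamma> T F"
  by (auto simp: affine_eq_def intro: smooth_on_subset)

lemma affine_eq_linear_compose:
  assumes S: "open S" and F: "affine_eq \<Gamma> S F" and L: "bounded_linear L"
  shows "affine_eq \<Gamma> S (\<lambda>u. L (F u))"
proof (rule affine_eqI[OF S])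
  show "smooth_on S (\<lambda>u. L (F u))"
    by (rule smooth_on_linear_compose[OF S L affine_eq_smooth[OF F]])
  show "((\<lambda>u. L (F u)) has_derivative (\<lambda>a. L (FD F u a))) (at u)" if "u \<in> S" for u
    by (rule bounded_linear.has_derivative[OF L smooth_on_has_derivative[OF affine_eq_smooth[OF F] that]])
  show "((\<lambda>w. L (FD F w b)) has_derivative (\<lambda>a. L (FD F u (\<Gamma> u a b)))) (at u)" if "u \<in> S" for u b
    by (rule bounded_linear.has_derivative[OF L affine_eq_has_derivative2[OF F that]])
qed

lemma affine_eq_add:
  assumes S: "open S" and F: "affine_eq \<Gamma> S F" and H: "affine_eq \<Gamma> S H"
  shows "affine_eq \<Gamma> S (\<lambda>u. F u + H u)"
proof (rule affine_eqI[OF S])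
  show "smooth_on S (\<lambda>u. F u + H u)"
    by (rule smooth_on_add[OF S affine_eq_smooth[OF F] affine_eq_smooth[OF H]])
  show "((\<lambda>u. F u + H u) has_derivative (\<lambda>a. FD F u a + FD H u a)) (at u)" if "u \<in> S" for u
    by (intro has_derivative_add smooth_on_has_derivative[OF _ that] affine_eq_smooth[OF F] affine_eq_smooth[OF H])
  show "((\<lambda>w. FD F w b + FD H w b) has_derivative (\<lambda>a. FD F u (\<Gamma> u a b) + FD H u (\<Gamma> u a b))) (at u)"
    if "u \<in> S" for u b
    by (intro has_derivative_add affine_eq_has_derivative2[OF _ that] F H)
qed

lemma affine_eq_const: "open S \<Longrightarrow> affine_eq \<Gamma> S (\<lambda>u. c)"
  by (rule affine_eqI[where F'="\<lambda>u a. 0"]) auto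

lemma affine_eq_sum:
  "open S \<Longrightarrow> (\<And>i. i \<in> I \<Longrightarrow> affine_eq \<Gamma> S (F i)) \<Longrightarrow> affine_eq \<Gamma> S (\<lambda>u. \<Sum>i\<in>I. F i u)"
  by (induction I rule: infinite_finite_induct) (auto intro: affine_eq_const affine_eq_add)

text \<open>
  The Christoffel symbols \<open>\<Gamma> u a b\<close> of a flat torsionfree connection in a coordinate domain \<open>D\<close>:
  the value at \<open>u\<close> of \<open>\<nabla>\<^sub>a b\<close> for constant vector fields \<open>a\<close>, \<open>b\<close>.
\<close>

locale flat_christoffel =
  fixes D :: "'v::euclidean_space set" and \<Gamma> :: "'v \<Rightarrow> 'v \<Rightarrow> 'v \<Rightarrow> 'v"
  assumes open_D: "open D"
    and linear_right: "u \<in> D \<Longrightarrow> linear (\<Gamma> u a)"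
    and smooth: "smooth_on D (\<lambda>u. \<Gamma> u a b)"
    and sym: "u \<in> D \<Longrightarrow> \<Gamma> u a b = \<Gamma> u b a"
    and flat: "u \<in> D \<Longrightarrow> FD (\<lambda>w. \<Gamma> w b c) u a + \<Gamma> u a (\<Gamma> u b c) = FD (\<lambda>w. \<Gamma> w a c) u b + \<Gamma> u b (\<Gamma> u a c)"
begin

lemma linear_left:
  assumes "u \<in> D" shows "linear (\<lambda>a. \<Gamma> u a b)"
  using linear_right[OF assms, of b] sym[OF assms, of _ b] by simp

lemma bound:
  assumes "p \<in> D"
  obtains R K where "R > 0" "K \<ge> 0" "cball p R \<subseteq> D"
    "\<And>u a b. u \<in> cball p R \<Longrightarrow> norm (\<Gamma> u a b) \<le> K * norm a * norm b"
proof -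
  obtain R where R: "R > 0" "cball p R \<subseteq> D" using assms open_D open_contains_cball by blast
  show ?thesis
    using bilinear_family_bounds[OF open_D R(2) linear_left linear_right smooth] that R by metis
qed

text \<open>The unknown covector is stored as a vector \<open>\<alpha>\<close> through the inner
  product, and \<open>adj u a\<close> is the transpose of \<open>\<Gamma> u a\<close>. In the
  integrability condition for the pair of covector and function, the first component is
  \<open>flat\<close> and the second is \<open>sym\<close>. The radius is found before
  \<open>L\<close>, so all covectors at \<open>p\<close> extend over the same ball.\<close>

lemma affine_function_exists:
  assumes p: "p \<in> D"
  obtains r where "r > 0" "ball p r \<subseteq> D"
    "\<And>L :: 'v \<Rightarrow> real. linear L \<Longrightarrow> \<exists>f. affine_eq \<Gamma> (ball p r) f \<and> FD f p = L"
proof -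
  define adj where "adj u a \<alpha> = (\<Sum>b\<in>Basis. (\<alpha> \<bullet> \<Gamma> u a b) *\<^sub>R b)" for u a \<alpha>
  have adj: "adj u a \<alpha> \<bullet> c = \<alpha> \<bullet> \<Gamma> u a c" if "u \<in> D" for u a \<alpha> c
  proof -
    have "\<alpha> \<bullet> \<Gamma> u a c = \<alpha> \<bullet> (\<Sum>b\<in>Basis. (c \<bullet> b) *\<^sub>R \<Gamma> u a b)"
      using linear_basis_expansion[OF linear_right[OF that]] by metis
    then show ?thesis by (simp add: adj_def inner_sum_left inner_sum_right inner_commute mult.commute)
  qed
  define G :: "'v \<Rightarrow> 'v \<Rightarrow> 'v \<times> real \<Rightarrow> 'v \<times> real" where "G u a s = (adj u a (fst s), fst s \<bullet> a)" for u a s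
  have hd: "((\<lambda>w. G w a s) has_derivative
      (\<lambda>h. (\<Sum>b\<in>Basis. (fst s \<bullet> FD (\<lambda>w. \<Gamma> w a b) u h) *\<^sub>R b, 0))) (at u)" if "u \<in> D" for u a s
    unfolding G_def adj_def
    by (intro has_derivative_Pair has_derivative_const has_derivative_sum has_derivative_scaleR_left
        has_derivative_inner_right smooth_on_has_derivative[OF smooth that])
  obtain r where r: "r > 0" "ball p r \<subseteq> D"
    "\<And>s0. \<exists>\<sigma>. \<sigma> p = s0 \<and> smooth_on (ball p r) \<sigma> \<and>
       (\<forall>u\<in>ball p r. (\<sigma> has_derivative (\<lambda>a. G u a (\<sigma> u))) (at u))"
  proof (rule linear_pfaffian_system[OF open_D p, of G])
    show "linear (\<lambda>a. G u a s)" if u: "u \<in> D" for u s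
      unfolding G_def adj_def
      by (auto intro!: linearI simp: linear_add[OF linear_left[OF u]] linear_scale[OF linear_left[OF u]]
          inner_add_right scaleR_add_left sum.distrib scaleR_sum_right)
    show "linear (G u a)" for u a
      unfolding G_def adj_def
      by (auto intro!: linearI simp: inner_add_left scaleR_add_left sum.distrib scaleR_sum_right)
    show "smooth_on D (\<lambda>u. G u a s)" for a s
      unfolding G_def adj_def
      by (intro smooth_on_Pair open_D smooth_on_const smooth_on_sum smooth
          smooth_on_linear_compose[OF open_D bounded_linear_scaleR_left]
          smooth_on_linear_compose[OF open_D bounded_linear_inner_right])
    fix u a b and s :: "'v \<times> real" assume u: "u \<in> D"
    have "(\<Sum>c\<in>Basis. (fst s \<bullet> FD (\<lambda>w. \<Gamma> w b c) u a) *\<^sub>R c) + adj u b (adj u a (fst s)) =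
        (\<Sum>c\<in>Basis. (fst s \<bullet> FD (\<lambda>w. \<Gamma> w a c) u b) *\<^sub>R c) + adj u a (adj u b (fst s))"
    proof (rule euclidean_eqI)
      fix c :: 'v assume c: "c \<in> Basis"
      have "fst s \<bullet> (FD (\<lambda>w. \<Gamma> w b c) u a + \<Gamma> u a (\<Gamma> u b c)) =
          fst s \<bullet> (FD (\<lambda>w. \<Gamma> w a c) u b + \<Gamma> u b (\<Gamma> u a c))"
        using flat[OF u] by simp
      then show "((\<Sum>c\<in>Basis. (fst s \<bullet> FD (\<lambda>w. \<Gamma> w b c) u a) *\<^sub>R c) + adj u b (adj u a (fst s))) \<bullet> c =
          ((\<Sum>c\<in>Basis. (fst s \<bullet> FD (\<lambda>w. \<Gamma> w a c) u b) *\<^sub>R c) + adj u a (adj u b (fst s))) \<bullet> c"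
        using c by (simp add: inner_add_left adj[OF u] inner_add_right)
    qed
    then show "FD (\<lambda>w. G w b s) u a + G u b (G u a s) = FD (\<lambda>w. G w a s) u b + G u a (G u b s)"
      unfolding FD_eqI[OF hd[OF u]] using sym[OF u, of a b] by (simp add: G_def adj[OF u])
  qed metis
  show ?thesis
  proof (rule that[OF r(1,2)])
    fix L :: "'v \<Rightarrow> real" assume L: "linear L"
    obtain \<sigma> where \<sigma>: "\<sigma> p = (\<Sum>b\<in>Basis. L b *\<^sub>R b, 0)" "smooth_on (ball p r) \<sigma>"
      "\<And>u. u \<in> ball p r \<Longrightarrow> (\<sigma> has_derivative (\<lambda>a. G u a (\<sigma> u))) (at u)"
      using r(3)[of "(\<Sum>b\<in>Basis. L b *\<^sub>R b, 0)"] by blast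
    define f where "f u = snd (\<sigma> u)" for u
    have d: "(f has_derivative (\<lambda>a. fst (\<sigma> u) \<bullet> a)) (at u)" if "u \<in> ball p r" for u
      using has_derivative_snd[OF \<sigma>(3)[OF that]] by (simp add: G_def f_def[abs_def])
    have "affine_eq \<Gamma> (ball p r) f"
    proof (rule affine_eqI[OF open_ball _ d])
      show "smooth_on (ball p r) f"
        unfolding f_def by (rule smooth_on_linear_compose[OF open_ball bounded_linear_snd \<sigma>(2)])
      fix u b assume u: "u \<in> ball p r"
      show "((\<lambda>w. fst (\<sigma> w) \<bullet> b) has_derivative (\<lambda>a. fst (\<sigma> u) \<bullet> \<Gamma> u a b)) (at u)"
        using has_derivative_inner_left[OF has_derivative_fst[OF \<sigma>(3)[OF u]], of b]
          adj[OF subsetD[OF r(2) u]] by (simp add: G_def)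
    qed
    moreover have "FD f p a = L a" for a
      using FD_eqI[OF d[of p]] r(1) \<sigma>(1) linear_basis_expansion[OF L, of a]
      by (simp add: inner_sum_left inner_commute[of a] mult.commute)
    ultimately show "\<exists>f. affine_eq \<Gamma> (ball p r) f \<and> FD f p = L" by blast
  qed
qed

text \<open>The components with differentials \<open>L v \<bullet> c\<close> at \<open>p\<close> are
  solved separately and added up, which relies on their common ball.\<close>

lemma affine_map_exists:
  assumes p: "p \<in> D" and L: "linear (L :: 'v \<Rightarrow> 'w::euclidean_space)"
  obtains r H where "r > 0" "ball p r \<subseteq> D" "affine_eq \<Gamma> (ball p r) H" "FD H p = L"
proof -
  obtain r where r: "r > 0" "ball p r \<subseteq> D"
    "\<And>L :: 'v \<Rightarrow> real. linear L \<Longrightarrow> \<exists>f. affine_eq \<Gamma> (ball p r) f \<and> FD f p = L"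
    using affine_function_exists[OF p] by blast
  have "\<exists>f. affine_eq \<Gamma> (ball p r) f \<and> FD f p = (\<lambda>v. L v \<bullet> c)" for c
    by (rule r(3)) (auto intro!: linearI simp: linear_add[OF L] linear_scale[OF L] inner_add_left)
  then obtain f where f: "\<And>c. affine_eq \<Gamma> (ball p r) (f c)" "\<And>c. FD (f c) p = (\<lambda>v. L v \<bullet> c)"
    by metis
  define H where "H u = (\<Sum>c\<in>Basis. f c u *\<^sub>R c)" for u
  have "affine_eq \<Gamma> (ball p r) H"
    unfolding H_def
    by (intro affine_eq_sum affine_eq_linear_compose[OF open_ball f(1) bounded_linear_scaleR_left]) auto
  moreover have "FD H p = L"
  proof -
    have "(H has_derivative (\<lambda>a. \<Sum>c\<in>Basis. FD (f c) p a *\<^sub>R c)) (at p)"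
      unfolding H_def using r(1)
      by (intro has_derivative_sum has_derivative_scaleR_left smooth_on_has_derivative[OF affine_eq_smooth[OF f(1)]]) auto
    then show ?thesis using FD_eqI f(2) by (fastforce simp: euclidean_representation)
  qed
  ultimately show ?thesis using that r by blast
qed

text \<open>The functions \<open>FD f u b \<bullet> c\<close>, for basis vectors \<open>b\<close>
  and \<open>c\<close>, solve a homogeneous linear system whose coefficients are the components of
  \<open>\<Gamma>\<close>. They vanish at \<open>p\<close>, hence nearby, and then \<open>f\<close>
  is locally constant with value zero.\<close>

lemma affine_eq_zero:
  fixes f :: "'v \<Rightarrow> 'w::euclidean_space"
  assumes S: "open S" "S \<subseteq> D" "p \<in> S" and f: "affine_eq \<Gamma> S f" and 0: "f p = 0" "\<And>a. FD f p a = 0"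
  shows "\<forall>\<^sub>F u in nhds p. f u = 0"
proof -
  obtain R K where R: "R > 0" "K \<ge> 0" "cball p R \<subseteq> D"
    "\<And>u a b. u \<in> cball p R \<Longrightarrow> norm (\<Gamma> u a b) \<le> K * norm a * norm b"
    using bound S by blast
  define I :: "('v \<times> 'w) set" where "I = Basis \<times> Basis"
  define \<sigma> where "\<sigma> i u = FD f u (fst i) \<bullet> snd i" for i u
  define T where "T = S \<inter> ball p R"
  have T: "open T" "p \<in> T" using S R(1) by (auto simp: T_def)
  have "\<forall>\<^sub>F u in nhds p. \<forall>i\<in>I. \<sigma> i u = 0"
  proof (rule linear_system_unique[OF T])
    show "finite I" by (simp add: I_def)
    show "(\<sigma> i has_derivative (\<lambda>a. FD f u (\<Gamma> u a (fst i)) \<bullet> snd i)) (at u)" if "u \<in> T" for i u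
      unfolding \<sigma>_def using that
      by (intro has_derivative_inner_left affine_eq_has_derivative2[OF f]) (auto simp: T_def)
    fix i u a assume i: "i \<in> I" and u: "u \<in> T"
    have uS: "u \<in> S" "u \<in> cball p R" using u by (auto simp: T_def)
    have n1: "norm (fst i) = 1" using i by (auto simp: I_def)
    have "FD f u (\<Gamma> u a (fst i)) \<bullet> snd i = (\<Sum>b\<in>Basis. (\<Gamma> u a (fst i) \<bullet> b) * \<sigma> (b, snd i) u)"
      by (subst linear_basis_expansion[OF smooth_on_linear_FD[OF affine_eq_smooth[OF f] uS(1)]])
        (simp add: \<sigma>_def inner_sum_left)
    also have "\<bar>\<dots>\<bar> \<le> (\<Sum>b\<in>Basis. K * norm a * \<bar>\<sigma> (b, snd i) u\<bar>)"
    proof (rule order_trans[OF sum_abs sum_mono])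
      fix b :: 'v assume "b \<in> Basis"
      then have "\<bar>\<Gamma> u a (fst i) \<bullet> b\<bar> \<le> K * norm a"
        using order_trans[OF Basis_le_norm R(4)[OF uS(2)], of b a "fst i"] n1 by simp
      then show "\<bar>(\<Gamma> u a (fst i) \<bullet> b) * \<sigma> (b, snd i) u\<bar> \<le> K * norm a * \<bar>\<sigma> (b, snd i) u\<bar>"
        by (simp add: abs_mult mult_right_mono)
    qed
    also have "\<dots> = K * norm a * (\<Sum>j\<in>(\<lambda>b. (b, snd i)) ` Basis. \<bar>\<sigma> j u\<bar>)"
      by (subst sum.reindex) (auto simp: inj_on_def sum_distrib_left)
    also have "\<dots> \<le> K * norm a * (\<Sum>j\<in>I. \<bar>\<sigma> j u\<bar>)"
      using i R(2) by (intro mult_left_mono sum_mono2) (auto simp: I_def)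
    finally show "\<bar>FD f u (\<Gamma> u a (fst i)) \<bullet> snd i\<bar> \<le> K * norm a * (\<Sum>j\<in>I. \<bar>\<sigma> j u\<bar>)" .
  qed (simp add: \<sigma>_def 0)
  moreover have "\<forall>\<^sub>F u in nhds p. u \<in> S" using S by (simp add: eventually_nhds_in_open)
  ultimately have "\<forall>\<^sub>F u in nhds p. (f has_derivative (\<lambda>a. 0)) (at u)"
  proof eventually_elim
    case (elim u)
    have "FD f u b = 0" if "b \<in> Basis" for b
      using elim(1) that by (auto intro: euclidean_eqI[of "FD f u b" 0] simp: I_def \<sigma>_def)
    then have "FD f u a = 0" for a
      by (subst linear_basis_expansion[OF smooth_on_linear_FD[OF affine_eq_smooth[OF f] elim(2)]]) simp
    then have "FD f u = (\<lambda>a. 0)" by blast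
    then show ?case using smooth_on_has_derivative[OF affine_eq_smooth[OF f] elim(2)] by simp
  qed
  from locally_constant[OF this] show ?thesis by (simp add: 0(1))
qed

text \<open>The hypothesis \<open>d\<close> is \<open>\<nabla> \<theta> = 0\<close> on constant
  fields. The coefficients of \<open>\<theta>\<close> on pairs of basis vectors thus solve a
  homogeneous linear system, with constant \<open>2 * K\<close> because \<open>\<Gamma>\<close>
  enters in both slots. It serves for the difference of two parallel forms that agree at a
  point.\<close>

lemma parallel_form_zero:
  fixes \<theta> :: "'v \<Rightarrow> 'v \<Rightarrow> 'v \<Rightarrow> real"
  assumes S: "open S" "S \<subseteq> D" "p \<in> S"
    and lin: "\<And>u b. u \<in> S \<Longrightarrow> linear (\<lambda>a. \<theta> u a b)" "\<And>u a. u \<in> S \<Longrightarrow> linear (\<theta> u a)"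
    and d: "\<And>u b c. u \<in> S \<Longrightarrow> ((\<lambda>w. \<theta> w b c) has_derivative (\<lambda>a. \<theta> u (\<Gamma> u a b) c + \<theta> u b (\<Gamma> u a c))) (at u)"
    and 0: "\<And>a b. \<theta> p a b = 0"
  shows "\<forall>\<^sub>F u in nhds p. \<forall>a b. \<theta> u a b = 0"
proof -
  obtain R K where R: "R > 0" "K \<ge> 0" "cball p R \<subseteq> D"
    "\<And>u a b. u \<in> cball p R \<Longrightarrow> norm (\<Gamma> u a b) \<le> K * norm a * norm b"
    using bound S by blast
  define I :: "('v \<times> 'v) set" where "I = Basis \<times> Basis"
  define \<sigma> where "\<sigma> i u = \<theta> u (fst i) (snd i)" for i u
  define T where "T = S \<inter> ball p R"
  have T: "open T" "p \<in> T" using S R(1) by (auto simp: T_def)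
  have "\<forall>\<^sub>F u in nhds p. \<forall>i\<in>I. \<sigma> i u = 0"
  proof (rule linear_system_unique[OF T])
    show "finite I" by (simp add: I_def)
    show "(\<sigma> i has_derivative (\<lambda>a. \<theta> u (\<Gamma> u a (fst i)) (snd i) + \<theta> u (fst i) (\<Gamma> u a (snd i)))) (at u)"
      if "u \<in> T" for i u
      unfolding \<sigma>_def using that by (intro d) (auto simp: T_def)
    fix i u a assume i: "i \<in> I" and u: "u \<in> T"
    have uS: "u \<in> S" "u \<in> cball p R" using u by (auto simp: T_def)
    have n1: "norm (fst i) = 1" "norm (snd i) = 1" using i by (auto simp: I_def)
    define N where "N = (\<Sum>j\<in>I. \<bar>\<sigma> j u\<bar>)"
    have \<theta>N: "\<bar>\<theta> u x y\<bar> \<le> (\<Sum>b\<in>Basis. \<bar>x \<bullet> b\<bar> * \<bar>\<theta> u b y\<bar>)" for x y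
      by (subst linear_basis_expansion[OF lin(1)[OF uS(1)]])
        (use sum_abs[of "\<lambda>b. (x \<bullet> b) *\<^sub>R \<theta> u b y" Basis] in \<open>simp add: abs_mult\<close>)
    have \<theta>N': "\<bar>\<theta> u x y\<bar> \<le> (\<Sum>b\<in>Basis. \<bar>y \<bullet> b\<bar> * \<bar>\<theta> u x b\<bar>)" for x y
      by (subst linear_basis_expansion[OF lin(2)[OF uS(1)]])
        (use sum_abs[of "\<lambda>b. (y \<bullet> b) *\<^sub>R \<theta> u x b" Basis] in \<open>simp add: abs_mult\<close>)
    have \<Gamma>: "\<bar>\<Gamma> u a c \<bullet> b\<bar> \<le> K * norm a" if "norm c = 1" "b \<in> Basis" for b c
      using order_trans[OF Basis_le_norm R(4)[OF uS(2)], of b a c] that by simp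
    have "\<bar>\<theta> u (\<Gamma> u a (fst i)) (snd i)\<bar> \<le> (\<Sum>b\<in>Basis. K * norm a * \<bar>\<sigma> (b, snd i) u\<bar>)"
      by (rule order_trans[OF \<theta>N sum_mono]) (auto simp: \<sigma>_def intro!: mult_right_mono \<Gamma> n1)
    also have "\<dots> = K * norm a * (\<Sum>j\<in>(\<lambda>b. (b, snd i)) ` Basis. \<bar>\<sigma> j u\<bar>)"
      by (subst sum.reindex) (auto simp: inj_on_def sum_distrib_left)
    also have "\<dots> \<le> K * norm a * N"
      unfolding N_def using i R(2) by (intro mult_left_mono sum_mono2) (auto simp: I_def)
    finally have 1: "\<bar>\<theta> u (\<Gamma> u a (fst i)) (snd i)\<bar> \<le> K * norm a * N" .
    have "\<bar>\<theta> u (fst i) (\<Gamma> u a (snd i))\<bar> \<le> (\<Sum>b\<in>Basis. K * norm a * \<bar>\<sigma> (fst i, b) u\<bar>)"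
      by (rule order_trans[OF \<theta>N' sum_mono]) (auto simp: \<sigma>_def intro!: mult_right_mono \<Gamma> n1)
    also have "\<dots> = K * norm a * (\<Sum>j\<in>(\<lambda>b. (fst i, b)) ` Basis. \<bar>\<sigma> j u\<bar>)"
      by (subst sum.reindex) (auto simp: inj_on_def sum_distrib_left)
    also have "\<dots> \<le> K * norm a * N"
      unfolding N_def using i R(2) by (intro mult_left_mono sum_mono2) (auto simp: I_def)
    finally have 2: "\<bar>\<theta> u (fst i) (\<Gamma> u a (snd i))\<bar> \<le> K * norm a * N" .
    show "\<bar>\<theta> u (\<Gamma> u a (fst i)) (snd i) + \<theta> u (fst i) (\<Gamma> u a (snd i))\<bar> \<le>
        (2 * K) * norm a * (\<Sum>j\<in>I. \<bar>\<sigma> j u\<bar>)"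
      using 1 2 by (simp add: N_def abs_le_iff)
  qed (simp add: \<sigma>_def 0)
  moreover have "\<forall>\<^sub>F u in nhds p. u \<in> S" using S by (simp add: eventually_nhds_in_open)
  ultimately show ?thesis
  proof eventually_elim
    case (elim u)
    have "\<theta> u a c = 0" if "c \<in> Basis" for a c
      by (subst linear_basis_expansion[OF lin(1)[OF elim(2)]])
        (use elim(1) that in \<open>auto simp: I_def \<sigma>_def\<close>)
    then have "\<theta> u a b = 0" for a b
      by (subst linear_basis_expansion[OF lin(2)[OF elim(2)]]) simp
    then show ?case by blast
  qed
qed

end

section \<open>Inverse functions and symplectic linear algebra\<close>

lemma linear_inj_imp_surj_DIM:
  fixes L :: "'v::euclidean_space \<Rightarrow> 'w::euclidean_space"
  assumes "linear L" "inj L" "DIM('v) = DIM('w)"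
  shows "surj L"
proof -
  have "dim (range L) = DIM('w)"
    using dim_image_eq[OF assms(1), of UNIV] assms(2,3) by (simp add: inj_on_subset)
  then have "span (range L) = UNIV" by (simp add: dim_eq_full)
  then show ?thesis
    using linear_subspace_image[OF assms(1) subspace_UNIV] by (metis span_eq_iff)
qed

text \<open>Where \<open>\<phi>\<close> vanishes, the term with the derivative of
  \<open>\<psi>\<close> drops out of the product rule, and continuity of \<open>\<psi>\<close>
  suffices. This makes an inverse differential differentiable when only its continuity is
  known.\<close>

lemma has_derivative_scaleR_vanishing:
  fixes \<phi> :: "'v::real_normed_vector \<Rightarrow> real" and \<psi> :: "'v \<Rightarrow> 'w::real_normed_vector"
  assumes \<phi>: "(\<phi> has_derivative \<phi>') (at x)" "\<phi> x = 0" and \<psi>: "isCont \<psi> x"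
  shows "((\<lambda>y. \<phi> y *\<^sub>R \<psi> y) has_derivative (\<lambda>h. \<phi>' h *\<^sub>R \<psi> x)) (at x)"
proof -
  have bl: "bounded_linear \<phi>'" using \<phi>(1) by (rule has_derivative_bounded_linear)
  have "((\<lambda>y. \<phi> y *\<^sub>R (\<psi> y - \<psi> x)) has_derivative (\<lambda>h. 0)) (at x)"
    unfolding has_derivative_at_alt
  proof (intro conjI allI impI)
    fix e :: real assume e: "e > 0"
    obtain d1 where d1: "d1 > 0" "\<And>y. norm (y - x) < d1 \<Longrightarrow> norm (\<phi> y - \<phi> x - \<phi>' (y - x)) \<le> 1 * norm (y - x)"
      using \<phi>(1) unfolding has_derivative_at_alt using zero_less_one by blast
    define C where "C = 1 + onorm \<phi>'"
    have C: "C > 0" using onorm_pos_le[OF bl] by (simp add: C_def)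
    obtain d2 where d2: "d2 > 0" "\<And>y. dist y x < d2 \<Longrightarrow> dist (\<psi> y) (\<psi> x) < e / C"
      using \<psi> e C unfolding continuous_at_eps_delta by (meson divide_pos_pos)
    show "\<exists>d>0. \<forall>y. norm (y - x) < d \<longrightarrow>
        norm (\<phi> y *\<^sub>R (\<psi> y - \<psi> x) - \<phi> x *\<^sub>R (\<psi> x - \<psi> x) - 0) \<le> e * norm (y - x)"
    proof (intro exI[of _ "min d1 d2"] conjI allI impI)
      fix y assume y: "norm (y - x) < min d1 d2"
      have "norm (\<phi> y) \<le> norm (\<phi>' (y - x)) + norm (y - x)"
        using norm_triangle_sub[of "\<phi> y" "\<phi>' (y - x)"] d1(2)[of y] y \<phi>(2) by simp
      also have "\<dots> \<le> C * norm (y - x)"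
        using onorm[OF bl, of "y - x"] by (simp add: C_def algebra_simps)
      finally have 1: "norm (\<phi> y) \<le> C * norm (y - x)" .
      have 2: "norm (\<psi> y - \<psi> x) \<le> e / C" using d2(2)[of y] y by (simp add: dist_norm less_imp_le)
      have "norm (\<phi> y *\<^sub>R (\<psi> y - \<psi> x)) \<le> (C * norm (y - x)) * (e / C)"
        unfolding norm_scaleR using 1 2 C by (intro mult_mono) auto
      also have "\<dots> = e * norm (y - x)" using C by simp
      finally show "norm (\<phi> y *\<^sub>R (\<psi> y - \<psi> x) - \<phi> x *\<^sub>R (\<psi> x - \<psi> x) - 0) \<le> e * norm (y - x)"
        by simp
    qed (use d1 d2 in auto)
  qed simp
  from has_derivative_add[OF this has_derivative_scaleR_left[OF \<phi>(1), of "\<psi> x"]]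
  show ?thesis by (simp add: algebra_simps)
qed

definition diffeo_on :: "'v::real_normed_vector set \<Rightarrow> ('v \<Rightarrow> 'w::real_normed_vector) \<Rightarrow> bool" where
  "diffeo_on S H \<longleftrightarrow> open S \<and> smooth_on S H \<and> inj_on H S \<and> open (H ` S) \<and>
     smooth_on (H ` S) (inv_into S H)"

text \<open>The image of \<open>T\<close> is the preimage of \<open>T\<close> under the continuous
  inverse, hence open. Since \<open>inv_into\<close> refers to the domain, the two inverses have to
  be compared on that image.\<close>

lemma diffeo_on_subset:
  assumes H: "diffeo_on S H" and T: "open T" "T \<subseteq> S"
  shows "diffeo_on T H"
proof -
  have eq: "inv_into T H y = inv_into S H y" if "y \<in> H ` T" for y
    using that T H by (auto simp: diffeo_on_def inv_into_f_f inj_on_subset subset_iff)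
  have "H ` T = H ` S \<inter> inv_into S H -` T"
    using T H by (auto simp: diffeo_on_def inv_into_f_f image_iff)
  also have "open \<dots>"
    using H T by (intro continuous_open_preimage smooth_on_continuous) (auto simp: diffeo_on_def)
  finally have op: "open (H ` T)" .
  moreover have "smooth_on (H ` T) (inv_into T H)"
    using smooth_on_cong[OF op eq] smooth_on_subset[of "H ` S" "inv_into S H" "H ` T"] H T
    by (auto simp: diffeo_on_def)
  ultimately show ?thesis
    using H T by (auto simp: diffeo_on_def intro: smooth_on_subset inj_on_subset)
qed

lemma diffeo_on_FD_inverse:
  assumes H: "diffeo_on S H" and u: "u \<in> S"
  shows "FD (inv_into S H) (H u) (FD H u a) = a" "FD H u (FD (inv_into S H) (H u) b) = b"
proof -
  let ?g = "inv_into S H"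
  have d: "(H has_derivative FD H u) (at u)" "(?g has_derivative FD ?g (H u)) (at (H u))"
    using H u by (auto simp: diffeo_on_def intro!: smooth_on_has_derivative)
  have gH: "?g (H u) = u" using H u by (simp add: diffeo_on_def)
  have "((\<lambda>x. ?g (H x)) has_derivative (\<lambda>a. FD ?g (H u) (FD H u a))) (at u)"
    using diff_chain_at[OF d] by (simp add: o_def)
  moreover have "((\<lambda>x. ?g (H x)) has_derivative (\<lambda>a. a)) (at u)"
    using H u has_derivative_cong_open[of S u "\<lambda>x. ?g (H x)" "\<lambda>x. x" "\<lambda>a. a"]
    by (auto simp: diffeo_on_def)
  ultimately show "FD ?g (H u) (FD H u a) = a" using has_derivative_unique by metis
  have "((\<lambda>y. H (?g y)) has_derivative (\<lambda>b. FD H u (FD ?g (H u) b))) (at (H u))"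
    using diff_chain_at[of ?g "FD ?g (H u)" "H u" H "FD H u"] d gH by (simp add: o_def)
  moreover have "((\<lambda>y. H (?g y)) has_derivative (\<lambda>b. b)) (at (H u))"
    using H u has_derivative_cong_open[of "H ` S" "H u" "\<lambda>y. H (?g y)" "\<lambda>y. y" "\<lambda>b. b"]
    by (auto simp: diffeo_on_def f_inv_into_f)
  ultimately show "FD H u (FD ?g (H u) b) = b" using has_derivative_unique by metis
qed

text \<open>
  The derivative of \<open>y \<mapsto> (DK (g y))\<^sup>-\<^sup>1 e\<close> is again a polynomial in the inverse differential and
  the derivatives of \<open>K\<close>, which bootstraps a differentiable inverse \<open>g\<close> to a smooth one.
\<close>

lemma smooth_on_inverse:
  fixes K g :: "'v::euclidean_space \<Rightarrow> 'v"
  assumes S: "open S" and K: "smooth_on S K" and V: "open V" and gS: "g ` V \<subseteq> S"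
    and g: "\<And>y. y \<in> V \<Longrightarrow> (g has_derivative g' y) (at y)"
    and inv: "\<And>y a. y \<in> V \<Longrightarrow> g' y (FD K (g y) a) = a" "\<And>y a. y \<in> V \<Longrightarrow> FD K (g y) (g' y a) = a"
  shows "smooth_on V g"
proof -
  have lin: "linear (g' y)" if "y \<in> V" for y using g[OF that] by (rule has_derivative_linear)
  have linK: "linear (FD K (g y))" if "y \<in> V" for y
    using that gS by (intro smooth_on_linear_FD[OF K]) auto
  \<comment> \<open>Let \<open>A = FD K (g y)\<close> and \<open>A' = FD K (g y')\<close> have
    inverses \<open>B = g' y\<close> and \<open>B' = g' y'\<close>. Then
    \<open>\<rho> y e y'\<close> is \<open>(A - A') B e\<close>, and \<open>\<rho>_eq\<close> is the
    resolvent identity \<open>B' - B = B' (A - A') B\<close>.\<close>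
  define \<rho> where "\<rho> y e y' = FD K (g y) (g' y e) - FD K (g y') (g' y e)" for y e y'
  have \<rho>_d: "(\<rho> y e has_derivative (\<lambda>h. - FD (\<lambda>x. FD K x (g' y e)) (g y) (g' y h))) (at y)"
    if y: "y \<in> V" for y e
  proof -
    have "((\<lambda>y'. FD K (g y') (g' y e)) has_derivative (\<lambda>h. FD (\<lambda>x. FD K x (g' y e)) (g y) (g' y h))) (at y)"
      using y gS diff_chain_at[OF g[OF y] smooth_on_has_derivative[OF smooth_on_FD[OF K]], of "g' y e"]
      by (auto simp: o_def)
    then show ?thesis unfolding \<rho>_def by (auto intro!: derivative_eq_intros)
  qed
  have \<rho>_eq: "g' y' e - g' y e = g' y' (\<rho> y e y')" if "y \<in> V" "y' \<in> V" for y y' e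
    using that by (simp add: \<rho>_def inv linear_diff[OF lin])
  have cont: "isCont (\<lambda>y'. g' y' e) y" if y: "y \<in> V" for y e
  proof -
    have "inj (FD K (g y))" using inv(1)[OF y] by (metis injI)
    then obtain c where c: "c > 0" "\<And>a. c * norm a \<le> norm (FD K (g y) a)"
      using linear_inj_bounded_below_pos[OF linK[OF y]] by metis
    \<comment> \<open>\<open>C y'\<close> bounds the operator norm of the difference of the
      differentials at \<open>g y'\<close> and \<open>g y\<close>. Once it is below
      \<open>c / 2\<close>, the differential at \<open>g y'\<close> is still bounded below by
      \<open>c / 2\<close>, so its inverse is bounded by \<open>2 / c\<close>.\<close>
    define C where "C y' = (\<Sum>b\<in>Basis. norm (FD K (g y') b - FD K (g y) b))" for y'
    have contK: "isCont (\<lambda>y'. FD K (g y') b) y" for b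
    proof -
      have "continuous_on V (\<lambda>y'. FD K (g y') b)"
        by (rule continuous_on_compose2[OF smooth_on_continuous[OF smooth_on_FD[OF K]]
              has_derivative_continuous_on[OF has_derivative_at_withinI[OF g]] gS])
      then show ?thesis using y V by (simp add: continuous_on_eq_continuous_at)
    qed
    have "(C \<longlongrightarrow> (\<Sum>b\<in>Basis. norm (FD K (g y) b - FD K (g y) b))) (at y)"
      unfolding C_def by (intro tendsto_intros) (use contK in \<open>auto simp: isCont_def\<close>)
    then have "\<forall>\<^sub>F y' in at y. C y' < c / 2"
      using c(1) by (intro order_tendstoD(2)) auto
    moreover have "\<forall>\<^sub>F y' in at y. y' \<in> V"
      using y V by (simp add: eventually_at_in_open')
    ultimately have le: "\<forall>\<^sub>F y' in at y. norm (g' y' e - g' y e) \<le> 2 / c * norm (\<rho> y e y')"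
    proof eventually_elim
      case (elim y')
      have "c * norm a \<le> 2 * norm (FD K (g y') a)" for a
      proof -
        have "norm (FD K (g y') a - FD K (g y) a) \<le> C y' * norm a"
          unfolding C_def
          by (rule linear_norm_le_Basis[OF linear_compose_sub[OF linK[OF elim(2)] linK[OF y]]]) simp
        also have "\<dots> \<le> c / 2 * norm a" using elim(1) by (intro mult_right_mono) auto
        finally show ?thesis
          using c(2)[of a] norm_triangle_ineq2[of "FD K (g y) a" "FD K (g y') a"]
          by (simp add: norm_minus_commute)
      qed
      from this[of "g' y' (\<rho> y e y')"] show ?case
        using c(1) by (simp add: inv(2)[OF elim(2)] \<rho>_eq[OF y elim(2)] field_simps)
    qed
    have "((\<lambda>y'. 2 / c * norm (\<rho> y e y')) \<longlongrightarrow> 2 / c * norm (\<rho> y e y)) (at y)"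
      using has_derivative_continuous[OF \<rho>_d[OF y]] by (intro tendsto_intros) (simp add: isCont_def)
    then have "((\<lambda>y'. 2 / c * norm (\<rho> y e y')) \<longlongrightarrow> 0) (at y)" by (simp add: \<rho>_def)
    from Lim_null_comparison[OF le this] show ?thesis
      unfolding isCont_def by (rule LIM_zero_cancel)
  qed
  \<comment> \<open>The vector \<open>\<rho> y e y'\<close> is zero at \<open>y' = y\<close>.
    Expanded in a basis, the right-hand side of \<open>\<rho>_eq\<close> is a sum of products of a
    differentiable factor vanishing at \<open>y\<close> and a continuous factor
    \<open>g' y' b\<close>, so the product rule at a zero applies.\<close>
  have d: "((\<lambda>y'. g' y' e) has_derivative
      (\<lambda>h. g' y (- FD (\<lambda>x. FD K x (g' y e)) (g y) (g' y h)))) (at y)" if y: "y \<in> V" for y e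
  proof -
    define \<rho>' where "\<rho>' h = - FD (\<lambda>x. FD K x (g' y e)) (g y) (g' y h)" for h
    have "((\<lambda>y'. g' y e + (\<Sum>b\<in>Basis. (\<rho> y e y' \<bullet> b) *\<^sub>R g' y' b)) has_derivative
        (\<lambda>h. 0 + (\<Sum>b\<in>Basis. (\<rho>' h \<bullet> b) *\<^sub>R g' y b))) (at y)"
      unfolding \<rho>'_def
      by (intro has_derivative_add has_derivative_const has_derivative_sum has_derivative_scaleR_vanishing
          has_derivative_inner_left \<rho>_d[OF y] cont[OF y]) (simp add: \<rho>_def)
    moreover have "g' y (\<rho>' h) = 0 + (\<Sum>b\<in>Basis. (\<rho>' h \<bullet> b) *\<^sub>R g' y b)" for h
      unfolding add_0_left by (rule linear_basis_expansion[OF lin[OF y]])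
    ultimately have "((\<lambda>y'. g' y e + (\<Sum>b\<in>Basis. (\<rho> y e y' \<bullet> b) *\<^sub>R g' y' b)) has_derivative
        (\<lambda>h. g' y (\<rho>' h))) (at y)" by simp
    then show ?thesis
      unfolding \<rho>'_def
    proof (rule has_derivative_cong_open[OF V y, THEN iffD2, rotated])
      fix y' assume y': "y' \<in> V"
      show "g' y' e = g' y e + (\<Sum>b\<in>Basis. (\<rho> y e y' \<bullet> b) *\<^sub>R g' y' b)"
        using \<rho>_eq[OF y y', of e] linear_basis_expansion[OF lin[OF y'], of "\<rho> y e y'"]
        by (metis add.commute diff_add_cancel)
    qed
  qed
  have Ck: "Ck_on k V (\<lambda>y. g' y e)" for k e
  proof (induction k arbitrary: e)
    case 0
    have "continuous_on V (\<lambda>y. g' y e)"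
      using cont by (simp add: continuous_at_imp_continuous_on)
    then show ?case by simp
  next
    case (Suc k)
    have Ckg: "Ck_on k V g" by (rule Ck_on_SucD[OF Ck_on_SucI[OF g Suc V]])
    have 1: "Ck_on k V (\<lambda>y. FD (\<lambda>x. FD K x a) (g y) b)" for a b
      using smooth_on_FD[OF smooth_on_FD[OF K, of a], of b] gS
      by (intro Ck_on_compose[OF V Ckg, of S "\<lambda>x. FD (\<lambda>x. FD K x a) x b"]) (auto simp: smooth_on_def)
    have 2: "Ck_on k V (\<lambda>y. FD (\<lambda>x. FD K x (g' y e)) (g y) b)" for b
    proof (rule Ck_on_apply[OF V _ 1 Suc])
      fix y assume "y \<in> V"
      then show "linear (\<lambda>a. FD (\<lambda>x. FD K x a) (g y) b)"
        using gS by (intro linear_FD_param[OF S smooth_on_linear_FD[OF K]]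
            smooth_on_differentiable[OF smooth_on_FD[OF K]]) auto
    qed
    have 3: "Ck_on k V (\<lambda>y. FD (\<lambda>x. FD K x (g' y e)) (g y) (g' y h))" for h
    proof (rule Ck_on_apply[OF V _ 2 Suc])
      fix y assume "y \<in> V"
      then show "linear (FD (\<lambda>x. FD K x (g' y e)) (g y))"
        using gS by (intro smooth_on_linear_FD[OF smooth_on_FD[OF K]]) auto
    qed
    have 4: "Ck_on k V (\<lambda>y. g' y (- FD (\<lambda>x. FD K x (g' y e)) (g y) (g' y h)))" for h
      by (rule Ck_on_apply[OF V lin Suc])
        (simp_all add: Ck_on_linear_compose[OF V bounded_linear_minus[OF bounded_linear_ident] 3])
    show ?case by (rule Ck_on_SucI[OF d 4 V])
  qed
  show ?thesis
    by (rule smooth_onI_FD[OF g _ V]) (simp_all add: smooth_on_def Ck)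
qed

text \<open>Composing \<open>H\<close> with the inverse of its differential at \<open>p\<close>
  gives a map \<open>K\<close> of the space into itself whose differential at \<open>p\<close> is
  the identity. This settles both the different target type and the inverse that the inverse
  function theorem asks for.\<close>

lemma smooth_inverse_function:
  fixes H :: "'v::euclidean_space \<Rightarrow> 'w::euclidean_space"
  assumes S: "open S" "p \<in> S" and H: "smooth_on S H" and inj: "inj (FD H p)" and D: "DIM('v) = DIM('w)"
  obtains T where "p \<in> T" "T \<subseteq> S" "diffeo_on T H"
proof -
  define N where "N = FD H p"
  have N: "linear N" unfolding N_def by (rule smooth_on_linear_FD[OF H S(2)])
  have bij: "bij N" using linear_inj_imp_surj_DIM[OF N _ D] inj by (simp add: N_def bij_def)
  define M where "M = inv N"
  have MN: "M (N a) = a" "N (M b) = b" for a b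
    using bij by (auto simp: M_def bij_def inv_f_f surj_f_inv_f)
  have M: "linear M"
    by (rule linearI) (metis MN linear_add[OF N], metis MN linear_scale[OF N])
  have bM: "bounded_linear M" "bounded_linear N" using M N by (auto simp: linear_conv_bounded_linear)
  define K where "K u = M (H u)" for u
  have K: "smooth_on S K" unfolding K_def by (rule smooth_on_linear_compose[OF S(1) bM(1) H])
  define f' where "f' u = Blinfun (FD K u)" for u
  have f': "blinfun_apply (f' u) = FD K u" if "u \<in> S" for u
    unfolding f'_def using smooth_on_has_derivative[OF K that] has_derivative_bounded_linear
    by (intro bounded_linear_Blinfun_apply) blast
  have FDKp: "FD K p = (\<lambda>a. a)"
  proof -
    have "(K has_derivative (\<lambda>a. M (N a))) (at p)"
      unfolding K_def N_def by (rule bounded_linear.has_derivative[OF bM(1) smooth_on_has_derivative[OF H S(2)]])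
    then show ?thesis using FD_eqI by (force simp: MN)
  qed
  obtain U V g g' where UV: "open U" "U \<subseteq> S" "p \<in> U" "open V" "K p \<in> V" "homeomorphism U V K g"
    "\<And>y. y \<in> V \<Longrightarrow> (g has_derivative (g' y)) (at y)"
    "\<And>y. y \<in> V \<Longrightarrow> g' y = inv (blinfun_apply (f'(g y)))"
    "\<And>y. y \<in> V \<Longrightarrow> bij (blinfun_apply (f'(g y)))"
  proof (rule inverse_function_theorem[OF S(1), of K f' p id_blinfun])
    show "(K has_derivative blinfun_apply (f' x)) (at x)" if "x \<in> S" for x
      using smooth_on_has_derivative[OF K that] by (simp add: f'[OF that])
    show "continuous_on S f'"
    proof (rule continuous_on_blinfun_componentwise)
      fix i :: 'v
      have "continuous_on S (\<lambda>x. FD K x i)" by (rule smooth_on_continuous[OF smooth_on_FD[OF K]])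
      then show "continuous_on S (\<lambda>x. blinfun_apply (f' x) i)"
        by (rule continuous_on_cong[THEN iffD2, OF refl, rotated]) (simp add: f')
    qed
    show "id_blinfun o\<^sub>L f' p = id_blinfun"
      by (rule blinfun_eqI) (simp add: f'[OF S(2)] FDKp)
  qed (use S that in blast)+
  have gU: "g ` V = U" "\<And>y. y \<in> V \<Longrightarrow> K (g y) = y" "\<And>u. u \<in> U \<Longrightarrow> g (K u) = u" "K ` U = V"
    using UV(6) by (auto simp: homeomorphism_def)
  have "smooth_on V g"
  proof (rule smooth_on_inverse[OF S(1) K UV(4) _ UV(7)])
    show "g ` V \<subseteq> S" using gU(1) UV(2) by simp
    fix y a assume y: "y \<in> V"
    then have "g y \<in> S" using gU(1) UV(2) by auto
    then have "g' y = inv (FD K (g y))" "bij (FD K (g y))" using UV(8,9)[OF y] by (simp_all add: f')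
    then show "g' y (FD K (g y) a) = a" "FD K (g y) (g' y a) = a"
      by (auto simp: bij_def inv_f_f surj_f_inv_f)
  qed
  have injH: "inj_on H U" by (rule inj_onI) (metis K_def gU(3))
  have HU: "H ` U = M -` V"
  proof (intro equalityI subsetI)
    fix y assume "y \<in> M -` V"
    then obtain u where u: "u \<in> U" "M y = K u" using gU(4) by auto
    then have "y = H u" unfolding K_def using MN(2) by metis
    then show "y \<in> H ` U" using u(1) by simp
  qed (use gU(4) in \<open>auto simp: K_def\<close>)
  have contM: "continuous_on UNIV M" using bM(1) linear_continuous_on by blast
  have op: "open (H ` U)" unfolding HU by (rule open_vimage[OF UV(4) contM])
  have inv: "inv_into U H y = g (M y)" if "y \<in> H ` U" for y
    using that injH gU(3) by (auto simp: inv_into_f_f K_def)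
  have "smooth_on (H ` U) (\<lambda>y. g (M y))"
    by (rule smooth_on_compose[OF op smooth_on_bounded_linear[OF bM(1)] \<open>smooth_on V g\<close>]) (auto simp: HU)
  then have "smooth_on (H ` U) (inv_into U H)"
    using smooth_on_cong[OF op inv] by simp
  then have "diffeo_on U H"
    using UV(1) op injH smooth_on_subset[OF H UV(2)] by (simp add: diffeo_on_def)
  then show ?thesis using that UV(2,3) by blast
qed


section \<open>Symplectic linear algebra on a complex vector space\<close>

abbreviation J :: "complex^'n \<Rightarrow> complex^'n" where "J v \<equiv> \<i> *s v"

lemma linear_J: "linear (J :: complex^'n \<Rightarrow> complex^'n)"
  by (rule linearI) (simp_all add: vec_eq_iff algebra_simps)

lemma J_J [simp]: "J (J v) = - v"
  by (simp add: vec_eq_iff)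

text \<open>One step of a symplectic Gram-Schmidt process: a partial frame is enlarged by a pair
  from its \<open>\<omega>\<close>-orthogonal space. \<open>Jinv\<close> switches on the requirement
  that the second vector be a multiple of \<open>J\<close> applied to the first. The normalisation
  \<open>2\<close> is that of
  \<open>\<omega> = 2 \<Sum> dx\<^sup>i \<and> dy\<^sub>i\<close>.\<close>

lemma symplectic_frame_extend:
  fixes \<omega> :: "complex^'n \<Rightarrow> complex^'n \<Rightarrow> real" and e f :: "'n \<Rightarrow> complex^'n"
  assumes lin: "\<And>v. linear (\<lambda>u. \<omega> u v)" and skew: "\<And>u v. \<omega> u v = - \<omega> v u"
    and nondeg: "\<And>u. (\<And>v. \<omega> u v = 0) \<Longrightarrow> u = 0"
    and k: "k \<notin> I"
    and frame: "\<And>i j. i \<in> I \<Longrightarrow> j \<in> I \<Longrightarrow> \<omega> (e i) (e j) = 0 \<and> \<omega> (f i) (f j) = 0 \<and>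
       \<omega> (e i) (f j) = (if i = j then 2 else 0)"
    and J: "Jinv \<Longrightarrow> (\<forall>u v. \<omega> (J u) (J v) = \<omega> u v) \<and> (\<forall>i\<in>I. \<exists>c. f i = c *\<^sub>R J (e i))"
  obtains a b where "\<And>i. i \<in> I \<Longrightarrow> \<omega> a (e i) = 0 \<and> \<omega> a (f i) = 0 \<and> \<omega> b (e i) = 0 \<and> \<omega> b (f i) = 0"
    "\<omega> a b = 2" "Jinv \<Longrightarrow> \<exists>c. b = c *\<^sub>R J a"
proof -
  have lin2: "linear (\<omega> u)" for u
    using linear_compose_neg[OF lin[of u]] skew by (metis (no_types, lifting) ext)
  note simps = linear_add[OF lin] linear_add[OF lin2] linear_scale[OF lin] linear_scale[OF lin2]
    linear_diff[OF lin] linear_diff[OF lin2] linear_neg[OF lin] linear_neg[OF lin2]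
    linear_sum[OF lin] linear_sum[OF lin2]
  define perp where "perp v \<longleftrightarrow> (\<forall>i\<in>I. \<omega> v (e i) = 0 \<and> \<omega> v (f i) = 0)" for v
  define \<Phi> :: "complex^'n \<Rightarrow> (real^'n) \<times> (real^'n)" where
    "\<Phi> v = ((\<chi> i. if i \<in> I then \<omega> v (e i) else 0), (\<chi> i. if i \<in> I then \<omega> v (f i) else 0))" for v
  have lin\<Phi>: "linear \<Phi>"
    by (rule linearI) (simp_all add: \<Phi>_def vec_eq_iff simps)
  \<comment> \<open>Dimension count: \<open>\<Phi>\<close> maps between real spaces of equal
    dimension, and the entries with index \<open>k\<close> of its values are zero since
    \<open>k\<close> is not in \<open>I\<close>. So \<open>\<Phi>\<close> has a kernel, whose
    elements are orthogonal to the frame.\<close>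
  have "\<not> surj \<Phi>"
  proof
    assume "surj \<Phi>"
    then obtain v where "\<Phi> v = (axis k 1, 0)" by (metis surjD)
    then have "fst (\<Phi> v) $ k = 1" by (simp add: axis_def)
    then show False using k by (simp add: \<Phi>_def)
  qed
  then have "\<not> inj \<Phi>"
    using linear_inj_imp_surj_DIM[OF lin\<Phi>] by auto
  then obtain e0 where e0: "e0 \<noteq> 0" "\<Phi> e0 = 0"
    using linear_injective_0[OF lin\<Phi>] by auto
  have perp_e0: "perp e0"
  proof -
    have "(if i \<in> I then \<omega> e0 (e i) else 0) = 0" "(if i \<in> I then \<omega> e0 (f i) else 0) = 0" for i
      using e0(2) by (simp_all add: \<Phi>_def vec_eq_iff prod_eq_iff)
    then show ?thesis unfolding perp_def by metis
  qed
  obtain f0 where f0: "\<omega> e0 f0 \<noteq> 0" using nondeg e0(1) by blast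
  \<comment> \<open>The symplectic projection along the frame: \<open>P v\<close> removes from
    \<open>v\<close> its components on the \<open>e i\<close> and \<open>f i\<close>. As
    \<open>e0\<close> is orthogonal to the frame, \<open>\<omega> e0 (P v) = \<omega> e0 v\<close>,
    so \<open>f0\<close> can be corrected without losing its pairing with \<open>e0\<close>.\<close>
  define P where "P v = v - (\<Sum>i\<in>I. (\<omega> v (f i) / 2) *\<^sub>R e i + (\<omega> (e i) v / 2) *\<^sub>R f i)" for v
  have fin: "finite I" by simp
  have fe: "\<omega> (f i) (e j) = - (if i = j then 2 else 0)" if "i \<in> I" "j \<in> I" for i j
    using frame[OF that(2,1)] skew[of "f i" "e j"] by simp
  have perp_P: "perp (P v)" for v
    unfolding perp_def
  proof (intro ballI conjI)
    fix j assume j: "j \<in> I"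
    have "\<omega> (P v) (e j) = \<omega> v (e j) - (\<Sum>i\<in>I. (\<omega> v (f i) / 2) * \<omega> (e i) (e j) + (\<omega> (e i) v / 2) * \<omega> (f i) (e j))"
      by (simp add: P_def simps)
    also have "(\<Sum>i\<in>I. (\<omega> v (f i) / 2) * \<omega> (e i) (e j) + (\<omega> (e i) v / 2) * \<omega> (f i) (e j)) =
        (\<Sum>i\<in>I. if i = j then - \<omega> (e i) v else 0)"
      using j by (intro sum.cong refl) (simp add: frame fe)
    also have "\<dots> = - \<omega> (e j) v" using j fin by simp
    finally show "\<omega> (P v) (e j) = 0" using skew[of v "e j"] by simp
    have "\<omega> (P v) (f j) = \<omega> v (f j) - (\<Sum>i\<in>I. (\<omega> v (f i) / 2) * \<omega> (e i) (f j) + (\<omega> (e i) v / 2) * \<omega> (f i) (f j))"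
      by (simp add: P_def simps)
    also have "(\<Sum>i\<in>I. (\<omega> v (f i) / 2) * \<omega> (e i) (f j) + (\<omega> (e i) v / 2) * \<omega> (f i) (f j)) =
        (\<Sum>i\<in>I. if i = j then \<omega> v (f i) else 0)"
      using j by (intro sum.cong refl) (simp add: frame)
    also have "\<dots> = \<omega> v (f j)" using j fin by simp
    finally show "\<omega> (P v) (f j) = 0" by simp
  qed
  define f1 where "f1 = P f0"
  have f1: "\<omega> e0 f1 \<noteq> 0" "perp f1"
  proof -
    have "\<omega> e0 f1 = \<omega> e0 f0 - (\<Sum>i\<in>I. (\<omega> f0 (f i) / 2) * \<omega> e0 (e i) + (\<omega> (e i) f0 / 2) * \<omega> e0 (f i))"
      by (simp add: f1_def P_def simps)
    then show "\<omega> e0 f1 \<noteq> 0" using perp_e0 f0 by (simp add: perp_def)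
  qed (simp add: f1_def perp_P)
  show ?thesis
  proof (cases Jinv)
    case False
    show ?thesis
      by (rule that[of e0 "(2 / \<omega> e0 f1) *\<^sub>R f1"])
        (use False perp_e0 f1 in \<open>auto simp: perp_def simps\<close>)
  next
    case True
    have Jw: "\<omega> (J u) (J v) = \<omega> u v" for u v using J[OF True] by blast
    have Jw2: "\<omega> (J u) v = - \<omega> u (J v)" for u v using Jw[of u "J v"] by (simp add: simps)
    have perp_J: "perp (J v)" if v: "perp v" for v
      unfolding perp_def
    proof (intro ballI conjI)
      fix i assume i: "i \<in> I"
      obtain c where c: "f i = c *\<^sub>R J (e i)" using J[OF True] i by blast
      have "c \<noteq> 0" using frame[OF i i] c linear_0[OF lin2[of "e i"]] by auto
      have "\<omega> v (f i) = c * \<omega> v (J (e i))" by (simp add: c simps)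
      then show "\<omega> (J v) (e i) = 0" using v i \<open>c \<noteq> 0\<close> by (simp add: perp_def Jw2)
      show "\<omega> (J v) (f i) = 0" using v i by (simp add: perp_def c simps Jw)
    qed
    \<comment> \<open>\<open>\<omega> a (J a)\<close> is the quadratic form of a symmetric bilinear
      form. If it vanished on the whole orthogonal space, which is stable under \<open>J\<close>,
      its value at \<open>e0 + J f1\<close> would give
      \<open>- 2 * \<omega> e0 f1 = 0\<close>.\<close>
    have "\<exists>a. perp a \<and> \<omega> a (J a) \<noteq> 0"
    proof (rule ccontr)
      assume "\<not> ?thesis"
      then have zero: "\<omega> a (J a) = 0" if "perp a" for a using that by blast
      have "perp (e0 + J f1)"
        using perp_e0 perp_J[OF f1(2)] by (simp add: perp_def simps)
      then have "\<omega> (e0 + J f1) (J (e0 + J f1)) = 0" by (rule zero)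
      moreover have "J (e0 + J f1) = J e0 - f1" by (simp add: linear_add[OF linear_J])
      moreover have "\<omega> (J f1) (J e0) = - \<omega> e0 f1" using Jw[of f1 e0] skew[of f1 e0] by simp
      moreover have "\<omega> (J f1) f1 = 0" using zero[OF f1(2)] skew[of "J f1" f1] by simp
      ultimately show False
        using zero[OF perp_e0] f1(1) by (simp add: simps)
    qed
    then obtain a where a: "perp a" "\<omega> a (J a) \<noteq> 0" by blast
    show ?thesis
      by (rule that[of a "(2 / \<omega> a (J a)) *\<^sub>R J a"])
        (use a perp_J[OF a(1)] in \<open>auto simp: perp_def simps\<close>)
  qed
qed

text \<open>Invariance under \<open>J\<close> is a premise of the last clause alone, so that one
  frame serves the symplectic and the Kaehler case.\<close>

lemma symplectic_frame_exists:
  fixes \<omega> :: "complex^'n \<Rightarrow> complex^'n \<Rightarrow> real"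
  assumes lin: "\<And>v. linear (\<lambda>u. \<omega> u v)" and skew: "\<And>u v. \<omega> u v = - \<omega> v u"
    and nondeg: "\<And>u. (\<And>v. \<omega> u v = 0) \<Longrightarrow> u = 0"
  obtains e f where "\<And>i j :: 'n. \<omega> (e i) (e j) = 0" "\<And>i j. \<omega> (f i) (f j) = 0"
    "\<And>i j. \<omega> (e i) (f j) = (if i = j then 2 else 0)"
    "\<And>i. (\<forall>u v. \<omega> (J u) (J v) = \<omega> u v) \<Longrightarrow> \<exists>c. f i = c *\<^sub>R J (e i)"
proof -
  define Jinv where "Jinv \<longleftrightarrow> (\<forall>u v. \<omega> (J u) (J v) = \<omega> u v)"
  define Q where "Q I e f \<longleftrightarrow> (\<forall>i\<in>I. \<forall>j\<in>I. \<omega> (e i) (e j) = 0 \<and> \<omega> (f i) (f j) = 0 \<and>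
       \<omega> (e i) (f j) = (if i = j then 2 else 0)) \<and> (Jinv \<longrightarrow> (\<forall>i\<in>I. \<exists>c. f i = c *\<^sub>R J (e i)))"
    for I :: "'n set" and e f
  have "\<exists>e f. Q I e f" if "finite I" for I
    using that
  proof (induction I)
    show "\<exists>e f. Q {} e f" by (simp add: Q_def)
    fix k :: 'n and I assume k: "k \<notin> I" and "\<exists>e f. Q I e f"
    then obtain e f where Q: "Q I e f" by blast
    obtain a b where ab: "\<And>i. i \<in> I \<Longrightarrow> \<omega> a (e i) = 0 \<and> \<omega> a (f i) = 0 \<and> \<omega> b (e i) = 0 \<and> \<omega> b (f i) = 0"
      "\<omega> a b = 2" "Jinv \<Longrightarrow> \<exists>c. b = c *\<^sub>R J a"
      using symplectic_frame_extend[OF lin skew nondeg k, of e f Jinv] Q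
      unfolding Q_def Jinv_def by blast
    have ab': "\<omega> (e i) a = 0" "\<omega> (f i) a = 0" "\<omega> (e i) b = 0" "\<omega> (f i) b = 0" if "i \<in> I" for i
      using ab(1)[OF that] skew by (metis neg_0_equal_iff_equal)+
    have self: "\<omega> u u = 0" for u using skew[of u u] by simp
    have "Q (insert k I) (e(k := a)) (f(k := b))"
      using Q k ab ab' self unfolding Q_def by auto
    then show "\<exists>e f. Q (insert k I) e f" by blast
  qed
  then obtain e f where "Q UNIV e f" using finite_class.finite_UNIV by blast
  then show ?thesis using that[of e f] by (simp add: Q_def Jinv_def)
qed

text \<open>\<open>L v\<close> lists the coordinates of \<open>v\<close> in the symplectic frame,
  read off by pairing with it. The last two clauses say that the spans of the \<open>f i\<close> and
  of the \<open>e i\<close>, which are the kernels of the two halves of \<open>L\<close>, are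
  totally real if \<open>\<omega>\<close> is \<open>J\<close>-invariant: since \<open>f i\<close> is
  a nonzero multiple of \<open>J (e i)\<close>, the pairings of \<open>J v\<close> with one half of
  the frame are, up to nonzero factors, those of \<open>v\<close> with the other half.\<close>

lemma linear_darboux:
  fixes \<omega> :: "complex^'n \<Rightarrow> complex^'n \<Rightarrow> real"
  assumes lin: "\<And>v. linear (\<lambda>u. \<omega> u v)" and skew: "\<And>u v. \<omega> u v = - \<omega> v u"
    and nondeg: "\<And>u. (\<And>v. \<omega> u v = 0) \<Longrightarrow> u = 0"
  obtains L :: "complex^'n \<Rightarrow> (real^'n) \<times> (real^'n)" where "linear L" "inj L"
    "\<And>u v. \<omega> u v = 2 * std_symplectic (L u) (L v)"
    "\<And>v. (\<forall>u v. \<omega> (J u) (J v) = \<omega> u v) \<Longrightarrow> fst (L v) = 0 \<Longrightarrow> fst (L (J v)) = 0 \<Longrightarrow> v = 0"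
    "\<And>v. (\<forall>u v. \<omega> (J u) (J v) = \<omega> u v) \<Longrightarrow> snd (L v) = 0 \<Longrightarrow> snd (L (J v)) = 0 \<Longrightarrow> v = 0"
proof -
  have lin2: "linear (\<omega> u)" for u
    using linear_compose_neg[OF lin[of u]] skew by (metis (no_types, lifting) ext)
  note simps = linear_add[OF lin] linear_add[OF lin2] linear_scale[OF lin] linear_scale[OF lin2]
    linear_neg[OF lin] linear_neg[OF lin2] linear_sum[OF lin] linear_sum[OF lin2]
  obtain e f where ef: "\<And>i j :: 'n. \<omega> (e i) (e j) = 0" "\<And>i j. \<omega> (f i) (f j) = 0"
    "\<And>i j. \<omega> (e i) (f j) = (if i = j then 2 else 0)"
    "\<And>i. (\<forall>u v. \<omega> (J u) (J v) = \<omega> u v) \<Longrightarrow> \<exists>c. f i = c *\<^sub>R J (e i)"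
    using symplectic_frame_exists[OF lin skew nondeg] by blast
  have fe: "\<omega> (f i) (e j) = - (if i = j then 2 else 0)" for i j
    using ef(3)[of j i] skew[of "f i" "e j"] by simp
  define L :: "complex^'n \<Rightarrow> (real^'n) \<times> (real^'n)" where
    "L v = ((\<chi> i. \<omega> v (f i) / 2), (\<chi> i. \<omega> (e i) v / 2))" for v
  have L: "linear L" by (rule linearI) (simp_all add: L_def vec_eq_iff simps add_divide_distrib)
  \<comment> \<open>\<open>N\<close> rebuilds a vector from its coordinates.
    \<open>L (N z) = z\<close> is a computation with the frame relations; the other order follows
    because the injective \<open>N\<close> is onto by equality of dimensions.\<close>
  define N where "N z = (\<Sum>i\<in>UNIV. (fst z $ i) *\<^sub>R e i + (snd z $ i) *\<^sub>R f i)" for z :: "(real^'n) \<times> (real^'n)"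
  have N: "linear N"
    by (rule linearI) (simp_all add: N_def scaleR_add_left sum.distrib scaleR_sum_right scaleR_add_right)
  have LN: "L (N z) = z" for z
    by (simp add: L_def N_def simps ef fe prod_eq_iff vec_eq_iff if_distrib if_distribR sum.delta cong: if_cong)
  have "inj N" by (rule injI) (metis LN)
  then have "surj N" using linear_inj_imp_surj_DIM[OF N] by simp
  then have NL: "N (L v) = v" for v by (metis LN surjD)
  have injL: "inj L" by (rule injI) (metis NL)
  have \<omega>: "\<omega> u v = 2 * std_symplectic (L u) (L v)" for u v
  proof -
    have "\<omega> u v = \<omega> (N (L u)) v" by (simp add: NL)
    also have "\<dots> = (\<Sum>i\<in>UNIV. \<omega> u (f i) / 2 * \<omega> (e i) v + \<omega> (e i) u / 2 * \<omega> (f i) v)"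
      by (simp add: N_def L_def simps)
    also have "\<dots> = (\<Sum>i\<in>UNIV. 2 * (\<omega> u (f i) / 2 * (\<omega> (e i) v / 2) - \<omega> v (f i) / 2 * (\<omega> (e i) u / 2)))"
    proof (rule sum.cong[OF refl])
      show "\<omega> u (f i) / 2 * \<omega> (e i) v + \<omega> (e i) u / 2 * \<omega> (f i) v =
          2 * (\<omega> u (f i) / 2 * (\<omega> (e i) v / 2) - \<omega> v (f i) / 2 * (\<omega> (e i) u / 2))" for i
        unfolding skew[of "f i" v] by simp
    qed
    also have "\<dots> = 2 * std_symplectic (L u) (L v)"
      unfolding std_symplectic_def L_def
      by (simp only: inner_vec_def inner_real_def vec_lambda_beta fst_conv snd_conv sum_subtractf
          sum_distrib_left[symmetric])
    finally show ?thesis .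
  qed
  show ?thesis
  proof (rule that[OF L injL \<omega>])
    fix v assume Jinv: "\<forall>u v. \<omega> (J u) (J v) = \<omega> u v"
    have c: "\<exists>c. c \<noteq> 0 \<and> f i = c *\<^sub>R J (e i)" for i
    proof -
      obtain c where c: "f i = c *\<^sub>R J (e i)" using ef(4)[OF Jinv] by blast
      then have "c \<noteq> 0" using ef(3)[of i i] linear_0[OF lin2[of "e i"]] by auto
      then show ?thesis using c by blast
    qed
    have "\<exists>c. c \<noteq> 0 \<and> \<omega> (J v) (f i) = c * \<omega> v (e i) \<and> \<omega> v (f i) = - c * \<omega> (J v) (e i)" for i
    proof -
      obtain c where "c \<noteq> 0" "f i = c *\<^sub>R J (e i)" using c by blast
      moreover have "\<omega> (J v) (e i) = - \<omega> v (J (e i))" using Jinv[rule_format, of v "J (e i)"] by (simp add: simps)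
      ultimately show ?thesis using Jinv by (auto simp: simps)
    qed
    then obtain c where c: "\<And>i. c i \<noteq> 0" "\<And>i. \<omega> (J v) (f i) = c i * \<omega> v (e i)"
      "\<And>i. \<omega> v (f i) = - c i * \<omega> (J v) (e i)" by metis
    show "v = 0" if "fst (L v) = 0" "fst (L (J v)) = 0"
    proof -
      have "\<omega> v (f i) = 0" "\<omega> (J v) (f i) = 0" for i
        using that by (simp_all add: L_def vec_eq_iff)
      then have "\<omega> v (f i) = 0" "\<omega> v (e i) = 0" for i using c by auto
      then have "L v = 0" using skew[of _ v] by (simp add: L_def vec_eq_iff prod_eq_iff)
      then show "v = 0" using NL[of v] linear_0[OF N] by simp
    qed
    show "v = 0" if "snd (L v) = 0" "snd (L (J v)) = 0"
    proof -
      have "\<omega> (e i) v = 0" "\<omega> (e i) (J v) = 0" for i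
        using that by (simp_all add: L_def vec_eq_iff)
      then have "\<omega> (e i) v = 0" "\<omega> v (f i) = 0" for i
        using c skew[of "J v" "e i" for i] by auto
      then have "L v = 0" by (simp add: L_def vec_eq_iff prod_eq_iff)
      then show "v = 0" using NL[of v] linear_0[OF N] by simp
    qed
  qed
qed

section \<open>Complex manifolds in a chart\<close>

lemma FD_vec_nth:
  assumes "F differentiable (at u)"
  shows "FD (\<lambda>u. F u $ i) u v = FD F u v $ i"
  using bounded_linear.has_derivative[OF bounded_linear_vec_nth FD_works[OF assms]] FD_eqI by metis

text \<open>Complex linearity of the full differential is the form that passes through compositions
  and inverses, so it is used from here on in place of the componentwise definition.\<close>

lemma holomorphic_map_on_iff:
  fixes F :: "complex^'n \<Rightarrow> complex^'m"
  assumes S: "open S"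
  shows "holomorphic_map_on S F \<longleftrightarrow> smooth_on S F \<and> (\<forall>u\<in>S. \<forall>v. FD F u (J v) = J (FD F u v))"
proof
  assume h: "holomorphic_map_on S F"
  then have sm: "smooth_on S F"
    by (intro smooth_on_vec S) (simp add: holomorphic_map_on_def Cn_holomorphic_on_def)
  show "smooth_on S F \<and> (\<forall>u\<in>S. \<forall>v. FD F u (J v) = J (FD F u v))"
  proof (intro conjI sm ballI allI)
    fix u v assume u: "u \<in> S"
    have "FD (\<lambda>u. F u $ i) u (J v) = \<i> * FD (\<lambda>u. F u $ i) u v" for i
      using h u by (simp add: holomorphic_map_on_def Cn_holomorphic_on_def)
    then have "FD F u (J v) $ i = (J (FD F u v)) $ i" for i
      by (simp add: FD_vec_nth[OF smooth_on_differentiable[OF sm u]])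
    then show "FD F u (J v) = J (FD F u v)" by (simp add: vec_eq_iff)
  qed
next
  assume h: "smooth_on S F \<and> (\<forall>u\<in>S. \<forall>v. FD F u (J v) = J (FD F u v))"
  then have sm: "smooth_on S F" by blast
  show "holomorphic_map_on S F"
    unfolding holomorphic_map_on_def Cn_holomorphic_on_def
  proof (intro allI conjI ballI)
    show "smooth_on S (\<lambda>u. F u $ i)" for i
      by (rule smooth_on_linear_compose[OF S bounded_linear_vec_nth sm])
    show "FD (\<lambda>u. F u $ i) u (J v) = \<i> * FD (\<lambda>u. F u $ i) u v" if "u \<in> S" for i u v
      using h that by (simp add: FD_vec_nth[OF smooth_on_differentiable[OF sm that]])
  qed
qed

abbreviation transition :: "('a, 'n::finite) chart \<Rightarrow> ('a, 'n) chart \<Rightarrow> complex^'n \<Rightarrow> complex^'n" where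
  "transition c d \<equiv> snd d \<circ> chart_inv c"

locale complex_mfd =
  fixes A :: "('a::{t2_space,second_countable_topology}, 'n::finite) chart set"
  assumes complex_manifold: "complex_manifold A"
begin

lemma chart_homeo:
  assumes "c \<in> A"
  shows "open (fst c)" "open (snd c ` fst c)" "homeomorphism (fst c) (snd c ` fst c) (snd c) (chart_inv c)"
  using complex_manifold assms unfolding complex_manifold_def by auto

lemma chart_inv_chart [simp]: "c \<in> A \<Longrightarrow> q \<in> fst c \<Longrightarrow> chart_inv c (snd c q) = q"
  using chart_homeo(3) by (simp add: homeomorphism_def)

lemma chart_chart_inv [simp]: "c \<in> A \<Longrightarrow> u \<in> snd c ` fst c \<Longrightarrow> snd c (chart_inv c u) = u"
  by (rule f_inv_into_f)

lemma inj_on_chart: "c \<in> A \<Longrightarrow> inj_on (snd c) (fst c)"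
  by (rule inj_on_inverseI[where g="chart_inv c"]) (rule chart_inv_chart)

lemma open_chart_image:
  assumes c: "c \<in> A" and U: "open U"
  shows "open (chart_image c U)"
proof -
  have "chart_image c U = snd c ` fst c \<inter> chart_inv c -` (U \<inter> fst c)"
    using c by (auto simp: image_iff)
  also have "open \<dots>"
    using chart_homeo[OF c] U
    by (intro continuous_open_preimage) (auto simp: homeomorphism_def)
  finally show ?thesis .
qed

lemma chart_exists: "\<exists>c\<in>A. q \<in> fst c"
  using complex_manifold unfolding complex_manifold_def by blast

lemma transition_holomorphic:
  assumes "c \<in> A" "d \<in> A"
  shows "smooth_on (chart_image c (fst d)) (transition c d)"
    "u \<in> chart_image c (fst d) \<Longrightarrow> FD (transition c d) u (J v) = J (FD (transition c d) u v)"
proof -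
  have "holomorphic_map_on (chart_image c (fst d)) (transition c d)"
    using complex_manifold assms unfolding complex_manifold_def by blast
  then show "smooth_on (chart_image c (fst d)) (transition c d)"
    "u \<in> chart_image c (fst d) \<Longrightarrow> FD (transition c d) u (J v) = J (FD (transition c d) u v)"
    using holomorphic_map_on_iff[OF open_chart_image[OF assms(1) chart_homeo(1)[OF assms(2)]]] by auto
qed

lemma transition_has_derivative:
  assumes "c \<in> A" "d \<in> A" "q \<in> fst c" "q \<in> fst d"
  shows "(transition c d has_derivative FD (transition c d) (snd c q)) (at (snd c q))"
  using assms by (intro smooth_on_has_derivative[OF transition_holomorphic(1)]) auto

lemma linear_FD_transition:
  assumes "c \<in> A" "d \<in> A" "q \<in> fst c" "q \<in> fst d"
  shows "linear (FD (transition c d) (snd c q))"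
  using transition_has_derivative[OF assms] by (rule has_derivative_linear)

lemma chart_change_has_derivative:
  assumes c: "c \<in> A" "d \<in> A" "q \<in> fst c" "q \<in> fst d"
    and f: "((f \<circ> chart_inv c) has_derivative f') (at (snd c q))"
  shows "((f \<circ> chart_inv d) has_derivative (\<lambda>v. f' (FD (transition d c) (snd d q) v))) (at (snd d q))"
proof -
  have "((f \<circ> chart_inv c) \<circ> transition d c has_derivative (f' \<circ> FD (transition d c) (snd d q))) (at (snd d q))"
    by (rule diff_chain_at[OF transition_has_derivative]) (use c f in auto)
  then have "((f \<circ> chart_inv c) \<circ> transition d c has_derivative (\<lambda>v. f' (FD (transition d c) (snd d q) v))) (at (snd d q))"
    by (simp add: o_def)
  then show ?thesis
    by (rule has_derivative_cong_open[THEN iffD1, rotated 3,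
          OF _ open_chart_image[OF c(2) chart_homeo(1)[OF c(1)]]]) (use c in auto)
qed

lemma FD_transition_self:
  assumes "c \<in> A" "q \<in> fst c"
  shows "FD (transition c c) (snd c q) v = v"
proof -
  have "((\<lambda>u. u) has_derivative (\<lambda>v. v)) (at (snd c q))" by simp
  then have "(transition c c has_derivative (\<lambda>v. v)) (at (snd c q))"
    by (rule has_derivative_cong_open[THEN iffD1, rotated 3, OF _ chart_homeo(2)[OF assms(1)]])
      (use assms in auto)
  then show ?thesis by (simp add: FD_eqI)
qed

lemma FD_transition_cocycle:
  assumes "c \<in> A" "d \<in> A" "e \<in> A" "q \<in> fst c" "q \<in> fst d" "q \<in> fst e"
  shows "FD (transition c e) (snd c q) v = FD (transition d e) (snd d q) (FD (transition c d) (snd c q) v)"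
  using FD_eqI[OF chart_change_has_derivative[OF assms(2,1,5,4) transition_has_derivative[OF assms(2,3,5,6)]]]
  by simp

text \<open>A set inside the domain of \<open>c\<close> is seen by any other chart through a smooth
  transition map, so smoothness can be tested in \<open>c\<close> alone. This is what removes the
  quantifier over charts from \<open>smooth_fun\<close>.\<close>

lemma smooth_on_chart_change:
  assumes c: "c \<in> A" "d \<in> A" and U: "open U" "U \<subseteq> fst c" and f: "smooth_on (snd c ` U) (f \<circ> chart_inv c)"
  shows "smooth_on (chart_image d U) (f \<circ> chart_inv d)"
proof -
  note op = open_chart_image[OF c(2) U(1)]
  have "smooth_on (chart_image d U) (\<lambda>u. (f \<circ> chart_inv c) (transition d c u))"
  proof (rule smooth_on_compose[OF op _ f])
    show "smooth_on (chart_image d U) (transition d c)"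
      by (rule smooth_on_subset[OF transition_holomorphic(1)[OF c(2,1)]]) (use U in auto)
  qed (use c U in auto)
  then show ?thesis
    by (rule smooth_on_cong[OF op, THEN iffD1, rotated]) (use c U in auto)
qed

lemma chart_image_eq: "U \<subseteq> fst c \<Longrightarrow> chart_image c U = snd c ` U"
  by (simp add: Int_absorb2)

lemma open_chart_image': "c \<in> A \<Longrightarrow> open U \<Longrightarrow> U \<subseteq> fst c \<Longrightarrow> open (snd c ` U)"
  using open_chart_image[of c U] by (simp add: chart_image_eq)

lemma smooth_fun_iff:
  assumes "c \<in> A" "open U" "U \<subseteq> fst c"
  shows "smooth_fun A U f \<longleftrightarrow> smooth_on (snd c ` U) (f \<circ> chart_inv c)"
  unfolding smooth_fun_def
  using smooth_on_chart_change[OF assms(1) _ assms(2,3)] chart_image_eq[OF assms(3)] assms(1) by metis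

text \<open>\<open>differential\<close> is computed in an arbitrarily chosen chart. The
  transformation rule between the entries of \<open>v\<close> cancels against the chain rule, so any
  chart around \<open>q\<close> may be used.\<close>

lemma differential_eq:
  assumes c: "c \<in> A" "q \<in> fst c" and v: "v \<in> tangent_space A q"
    and f: "(f \<circ> chart_inv c) differentiable (at (snd c q))"
  shows "differential A f q v = FD (f \<circ> chart_inv c) (snd c q) (v c)"
proof -
  define d where "d = some_chart A q"
  have d: "d \<in> A" "q \<in> fst d"
    using someI_ex[of "\<lambda>c. c \<in> A \<and> q \<in> fst c"] chart_exists unfolding d_def some_chart_def by blast+
  have "v c = FD (transition d c) (snd d q) (v d)"
    using v c d unfolding tangent_space_def by blast
  then show ?thesis
    using FD_eqI[OF chart_change_has_derivative[OF c(1) d(1) c(2) d(2) FD_works[OF f]]]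
    by (simp add: differential_def Let_def flip: d_def)
qed

section \<open>Tangent vectors as compatible families of coordinate vectors\<close>

lemma tangent_spaceI:
  assumes "\<And>d. \<not> (d \<in> A \<and> q \<in> fst d) \<Longrightarrow> v d = 0"
    "\<And>d e. d \<in> A \<Longrightarrow> e \<in> A \<Longrightarrow> q \<in> fst d \<Longrightarrow> q \<in> fst e \<Longrightarrow> v e = FD (transition d e) (snd d q) (v d)"
  shows "v \<in> tangent_space A q"
  unfolding tangent_space_def using assms by blast

lemma tangent_spaceD:
  assumes "v \<in> tangent_space A q"
  shows "\<not> (d \<in> A \<and> q \<in> fst d) \<Longrightarrow> v d = 0"
    "d \<in> A \<Longrightarrow> e \<in> A \<Longrightarrow> q \<in> fst d \<Longrightarrow> q \<in> fst e \<Longrightarrow> v e = FD (transition d e) (snd d q) (v d)"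
  using assms unfolding tangent_space_def by blast+

lemma tangent_space_eqI:
  assumes "v \<in> tangent_space A q" "w \<in> tangent_space A q" "c \<in> A" "q \<in> fst c" "v c = w c"
  shows "v = w"
proof
  fix d
  show "v d = w d"
  proof (cases "d \<in> A \<and> q \<in> fst d")
    case True
    then show ?thesis
      using tangent_spaceD(2)[OF assms(1) assms(3) _ assms(4), of d]
        tangent_spaceD(2)[OF assms(2) assms(3) _ assms(4), of d] assms(5) by metis
  next
    case False
    then show ?thesis using tangent_spaceD(1) assms by metis
  qed
qed

text \<open>The coordinate field of the chart \<open>c\<close> with constant components
  \<open>a\<close>. It is meant for points of \<open>fst c\<close>; its values elsewhere carry no
  meaning.\<close>

definition tangent_lift :: "('a, 'n) chart \<Rightarrow> complex^'n \<Rightarrow> 'a \<Rightarrow> ('a, 'n) tvec" where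
  "tangent_lift c a q = (\<lambda>d. if d \<in> A \<and> q \<in> fst d then FD (transition c d) (snd c q) a else 0)"

lemma tangent_lift:
  assumes c: "c \<in> A" "q \<in> fst c"
  shows "tangent_lift c a q \<in> tangent_space A q" "tangent_lift c a q c = a"
proof -
  have "tangent_lift c a q e = FD (transition d e) (snd d q) (tangent_lift c a q d)"
    if "d \<in> A" "e \<in> A" "q \<in> fst d" "q \<in> fst e" for d e
    using FD_transition_cocycle[OF c(1) that(1,2) c(2) that(3,4), of a] that
    by (simp only: tangent_lift_def simp_thms if_True)
  moreover have "tangent_lift c a q d = 0" if "\<not> (d \<in> A \<and> q \<in> fst d)" for d
    unfolding tangent_lift_def using that by (rule if_not_P)
  ultimately show "tangent_lift c a q \<in> tangent_space A q" by (intro tangent_spaceI)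
  show "tangent_lift c a q c = a"
    using FD_transition_self[OF c] c by (simp only: tangent_lift_def simp_thms if_True)
qed

lemma tangent_space_linear:
  assumes "u \<in> tangent_space A q" "v \<in> tangent_space A q"
  shows "(\<lambda>d. r *\<^sub>R u d + s *\<^sub>R v d) \<in> tangent_space A q"
proof -
  have "r *\<^sub>R u e + s *\<^sub>R v e = FD (transition d e) (snd d q) (r *\<^sub>R u d + s *\<^sub>R v d)"
    if "d \<in> A" "e \<in> A" "q \<in> fst d" "q \<in> fst e" for d e
    unfolding tangent_spaceD(2)[OF assms(1) that] tangent_spaceD(2)[OF assms(2) that]
    using linear_FD_transition[OF that] by (simp only: linear_add linear_scale)
  moreover have "r *\<^sub>R u d + s *\<^sub>R v d = 0" if "\<not> (d \<in> A \<and> q \<in> fst d)" for d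
    using tangent_spaceD(1)[OF assms(1) that] tangent_spaceD(1)[OF assms(2) that] by simp
  ultimately show ?thesis by (intro tangent_spaceI)
qed

lemma tangent_space_J:
  assumes "v \<in> tangent_space A q"
  shows "J_vec v \<in> tangent_space A q"
proof -
  have "J (v e) = FD (transition d e) (snd d q) (J (v d))"
    if "d \<in> A" "e \<in> A" "q \<in> fst d" "q \<in> fst e" for d e
    unfolding tangent_spaceD(2)[OF assms that]
    by (rule transition_holomorphic(2)[OF that(1,2), symmetric]) (use that in blast)
  moreover have "J (v d) = 0" if "\<not> (d \<in> A \<and> q \<in> fst d)" for d
    using tangent_spaceD(1)[OF assms that] by (simp add: linear_0[OF linear_J])
  ultimately show ?thesis unfolding J_vec_def by (intro tangent_spaceI)
qed

text \<open>The entry of a field in another chart is its entry in \<open>c\<close> under the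
  differential of the transition map, which is a smooth family of linear maps.\<close>

lemma smooth_vfields_iff:
  assumes c: "c \<in> A" and U: "open U" "U \<subseteq> fst c"
  shows "X \<in> smooth_vfields A U \<longleftrightarrow>
    (\<forall>q\<in>U. X q \<in> tangent_space A q) \<and> smooth_on (snd c ` U) (\<lambda>u. X (chart_inv c u) c)"
proof
  assume "X \<in> smooth_vfields A U"
  then show "(\<forall>q\<in>U. X q \<in> tangent_space A q) \<and> smooth_on (snd c ` U) (\<lambda>u. X (chart_inv c u) c)"
    using c chart_image_eq[OF U(2)] unfolding smooth_vfields_def by auto
next
  assume X: "(\<forall>q\<in>U. X q \<in> tangent_space A q) \<and> smooth_on (snd c ` U) (\<lambda>u. X (chart_inv c u) c)"
  have "smooth_on (chart_image d U) (\<lambda>u. X (chart_inv d u) d)" if d: "d \<in> A" for d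
  proof -
    note op = open_chart_image[OF d U(1)]
    define V where "V = U \<inter> fst d"
    have V: "open V" "V \<subseteq> fst c" "V \<subseteq> U" "V \<subseteq> fst d" "chart_image d U = chart_image d V"
      using U chart_homeo(1)[OF d] by (auto simp: V_def)
    have sm1: "smooth_on (snd c ` V) (\<lambda>u. FD (transition c d) u (X (chart_inv c u) c))"
    proof (rule smooth_on_apply[where L="FD (transition c d)" and Y="\<lambda>u. X (chart_inv c u) c"])
      show "open (snd c ` V)" using V by (intro open_chart_image' c) auto
      have sm: "smooth_on (snd c ` V) (transition c d)"
        using c d V by (intro smooth_on_subset[OF transition_holomorphic(1)]) auto
      show "smooth_on (snd c ` V) (\<lambda>u. FD (transition c d) u b)" for b by (rule smooth_on_FD[OF sm])
      show "linear (FD (transition c d) u)" if "u \<in> snd c ` V" for u by (rule smooth_on_linear_FD[OF sm that])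
      show "smooth_on (snd c ` V) (\<lambda>u. X (chart_inv c u) c)"
        using X V by (auto intro: smooth_on_subset)
    qed
    have sm2: "smooth_on (snd c ` V) ((\<lambda>q. X q d) \<circ> chart_inv c)"
    proof (rule smooth_on_cong[THEN iffD1, OF _ _ sm1])
      show "open (snd c ` V)" using V by (intro open_chart_image' c) auto
    next
      fix u assume "u \<in> snd c ` V"
      then obtain q where q: "q \<in> V" "u = snd c q" by auto
      then have "X q d = FD (transition c d) (snd c q) (X q c)"
        using X V c d by (intro tangent_spaceD(2)) auto
      then show "FD (transition c d) u (X (chart_inv c u) c) = ((\<lambda>q. X q d) \<circ> chart_inv c) u"
        using q V c by (auto simp: subset_iff)
    qed
    from smooth_on_chart_change[OF c d V(1,2) sm2] show ?thesis by (simp add: V(5) o_def)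
  qed
  then show "X \<in> smooth_vfields A U" using X by (simp add: smooth_vfields_def)
qed

lemma smooth_vfields_comp:
  assumes "c \<in> A" "open U" "U \<subseteq> fst c" "X \<in> smooth_vfields A U"
  shows "smooth_on (snd c ` U) (\<lambda>u. X (chart_inv c u) c)"
  using assms smooth_vfields_iff by blast

lemma tangent_lift_smooth:
  assumes "c \<in> A" "open U" "U \<subseteq> fst c"
  shows "tangent_lift c a \<in> smooth_vfields A U"
proof -
  have "smooth_on (snd c ` U) (\<lambda>u. tangent_lift c a (chart_inv c u) c)"
    by (rule smooth_on_cong[OF open_chart_image'[OF assms], THEN iffD2, OF _ smooth_on_const[of _ a]])
      (use assms tangent_lift(2)[OF assms(1)] in \<open>auto simp: subset_iff\<close>)
  then show ?thesis using smooth_vfields_iff[OF assms] tangent_lift(1) assms by blast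
qed

end

section \<open>The connection in a chart\<close>

locale special_complex_chart =
  fixes A :: "('a::{t2_space,second_countable_topology}, 'n::finite) chart set"
    and nabla :: "('a, 'n) vfield \<Rightarrow> ('a, 'n) vfield \<Rightarrow> ('a, 'n) vfield"
    and c :: "('a, 'n) chart"
  assumes special_complex_manifold: "special_complex_manifold A nabla" and c: "c \<in> A"

sublocale special_complex_chart \<subseteq> complex_mfd A
  using special_complex_manifold by unfold_locales (simp add: special_complex_manifold_def)

context special_complex_chart
begin

abbreviation "D \<equiv> snd c ` fst c"

abbreviation "E \<equiv> tangent_lift c"

lemma connection: "connection A nabla"
  using special_complex_manifold by (simp add: special_complex_manifold_def)

lemmas connection_clauses = connection[unfolded connection_def, THEN spec, THEN mp]

lemmas nabla_smooth = connection_clauses[THEN conjunct1, rule_format]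

text \<open>A field and its coordinate expansion agree on the domain \<open>U\<close> but may differ
  as total functions, so exchanging one for the other under \<open>nabla\<close> has to go through
  the restriction clause of \<open>connection\<close>.\<close>

lemma nabla_cong:
  assumes "open U" "X \<in> smooth_vfields A U" "Y \<in> smooth_vfields A U"
    "X' \<in> smooth_vfields A U" "Y' \<in> smooth_vfields A U"
    "\<And>p. p \<in> U \<Longrightarrow> X p = X' p" "\<And>p. p \<in> U \<Longrightarrow> Y p = Y' p" "q \<in> U"
  shows "nabla X Y q = nabla X' Y' q"
  by (rule connection_clauses[THEN conjunct2, THEN conjunct1, rule_format, OF assms(1-5) _ assms(8)])
    (simp add: assms(6,7))

lemmas nabla_add_left = connection_clauses[THEN conjunct2, THEN conjunct2, THEN conjunct1, rule_format]

lemmas nabla_smult_left =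
  connection_clauses[THEN conjunct2, THEN conjunct2, THEN conjunct2, THEN conjunct1, rule_format]

lemmas nabla_add_right =
  connection_clauses[THEN conjunct2, THEN conjunct2, THEN conjunct2, THEN conjunct2, THEN conjunct1, rule_format]

lemmas nabla_smult_right =
  connection_clauses[THEN conjunct2, THEN conjunct2, THEN conjunct2, THEN conjunct2, THEN conjunct2, rule_format]

lemma vfields_linear:
  assumes V: "open V" "V \<subseteq> fst c" and X: "X \<in> smooth_vfields A V" and Y: "Y \<in> smooth_vfields A V"
    and f: "smooth_fun A V f"
  shows "vf_add X Y \<in> smooth_vfields A V" "vf_smult f X \<in> smooth_vfields A V"
    "vf_minus X Y \<in> smooth_vfields A V"
proof -
  note op = open_chart_image'[OF c V]
  note XY = X[unfolded smooth_vfields_iff[OF c V]] Y[unfolded smooth_vfields_iff[OF c V]]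
  show "vf_add X Y \<in> smooth_vfields A V"
    unfolding smooth_vfields_iff[OF c V] vf_add_def
    using XY tangent_space_linear[of "X q" q "Y q" 1 1 for q] by (auto intro: smooth_on_add[OF op])
  show "vf_minus X Y \<in> smooth_vfields A V"
    unfolding smooth_vfields_iff[OF c V] vf_minus_def
    using XY tangent_space_linear[of "X q" q "Y q" 1 "-1" for q] by (auto intro: smooth_on_diff[OF op])
  show "vf_smult f X \<in> smooth_vfields A V"
    unfolding smooth_vfields_iff[OF c V] vf_smult_def
    using XY tangent_space_linear[of "X q" q "X q" "f q" 0 for q] f
      smooth_on_bilinear[OF op bounded_bilinear_scaleR, of "f \<circ> chart_inv c"]
    by (auto simp: smooth_fun_iff[OF c V] o_def)
qed

lemma smooth_fun_const: "smooth_fun A V (\<lambda>_. k)"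
  by (simp add: smooth_fun_def o_def)

lemma lie_deriv_eq:
  assumes V: "open V" "V \<subseteq> fst c" and X: "X \<in> smooth_vfields A V" and f: "smooth_fun A V f" and q: "q \<in> V"
  shows "lie_deriv A X f q = FD (f \<circ> chart_inv c) (snd c q) (X q c)"
  unfolding lie_deriv_def
proof (rule differential_eq[OF c])
  show "q \<in> fst c" using q V by auto
  show "X q \<in> tangent_space A q" using X q by (simp add: smooth_vfields_def)
  show "(f \<circ> chart_inv c) differentiable at (snd c q)"
    using f q unfolding smooth_fun_iff[OF c V] by (intro smooth_on_differentiable) auto
qed

section \<open>Covariant derivatives of finite combinations of fields\<close>

definition vf_sum :: "'i set \<Rightarrow> ('i \<Rightarrow> 'a \<Rightarrow> real) \<Rightarrow> ('i \<Rightarrow> ('a, 'n) vfield) \<Rightarrow> ('a, 'n) vfield" where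
  "vf_sum I f Z = (\<lambda>q d. \<Sum>i\<in>I. f i q *\<^sub>R Z i q d)"

lemma vf_add_apply: "vf_add X Y q d = X q d + Y q d"
  by (simp add: vf_add_def)

lemma vf_smult_apply: "vf_smult g X q d = g q *\<^sub>R X q d"
  by (simp add: vf_smult_def)

lemma vf_sum_insert:
  "finite I \<Longrightarrow> k \<notin> I \<Longrightarrow> vf_sum (insert k I) f Z = vf_add (vf_smult (f k) (Z k)) (vf_sum I f Z)"
  by (simp add: vf_sum_def vf_add_def vf_smult_def)

context
  fixes V :: "'a set" and f :: "'i \<Rightarrow> 'a \<Rightarrow> real" and Z :: "'i \<Rightarrow> ('a, 'n) vfield"
  assumes V: "open V" "V \<subseteq> fst c" and f: "\<And>i. smooth_fun A V (f i)" and Z: "\<And>i. Z i \<in> smooth_vfields A V"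
begin

lemma vf_sum_smooth: "finite I \<Longrightarrow> vf_sum I f Z \<in> smooth_vfields A V"
proof (induction I rule: finite_induct)
  case empty
  \<comment> \<open>The clauses for \<open>nabla\<close> mention no zero field. It is produced as
    the multiple of a field by the zero function, here and in the two inductions that
    follow.\<close>
  have "vf_sum {} f Z = vf_smult (\<lambda>_. 0) (E 0)" by (simp add: vf_sum_def vf_smult_def)
  then show ?case
    using vfields_linear(2)[OF V _ _ smooth_fun_const] tangent_lift_smooth[OF c V] by metis
next
  case (insert k I)
  show ?case
    unfolding vf_sum_insert[OF insert(1,2)]
    by (rule vfields_linear(1)[OF V vfields_linear(2)[OF V Z Z f] insert(3) f])
qed

lemma nabla_vf_sum_right:
  assumes X: "X \<in> smooth_vfields A V" and q: "q \<in> V" and I: "finite I"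
  shows "nabla X (vf_sum I f Z) q d =
    (\<Sum>i\<in>I. lie_deriv A X (f i) q *\<^sub>R Z i q d + f i q *\<^sub>R nabla X (Z i) q d)"
  using I
proof (induction I rule: finite_induct)
  case empty
  have "lie_deriv A X (\<lambda>_. 0) q = 0"
    using lie_deriv_eq[OF V X smooth_fun_const q] by (simp add: o_def FD_eqI[OF has_derivative_const])
  then have "nabla X (vf_smult (\<lambda>_. 0) X) q d = 0"
    using nabla_smult_right[OF V(1) X X smooth_fun_const[of V 0] q] by (simp add: vf_add_def vf_smult_def)
  then show ?case by (simp add: vf_sum_def vf_smult_def)
next
  case (insert k I)
  show ?case
    unfolding vf_sum_insert[OF insert(1,2)]
      nabla_add_right[OF V(1) X vfields_linear(2)[OF V Z Z f] vf_sum_smooth[OF insert(1)] q]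
    by (simp only: vf_add_apply vf_smult_apply nabla_smult_right[OF V(1) X Z f q] insert(3)
        sum.insert[OF insert(1,2)])
qed

lemma nabla_vf_sum_left:
  assumes Y: "Y \<in> smooth_vfields A V" and q: "q \<in> V" and I: "finite I"
  shows "nabla (vf_sum I f Z) Y q d = (\<Sum>i\<in>I. f i q *\<^sub>R nabla (Z i) Y q d)"
  using I
proof (induction I rule: finite_induct)
  case empty
  have "nabla (vf_smult (\<lambda>_. 0) Y) Y q d = 0"
    using nabla_smult_left[OF V(1) Y Y smooth_fun_const[of V 0] q] by (simp add: vf_smult_def)
  then show ?case by (simp add: vf_sum_def vf_smult_def)
next
  case (insert k I)
  show ?case
    unfolding vf_sum_insert[OF insert(1,2)]
      nabla_add_left[OF V(1) vfields_linear(2)[OF V Z Z f] vf_sum_smooth[OF insert(1)] Y q]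
    by (simp only: vf_add_apply vf_smult_apply nabla_smult_left[OF V(1) Z Y f q] insert(3)
        sum.insert[OF insert(1,2)])
qed

end

text \<open>Extended bilinearly from basis pairs rather than read off from
  \<open>nabla (E a) (E b)\<close> for all \<open>a\<close> and \<open>b\<close>, so that
  bilinearity holds by construction; agreement for arbitrary constant fields is then
  \<open>nabla_E\<close>.\<close>

definition christoffel :: "complex^'n \<Rightarrow> complex^'n \<Rightarrow> complex^'n \<Rightarrow> complex^'n" where
  "christoffel u a b = (\<Sum>i\<in>Basis. \<Sum>j\<in>Basis. ((a \<bullet> i) * (b \<bullet> j)) *\<^sub>R nabla (E i) (E j) (chart_inv c u) c)"

lemma vfield_expansion:
  assumes V: "open V" "V \<subseteq> fst c" and X: "X \<in> smooth_vfields A V"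
  shows "\<And>b. smooth_fun A V (\<lambda>q. X q c \<bullet> b)"
    and "q \<in> V \<Longrightarrow> X q = vf_sum Basis (\<lambda>b q. X q c \<bullet> b) E q"
proof -
  show sm: "smooth_fun A V (\<lambda>q. X q c \<bullet> b)" for b
    unfolding smooth_fun_iff[OF c V] o_def
    by (rule smooth_on_linear_compose[OF open_chart_image'[OF c V] bounded_linear_inner_left
          smooth_vfields_comp[OF c V X]])
  assume q: "q \<in> V"
  then have qc: "q \<in> fst c" using V by auto
  have "vf_sum Basis (\<lambda>b q. X q c \<bullet> b) E \<in> smooth_vfields A V"
    by (rule vf_sum_smooth[OF V sm tangent_lift_smooth[OF c V]]) simp
  then have t: "vf_sum Basis (\<lambda>b q. X q c \<bullet> b) E q \<in> tangent_space A q" "X q \<in> tangent_space A q"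
    using X q by (auto simp: smooth_vfields_def)
  show "X q = vf_sum Basis (\<lambda>b q. X q c \<bullet> b) E q"
    by (rule tangent_space_eqI[OF t(2,1) c qc])
      (simp add: vf_sum_def tangent_lift(2)[OF c qc] euclidean_representation)
qed

text \<open>The Leibniz rule on the expansion of \<open>Y\<close> in coordinate fields gives the
  derivative of the components of \<open>Y\<close> and terms with \<open>nabla X (E b)\<close>;
  tensoriality in \<open>X\<close> reduces the latter to coordinate fields.\<close>

lemma nabla_chart:
  assumes V: "open V" "V \<subseteq> fst c" and X: "X \<in> smooth_vfields A V" and Y: "Y \<in> smooth_vfields A V" and q: "q \<in> V"
  shows "nabla X Y q c = FD (\<lambda>u. Y (chart_inv c u) c) (snd c q) (X q c) + christoffel (snd c q) (X q c) (Y q c)"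
proof -
  note e = vfield_expansion[OF V]
  note Es = tangent_lift_smooth[OF c V]
  have qc: "q \<in> fst c" using V q by auto
  have "nabla X Y q = nabla X (vf_sum Basis (\<lambda>b q. Y q c \<bullet> b) E) q"
    by (rule nabla_cong[OF V(1) X Y X vf_sum_smooth[OF V e(1)[OF Y] Es finite_Basis] refl e(2)[OF Y] q])
  then have "nabla X Y q c = (\<Sum>b\<in>Basis. lie_deriv A X (\<lambda>q. Y q c \<bullet> b) q *\<^sub>R b + (Y q c \<bullet> b) *\<^sub>R nabla X (E b) q c)"
    using nabla_vf_sum_right[OF V e(1)[OF Y] Es X q finite_Basis, where d=c] by (simp add: tangent_lift(2)[OF c qc])
  also have "\<dots> = (\<Sum>b\<in>Basis. lie_deriv A X (\<lambda>q. Y q c \<bullet> b) q *\<^sub>R b) + (\<Sum>b\<in>Basis. (Y q c \<bullet> b) *\<^sub>R nabla X (E b) q c)"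
    by (rule sum.distrib)
  also have "(\<Sum>b\<in>Basis. lie_deriv A X (\<lambda>q. Y q c \<bullet> b) q *\<^sub>R b) = FD (\<lambda>u. Y (chart_inv c u) c) (snd c q) (X q c)"
  proof -
    have "lie_deriv A X (\<lambda>q. Y q c \<bullet> b) q = FD (\<lambda>u. Y (chart_inv c u) c) (snd c q) (X q c) \<bullet> b" for b
    proof -
      have "((\<lambda>u. Y (chart_inv c u) c) has_derivative FD (\<lambda>u. Y (chart_inv c u) c) (snd c q)) (at (snd c q))"
        by (rule smooth_on_has_derivative[OF smooth_vfields_comp[OF c V Y]]) (use q in auto)
      from FD_eqI[OF has_derivative_inner_left[OF this, of b]] show ?thesis
        unfolding lie_deriv_eq[OF V X e(1)[OF Y] q] by (simp add: o_def)
    qed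
    then show ?thesis by (simp add: euclidean_representation)
  qed
  also have "(\<Sum>b\<in>Basis. (Y q c \<bullet> b) *\<^sub>R nabla X (E b) q c) = christoffel (snd c q) (X q c) (Y q c)"
  proof -
    have "nabla X (E b) q c = (\<Sum>a\<in>Basis. (X q c \<bullet> a) *\<^sub>R nabla (E a) (E b) q c)" for b
    proof -
      have "nabla X (E b) q = nabla (vf_sum Basis (\<lambda>b q. X q c \<bullet> b) E) (E b) q"
        by (rule nabla_cong[OF V(1) X Es vf_sum_smooth[OF V e(1)[OF X] Es finite_Basis] Es e(2)[OF X] refl q])
      then show ?thesis
        using nabla_vf_sum_left[OF V e(1)[OF X] Es Es q finite_Basis, where d=c] by simp
    qed
    then have "(\<Sum>b\<in>Basis. (Y q c \<bullet> b) *\<^sub>R nabla X (E b) q c) =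
        (\<Sum>b\<in>Basis. \<Sum>a\<in>Basis. ((X q c \<bullet> a) * (Y q c \<bullet> b)) *\<^sub>R nabla (E a) (E b) q c)"
      by (simp add: scaleR_sum_right mult.commute)
    also have "\<dots> = christoffel (snd c q) (X q c) (Y q c)"
      unfolding christoffel_def chart_inv_chart[OF c qc] by (rule sum.swap)
    finally show ?thesis .
  qed
  finally show ?thesis .
qed

section \<open>The Christoffel symbols: torsion, curvature and complex structure\<close>

lemma open_D: "open D" by (rule chart_homeo(2)[OF c])

lemma W: "open (fst c)" "fst c \<subseteq> fst c"
  by (simp_all add: chart_homeo(1)[OF c])

lemma FD_const_on_D:
  assumes "\<And>u. u \<in> D \<Longrightarrow> F u = k" "u \<in> D"
  shows "FD F u = (\<lambda>_. 0)"
  using FD_cong_open[OF open_D assms(2), of F "\<lambda>_. k"] assms(1) by (simp add: FD_eqI[OF has_derivative_const])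

lemma nabla_E:
  assumes q: "q \<in> fst c"
  shows "nabla (E a) (E b) q c = christoffel (snd c q) a b"
proof -
  have "FD (\<lambda>u. E b (chart_inv c u) c) (snd c q) = (\<lambda>_. 0)"
    by (rule FD_const_on_D[where k=b]) (use q in \<open>auto simp: c tangent_lift(2)[OF c]\<close>)
  then show ?thesis
    using nabla_chart[OF W tangent_lift_smooth[OF c W] tangent_lift_smooth[OF c W] q, of a b]
    by (simp add: tangent_lift(2)[OF c q])
qed

lemma nabla_E_field:
  assumes q: "q \<in> fst c"
  shows "nabla (E a) (E b) q = E (christoffel (snd c q) a b) q"
proof (rule tangent_space_eqI[OF _ tangent_lift(1)[OF c q] c q])
  show "nabla (E a) (E b) q \<in> tangent_space A q"
    using nabla_smooth[OF W(1) tangent_lift_smooth[OF c W] tangent_lift_smooth[OF c W], of a b] q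
    by (simp add: smooth_vfields_def)
qed (simp add: nabla_E[OF q] tangent_lift(2)[OF c q])

lemma linear_christoffel: "linear (christoffel u a)"
  by (rule linearI)
    (simp_all add: christoffel_def inner_add_left algebra_simps sum.distrib scaleR_add_left scaleR_sum_right)

lemma smooth_christoffel: "smooth_on D (\<lambda>u. christoffel u a b)"
  unfolding christoffel_def
  by (intro smooth_on_sum open_D smooth_on_linear_compose[OF open_D bounded_linear_scaleR_right]
      smooth_vfields_comp[OF c W] nabla_smooth[OF W(1)] tangent_lift_smooth[OF c W])

lemma lie_bracket_E:
  assumes q: "q \<in> fst c"
  shows "lie_bracket A (E a) (E b) q c = 0"
proof -
  have "FD (\<lambda>u. E b (chart_inv c u) c) (snd c q) = (\<lambda>_. 0)" for b
    by (rule FD_const_on_D[where k=b]) (use q in \<open>auto simp: c tangent_lift(2)[OF c]\<close>)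
  then show ?thesis using q c by (simp add: lie_bracket_def)
qed

lemma torsionfree_E:
  assumes q: "q \<in> fst c"
  shows "lie_bracket A (E a) (E b) q = vf_minus (nabla (E a) (E b)) (nabla (E b) (E a)) q"
proof -
  have "torsionfree A nabla"
    using special_complex_manifold by (simp add: special_complex_manifold_def)
  from this[unfolded torsionfree_def, rule_format, OF W(1) tangent_lift_smooth[OF c W] tangent_lift_smooth[OF c W] q]
  have "vf_minus (vf_minus (nabla (E a) (E b)) (nabla (E b) (E a))) (lie_bracket A (E a) (E b)) q = (\<lambda>c. 0)" .
  then show ?thesis by (simp add: vf_minus_def fun_eq_iff)
qed

lemma christoffel_sym:
  assumes "u \<in> D"
  shows "christoffel u a b = christoffel u b a"
proof -
  obtain q where q: "q \<in> fst c" "u = snd c q" using assms by auto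
  show ?thesis
    using fun_cong[OF torsionfree_E[OF q(1), of a b], of c]
    by (simp add: vf_minus_def nabla_E[OF q(1)] q(2) lie_bracket_E[OF q(1)])
qed

lemma christoffel_flat:
  assumes "u \<in> D"
  shows "FD (\<lambda>w. christoffel w b d) u a + christoffel u a (christoffel u b d) =
    FD (\<lambda>w. christoffel w a d) u b + christoffel u b (christoffel u a d)"
proof -
  obtain q where q: "q \<in> fst c" "u = snd c q" using assms by auto
  note Es = tangent_lift_smooth[OF c W]
  note ns = nabla_smooth[OF W(1) Es Es]
  have nn: "nabla (E a) (nabla (E b) (E d)) q c = FD (\<lambda>w. christoffel w b d) u a + christoffel u a (christoffel u b d)"
    for a b
  proof -
    have "FD (\<lambda>w. nabla (E b) (E d) (chart_inv c w) c) u = FD (\<lambda>w. christoffel w b d) u"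
    proof (rule FD_cong_open[OF open_D assms])
      fix w assume "w \<in> D"
      then obtain q' where q': "q' \<in> fst c" "w = snd c q'" by auto
      show "nabla (E b) (E d) (chart_inv c w) c = christoffel w b d"
        unfolding q'(2) chart_inv_chart[OF c q'(1)] by (rule nabla_E[OF q'(1)])
    qed
    then show ?thesis
      using nabla_chart[OF W Es ns q(1), of a b d]
      by (simp add: tangent_lift(2)[OF c q(1)] nabla_E[OF q(1)] q(2))
  qed
  \<comment> \<open>\<open>lie_bracket\<close> is defined entry by entry, so it is not evident that
    its entries transform like a tangent vector. Vanishing torsion identifies it with a difference
    of covariant derivatives, which is a smooth field.\<close>
  have lb: "lie_bracket A (E a) (E b) \<in> smooth_vfields A (fst c)"
  proof -
    have "vf_minus (nabla (E a) (E b)) (nabla (E b) (E a)) \<in> smooth_vfields A (fst c)"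
      by (rule vfields_linear(3)[OF W ns ns smooth_fun_const])
    moreover have "lie_bracket A (E a) (E b) (chart_inv c u) =
        vf_minus (nabla (E a) (E b)) (nabla (E b) (E a)) (chart_inv c u)" if "u \<in> D" for u
      using that torsionfree_E c by auto
    ultimately show ?thesis
      unfolding smooth_vfields_iff[OF c W]
      using torsionfree_E smooth_on_cong[OF open_D, of "\<lambda>u. lie_bracket A (E a) (E b) (chart_inv c u) c"
          "\<lambda>u. vf_minus (nabla (E a) (E b)) (nabla (E b) (E a)) (chart_inv c u) c"] by simp
  qed
  have bracket: "nabla (lie_bracket A (E a) (E b)) (E d) q c = 0"
  proof -
    have "((\<lambda>w. E d (chart_inv c w) c) has_derivative FD (\<lambda>w. E d (chart_inv c w) c) (snd c q)) (at (snd c q))"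
      by (rule smooth_on_has_derivative[OF smooth_vfields_comp[OF c W Es]]) (use q in auto)
    then have "FD (\<lambda>w. E d (chart_inv c w) c) (snd c q) 0 = 0"
      by (rule linear_0[OF has_derivative_linear])
    then show ?thesis
      using nabla_chart[OF W lb Es q(1), of d] lie_bracket_E[OF q(1), of a b]
      by (simp add: christoffel_def)
  qed
  have "vf_minus (vf_minus (nabla (E a) (nabla (E b) (E d))) (nabla (E b) (nabla (E a) (E d))))
      (nabla (lie_bracket A (E a) (E b)) (E d)) q = (\<lambda>c. 0)"
  proof -
    have "flat A nabla"
      using special_complex_manifold by (simp add: special_complex_manifold_def)
    from this[unfolded flat_def, rule_format, OF W(1) Es Es Es q(1)] show ?thesis .
  qed
  from fun_cong[OF this, of c] show ?thesis
    using nn[of a b] nn[of b a] bracket by (simp add: vf_minus_def)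
qed

sublocale flat_christoffel D christoffel
  by (rule flat_christoffel.intro[OF open_D linear_christoffel smooth_christoffel christoffel_sym christoffel_flat])

text \<open>On constant fields \<open>(\<nabla>\<^sub>a J) b\<close> is
  \<open>\<Gamma> a (J b) - J (\<Gamma> a b)\<close>, and the second term is symmetric in
  \<open>a\<close> and \<open>b\<close> because the torsion vanishes.\<close>

lemma christoffel_J:
  assumes "u \<in> D"
  shows "christoffel u a (J b) = christoffel u b (J a)"
proof -
  obtain q where q: "q \<in> fst c" "u = snd c q" using assms by auto
  note Es = tangent_lift_smooth[OF c W]
  have JE: "J_field (E b) p = E (J b) p" if "p \<in> fst c" for b p
  proof (rule tangent_space_eqI[OF _ tangent_lift(1)[OF c that] c that])
    show "J_field (E b) p \<in> tangent_space A p"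
      unfolding J_field_def by (rule tangent_space_J[OF tangent_lift(1)[OF c that]])
  qed (simp add: J_field_def J_vec_def tangent_lift(2)[OF c that])
  have JEs: "J_field (E b) \<in> smooth_vfields A (fst c)" for b
  proof -
    have "smooth_on D (\<lambda>u. J_field (E b) (chart_inv c u) c)"
      using smooth_on_linear_compose[OF open_D _ smooth_vfields_comp[OF c W Es], of J b]
        linear_J by (simp add: J_field_def J_vec_def linear_conv_bounded_linear)
    then show ?thesis
      unfolding smooth_vfields_iff[OF c W]
      using tangent_space_J tangent_lift(1)[OF c] by (simp add: J_field_def)
  qed
  have "nabla (E a) (J_field (E b)) q = nabla (E a) (E (J b)) q" for a b
    by (rule nabla_cong[OF W(1) Es JEs Es Es refl JE q(1)])
  then have nJ: "nabla_J nabla (E a) (E b) q c = christoffel u a (J b) - J (christoffel u a b)" for a b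
    by (simp add: nabla_J_def vf_minus_def nabla_E[OF q(1)] J_field_def J_vec_def q(2))
  have "nabla_J nabla (E a) (E b) q = nabla_J nabla (E b) (E a) q"
  proof -
    have "\<forall>U. open U \<longrightarrow> (\<forall>X\<in>smooth_vfields A U. \<forall>Y\<in>smooth_vfields A U. \<forall>p\<in>U.
        nabla_J nabla X Y p = nabla_J nabla Y X p)"
      using special_complex_manifold by (simp add: special_complex_manifold_def)
    from this[rule_format, OF W(1) Es Es q(1)] show ?thesis .
  qed
  then show ?thesis
    using nJ[of a b] nJ[of b a] christoffel_sym[OF assms, of a b] by simp
qed

text \<open>In the chart \<open>X (Y f)\<close> contributes the second derivative of
  \<open>f\<close> and a term with the derivative of \<open>Y\<close> along \<open>X\<close>, which
  cancels against the same term in \<open>nabla_chart\<close>. What is left depends only on the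
  values of \<open>X\<close> and \<open>Y\<close> at the point, so constant fields suffice as test
  fields.\<close>

lemma affine_fun_iff:
  assumes U: "open U" "U \<subseteq> fst c"
  shows "affine_fun A nabla U f \<longleftrightarrow> affine_eq christoffel (snd c ` U) (f \<circ> chart_inv c)"
proof -
  let ?F = "f \<circ> chart_inv c"
  have lie2: "lie_deriv A X (lie_deriv A Y f) q - lie_deriv A (nabla X Y) f q =
      FD (\<lambda>w. FD ?F w (Y q c)) (snd c q) (X q c) - FD ?F (snd c q) (christoffel (snd c q) (X q c) (Y q c))"
    if sm: "smooth_on (snd c ` U) ?F" and V: "open V" "V \<subseteq> U"
      and X: "X \<in> smooth_vfields A V" and Y: "Y \<in> smooth_vfields A V" and q: "q \<in> V" for V X Y q
  proof -
    have Vc: "V \<subseteq> fst c" using V U by auto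
    note op = open_chart_image'[OF c V(1) Vc]
    have smV: "smooth_on (snd c ` V) ?F" using sm V by (auto intro: smooth_on_subset)
    have fV: "smooth_fun A V f" using smV by (simp add: smooth_fun_iff[OF c V(1) Vc])
    note Yc = smooth_vfields_comp[OF c V(1) Vc Y]
    have qV: "snd c q \<in> snd c ` V" using q by simp
    have qc: "q \<in> fst c" using q Vc by auto
    have eq: "(lie_deriv A Y f \<circ> chart_inv c) w = FD ?F w (Y (chart_inv c w) c)" if w: "w \<in> snd c ` V" for w
    proof -
      obtain p where p: "p \<in> V" "w = snd c p" using w by blast
      then have pc: "p \<in> fst c" using Vc by auto
      show ?thesis
        unfolding o_def p(2) chart_inv_chart[OF c pc] lie_deriv_eq[OF V(1) Vc Y fV p(1)] by (simp add: o_def)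
    qed
    have "((\<lambda>w. FD ?F w (Y (chart_inv c w) c)) has_derivative
        (\<lambda>a. FD (\<lambda>w. FD ?F w (Y (chart_inv c (snd c q)) c)) (snd c q) a
          + FD ?F (snd c q) (FD (\<lambda>w. Y (chart_inv c w) c) (snd c q) a))) (at (snd c q))"
      by (rule has_derivative_apply[OF op smooth_on_linear_FD[OF smV] qV
            smooth_on_differentiable[OF smooth_on_FD[OF smV] qV] smooth_on_has_derivative[OF Yc qV]])
    then have "FD (\<lambda>w. FD ?F w (Y (chart_inv c w) c)) (snd c q) a =
        FD (\<lambda>w. FD ?F w (Y q c)) (snd c q) a + FD ?F (snd c q) (FD (\<lambda>w. Y (chart_inv c w) c) (snd c q) a)" for a
      by (simp add: FD_eqI chart_inv_chart[OF c qc])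
    then have FDl: "FD (lie_deriv A Y f \<circ> chart_inv c) (snd c q) a =
        FD (\<lambda>w. FD ?F w (Y q c)) (snd c q) a + FD ?F (snd c q) (FD (\<lambda>w. Y (chart_inv c w) c) (snd c q) a)" for a
    proof -
      have "FD (lie_deriv A Y f \<circ> chart_inv c) (snd c q) = FD (\<lambda>w. FD ?F w (Y (chart_inv c w) c)) (snd c q)"
        by (rule FD_cong_open[OF op qV eq])
      then show ?thesis using \<open>\<And>a. FD (\<lambda>w. FD ?F w (Y (chart_inv c w) c)) (snd c q) a = _\<close> by simp
    qed
    have "smooth_on (snd c ` V) (\<lambda>w. FD ?F w (Y (chart_inv c w) c))"
      by (rule smooth_on_apply[OF op smooth_on_linear_FD[OF smV] smooth_on_FD[OF smV] Yc])
    then have "smooth_fun A V (lie_deriv A Y f)"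
      unfolding smooth_fun_iff[OF c V(1) Vc] by (rule smooth_on_cong[OF op eq, THEN iffD2, rotated])
    then have "lie_deriv A X (lie_deriv A Y f) q = FD (lie_deriv A Y f \<circ> chart_inv c) (snd c q) (X q c)"
      by (rule lie_deriv_eq[OF V(1) Vc X _ q])
    moreover have "lie_deriv A (nabla X Y) f q = FD ?F (snd c q) (nabla X Y q c)"
      by (rule lie_deriv_eq[OF V(1) Vc nabla_smooth[OF V(1) X Y] fV q])
    ultimately show ?thesis
      unfolding FDl nabla_chart[OF V(1) Vc X Y q] linear_add[OF smooth_on_linear_FD[OF smV qV]] by simp
  qed
  show ?thesis
  proof
    assume f: "affine_fun A nabla U f"
    then have sm: "smooth_on (snd c ` U) ?F" by (simp add: affine_fun_def smooth_fun_iff[OF c U])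
    have "FD (\<lambda>w. FD ?F w b) (snd c q) a = FD ?F (snd c q) (christoffel (snd c q) a b)" if q: "q \<in> U" for q a b
    proof -
      have qc: "q \<in> fst c" using q U by auto
      note Es = tangent_lift_smooth[OF c U]
      have "lie_deriv A (E a) (lie_deriv A (E b) f) q - lie_deriv A (nabla (E a) (E b)) f q = 0"
        using f Es q U(1) unfolding affine_fun_def by blast
      then show ?thesis
        using lie2[OF sm U(1) order_refl Es Es q, of a b] by (simp add: tangent_lift(2)[OF c qc])
    qed
    then show "affine_eq christoffel (snd c ` U) ?F" using sm by (auto simp: affine_eq_def)
  next
    assume F: "affine_eq christoffel (snd c ` U) ?F"
    note sm = affine_eq_smooth[OF F]
    have "lie_deriv A X (lie_deriv A Y f) q - lie_deriv A (nabla X Y) f q = 0"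
      if "open V" "V \<subseteq> U" "X \<in> smooth_vfields A V" "Y \<in> smooth_vfields A V" "q \<in> V" for V X Y q
      unfolding lie2[OF sm that] using F that by (auto simp: affine_eq_def)
    then show "affine_fun A nabla U f"
      using sm unfolding affine_fun_def smooth_fun_iff[OF c U] by blast
  qed
qed

end

section \<open>Coordinate systems in a chart\<close>

text \<open>\<open>inv_into\<close> is a choice determined by the set and the values on it, so the
  two maps have literally the same inverse function.\<close>

lemma diffeo_on_cong:
  assumes eq: "\<And>u. u \<in> S \<Longrightarrow> F u = H u"
  shows "diffeo_on S F \<longleftrightarrow> diffeo_on S H"
proof -
  have im: "F ` S = H ` S" using eq by (rule image_cong[OF refl])
  have inj: "inj_on F S \<longleftrightarrow> inj_on H S" using eq by (rule inj_on_cong)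
  have inv: "inv_into S F = inv_into S H"
  proof -
    have "(\<lambda>y. y \<in> S \<and> F y = x) = (\<lambda>y. y \<in> S \<and> H y = x)" for x using eq by auto
    then show ?thesis unfolding inv_into_def by simp
  qed
  show ?thesis
    unfolding diffeo_on_def im inj inv using smooth_on_cong[of S F H] eq by blast
qed

lemma affine_eq_cong:
  assumes S: "open S" and eq: "\<And>u. u \<in> S \<Longrightarrow> F u = H u"
  shows "affine_eq \<Gamma> S F \<longleftrightarrow> affine_eq \<Gamma> S H"
proof -
  have 1: "FD F u = FD H u" if "u \<in> S" for u by (rule FD_cong_open[OF S that eq])
  have 2: "FD (\<lambda>w. FD F w b) u = FD (\<lambda>w. FD H w b) u" if "u \<in> S" for u b
    by (rule FD_cong_open[OF S that]) (simp add: 1)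
  show ?thesis
    unfolding affine_eq_def using smooth_on_cong[OF S eq] 1 2 by simp
qed

lemma diffeo_on_affine_compose:
  fixes H :: "'v::euclidean_space \<Rightarrow> 'w::euclidean_space" and L :: "'w \<Rightarrow> 'w"
  assumes H: "diffeo_on S H" and L: "linear L" "inj L"
  shows "diffeo_on S (\<lambda>u. L (H u) + b)"
proof -
  note Hd = H[unfolded diffeo_on_def]
  have surj: "surj L" by (rule linear_inj_imp_surj_DIM[OF L]) simp
  define M where "M = inv L"
  have MLz: "M (L z) = z" "L (M z) = z" for z
    using L(2) surj by (simp_all add: M_def surj_f_inv_f)
  have linM: "linear M"
    by (rule linearI) (metis MLz linear_add[OF L(1)], metis MLz linear_scale[OF L(1)])
  have bl: "bounded_linear L" "bounded_linear M"
    using L(1) linM by (simp_all add: linear_conv_bounded_linear)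
  define F where "F u = L (H u) + b" for u
  have FS: "F ` S = (\<lambda>y. M (y - b)) -` (H ` S)"
  proof (intro equalityI subsetI)
    fix y assume "y \<in> (\<lambda>y. M (y - b)) -` (H ` S)"
    then obtain u where u: "u \<in> S" "M (y - b) = H u" by auto
    then have "y = F u" using MLz(2)[of "y - b"] by (simp add: F_def)
    then show "y \<in> F ` S" using u by blast
  qed (auto simp: F_def MLz)
  have "continuous_on UNIV (\<lambda>y. M (y - b))"
    by (intro continuous_intros linear_continuous_on_compose[OF _ linM])
  then have op: "open (F ` S)" unfolding FS using Hd by (intro open_vimage) auto
  have inj: "inj_on F S"
    using Hd by (auto simp: inj_on_def F_def dest: injD[OF L(2)])
  have inv: "inv_into S F y = inv_into S H (M (y - b))" if y: "y \<in> F ` S" for y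
  proof -
    obtain u where u: "u \<in> S" "y = F u" using y by blast
    have "M (y - b) = H u" by (simp add: u(2) F_def MLz)
    then show ?thesis using u inv_into_f_f[OF inj u(1)] inv_into_f_f[of H S u] Hd by simp
  qed
  have sM: "smooth_on (F ` S) (\<lambda>y. M (y - b))"
    by (intro smooth_on_linear_compose[OF op bl(2)] smooth_on_diff[OF op]
        smooth_on_bounded_linear bounded_linear_ident smooth_on_const)
  have "smooth_on (F ` S) (\<lambda>y. inv_into S H (M (y - b)))"
    by (rule smooth_on_compose[OF op sM, of "H ` S" "inv_into S H"]) (use Hd FS in auto)
  then have "smooth_on (F ` S) (inv_into S F)"
    by (rule smooth_on_cong[OF op inv, THEN iffD2, rotated])
  moreover have "smooth_on S F"
    unfolding F_def using Hd by (intro smooth_on_add smooth_on_const smooth_on_linear_compose[OF _ bl(1)]) auto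
  ultimately show ?thesis
    using op inj Hd unfolding diffeo_on_def F_def[abs_def] by blast
qed

section \<open>Holomorphic maps from real and imaginary parts\<close>

definition cvec :: "real^'n \<Rightarrow> real^'n \<Rightarrow> complex^'n" where
  "cvec a b = (\<chi> i. Complex (a $ i) (b $ i))"

lemma cvec_eq_0_iff: "cvec a b = 0 \<longleftrightarrow> a = 0 \<and> b = 0"
  by (auto simp: cvec_def vec_eq_iff complex_eq_iff)

lemma Re_vec_cvec [simp]: "Re_vec (cvec a b) = a"
  by (simp add: cvec_def Re_vec_def vec_eq_iff)

lemma J_cvec: "J (cvec a b) = cvec (- b) a"
  by (simp add: cvec_def vec_eq_iff complex_eq_iff)

lemma bounded_linear_cvec: "bounded_linear (\<lambda>z. cvec (fst z) (snd z))"
proof -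
  have "linear (\<lambda>z :: (real^'n) \<times> (real^'n). cvec (fst z) (snd z))"
    by (rule linearI) (simp_all add: cvec_def vec_eq_iff complex_eq_iff)
  then show ?thesis by (simp add: linear_conv_bounded_linear)
qed

text \<open>The differential of \<open>h + i g\<close> sends \<open>a\<close> to
  \<open>dh a - i dh (J a)\<close>, which is complex linear because \<open>J (J a) = - a\<close>.
  The formula for the differential is kept for the injectivity argument in the Kaehler case.\<close>

lemma cvec_holomorphic:
  fixes h g :: "complex^'m \<Rightarrow> real^'n"
  assumes S: "open S" and h: "smooth_on S h" and g: "smooth_on S g"
    and cr: "\<And>u a. u \<in> S \<Longrightarrow> FD g u a = - FD h u (J a)"
  shows "smooth_on S (\<lambda>u. cvec (h u) (g u))"
    and "u \<in> S \<Longrightarrow> FD (\<lambda>u. cvec (h u) (g u)) u a = cvec (FD h u a) (FD g u a)"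
    and "u \<in> S \<Longrightarrow> FD (\<lambda>u. cvec (h u) (g u)) u (J a) = J (FD (\<lambda>u. cvec (h u) (g u)) u a)"
proof -
  show "smooth_on S (\<lambda>u. cvec (h u) (g u))"
    using smooth_on_linear_compose[OF S bounded_linear_cvec smooth_on_Pair[OF S h g]] by simp
  have *: "FD (\<lambda>u. cvec (h u) (g u)) u a = cvec (FD h u a) (FD g u a)" if u: "u \<in> S" for a
  proof -
    have "((\<lambda>u. cvec (h u) (g u)) has_derivative (\<lambda>a. cvec (FD h u a) (FD g u a))) (at u)"
      using bounded_linear.has_derivative[OF bounded_linear_cvec
          has_derivative_Pair[OF smooth_on_has_derivative[OF h u] smooth_on_has_derivative[OF g u]]]
      by simp
    then show ?thesis by (simp add: FD_eqI)
  qed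
  show "u \<in> S \<Longrightarrow> FD (\<lambda>u. cvec (h u) (g u)) u a = cvec (FD h u a) (FD g u a)" by (rule *)
  assume u: "u \<in> S"
  have "FD h u (J (J a)) = - FD h u a"
    using linear_neg[OF smooth_on_linear_FD[OF h u]] by simp
  then show "FD (\<lambda>u. cvec (h u) (g u)) u (J a) = J (FD (\<lambda>u. cvec (h u) (g u)) u a)"
    by (simp add: *[OF u] J_cvec cr[OF u])
qed

section \<open>Coordinate systems on the manifold and in a chart\<close>

context complex_mfd
begin

text \<open>The common core of real and holomorphic coordinates, with an arbitrary target space, so
  that the transfer from a chart is proved once for both.\<close>

definition coord_map :: "'a set \<Rightarrow> ('a \<Rightarrow> 'w::real_normed_vector) \<Rightarrow> bool" where
  "coord_map U h \<longleftrightarrow> open U \<and> inj_on h U \<and> open (h ` U) \<and> smooth_fun A U h \<and>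
     (\<forall>d\<in>A. smooth_on (h ` (U \<inter> fst d)) (snd d \<circ> inv_into U h))"

lemma real_coords_iff: "real_coords A U x y \<longleftrightarrow> coord_map U (\<lambda>p. (x p, y p))"
  by (simp add: real_coords_def coord_map_def Let_def)

lemma open_chart_preimage:
  assumes c: "c \<in> A" and S: "open S" "S \<subseteq> snd c ` fst c"
  shows "open (chart_inv c ` S)" "chart_inv c ` S \<subseteq> fst c" "snd c ` chart_inv c ` S = S"
proof -
  have "chart_inv c ` S = fst c \<inter> snd c -` S"
    using c S(2) by (auto simp: image_iff subset_iff) (metis chart_inv_chart)
  also have "open \<dots>"
    using chart_homeo[OF c] S(1) by (intro continuous_open_preimage) (auto simp: homeomorphism_def)
  finally show "open (chart_inv c ` S)" .
  show "chart_inv c ` S \<subseteq> fst c" using S(2) by (auto simp: inv_into_into)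
  have "snd c (chart_inv c u) = u" if "u \<in> S" for u using that S(2) c by (intro chart_chart_inv) auto
  then show "snd c ` chart_inv c ` S = S" by (simp add: image_image)
qed

lemma image_chart_comp:
  "c \<in> A \<Longrightarrow> U \<subseteq> fst c \<Longrightarrow> (h \<circ> chart_inv c) ` snd c ` U = h ` U"
  by (force simp: image_image subset_iff)

lemma inj_on_chart_comp:
  assumes "c \<in> A" "U \<subseteq> fst c" "inj_on h U"
  shows "inj_on (h \<circ> chart_inv c) (snd c ` U)"
  using assms by (auto simp: inj_on_def subset_iff)

lemma inv_into_chart_comp:
  assumes c: "c \<in> A" "U \<subseteq> fst c" and inj: "inj_on h U" and V: "V \<subseteq> U" and y: "y \<in> h ` V"
  shows "inv_into (snd c ` V) (h \<circ> chart_inv c) y = snd c (inv_into U h y)"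
proof -
  obtain q where q: "q \<in> V" "y = h q" using y by auto
  have "inv_into (snd c ` V) (h \<circ> chart_inv c) ((h \<circ> chart_inv c) (snd c q)) = snd c q"
    using c V q inj by (intro inv_into_f_f inj_on_chart_comp) (auto intro: inj_on_subset)
  moreover have "q \<in> fst c" using q V c by auto
  moreover have "q \<in> U" using q V by auto
  ultimately show ?thesis using c inj q by simp
qed

lemma coord_map_chart:
  fixes h :: "'a \<Rightarrow> 'w::euclidean_space"
  assumes c: "c \<in> A" and h: "coord_map U h" and V: "open V" "V \<subseteq> U" "V \<subseteq> fst c"
    and dim: "DIM('w) \<le> DIM(complex^'n)"
  shows "diffeo_on (snd c ` V) (h \<circ> chart_inv c)"
proof -
  note hd = h[unfolded coord_map_def]
  define T where "T = U \<inter> fst c"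
  have T: "open T" "T \<subseteq> fst c" "T \<subseteq> U" using hd chart_homeo(1)[OF c] by (auto simp: T_def)
  note op = open_chart_image'[OF c T(1,2)]
  have sm: "smooth_on (snd c ` T) (h \<circ> chart_inv c)"
    using hd c chart_image_eq[OF T(2)] by (auto simp: smooth_fun_def T_def Int_assoc)
  have inj: "inj_on (h \<circ> chart_inv c) (snd c ` T)"
    using hd T by (intro inj_on_chart_comp[OF c T(2)]) (auto intro: inj_on_subset)
  \<comment> \<open>The assumption gives an open image for \<open>U\<close>; for the smaller set
    \<open>T\<close> openness follows from invariance of domain, which is where the hypothesis on
    dimensions enters.\<close>
  have opT: "open (h ` T)"
    using invariance_of_domain_gen[OF op smooth_on_continuous[OF sm] inj dim]
    by (simp only: image_chart_comp[OF c T(2)])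
  have "smooth_on (h ` T) (\<lambda>y. snd c (inv_into U h y))"
    using hd c by (auto simp: T_def o_def)
  then have "smooth_on (h ` T) (inv_into (snd c ` T) (h \<circ> chart_inv c))"
  proof (rule smooth_on_cong[OF opT, THEN iffD2, rotated])
    fix y assume y: "y \<in> h ` T"
    obtain q where q: "q \<in> T" "y = h q" using y by auto
    have "q \<in> U" "q \<in> fst c" using q T by auto
    then have "inv_into (snd c ` T) (h \<circ> chart_inv c) ((h \<circ> chart_inv c) (snd c q)) = snd c q"
      using q by (intro inv_into_f_f inj) auto
    then show "inv_into (snd c ` T) (h \<circ> chart_inv c) y = snd c (inv_into U h y)"
      using hd q \<open>q \<in> U\<close> \<open>q \<in> fst c\<close> c by simp
  qed
  then have "diffeo_on (snd c ` T) (h \<circ> chart_inv c)"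
    using op sm inj opT by (simp only: diffeo_on_def image_chart_comp[OF c T(2)] simp_thms)
  then show ?thesis
    by (rule diffeo_on_subset) (use V in \<open>auto simp: T_def intro!: open_chart_image'[OF c]\<close>)
qed

lemma coord_map_inverse_eq:
  assumes c: "c \<in> A" "d \<in> A" and U: "U \<subseteq> fst c" and inj: "inj_on h U" and y: "y \<in> h ` (U \<inter> fst d)"
  shows "(snd d \<circ> inv_into U h) y = transition c d (inv_into (snd c ` U) (h \<circ> chart_inv c) y)"
proof -
  have "y \<in> h ` U" using y by auto
  then obtain q where q: "q \<in> U" "y = h q" by auto
  have "inv_into U h y = q" using q inj by simp
  then show ?thesis
    using q U c inv_into_chart_comp[OF c(1) U inj order_refl \<open>y \<in> h ` U\<close>] by (auto simp: subset_iff)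
qed

lemma coord_mapI:
  fixes h :: "'a \<Rightarrow> 'w::euclidean_space"
  assumes c: "c \<in> A" and U: "open U" "U \<subseteq> fst c" and H: "diffeo_on (snd c ` U) (h \<circ> chart_inv c)"
  shows "coord_map U h"
    and "\<And>d. d \<in> A \<Longrightarrow> open (h ` (U \<inter> fst d))"
proof -
  note Hd = H[unfolded diffeo_on_def image_chart_comp[OF c U(2)]]
  have inj: "inj_on h U"
  proof (rule inj_onI)
    fix p q assume pq: "p \<in> U" "q \<in> U" "h p = h q"
    then have fc: "p \<in> fst c" "q \<in> fst c" using U by auto
    have "(h \<circ> chart_inv c) (snd c p) = (h \<circ> chart_inv c) (snd c q)" using pq fc c by simp
    moreover have "inj_on (h \<circ> chart_inv c) (snd c ` U)" using Hd by blast
    ultimately have "snd c p = snd c q" using pq by (meson inj_onD imageI)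
    then show "p = q" by (rule inj_onD[OF inj_on_chart[OF c] _ fc])
  qed
  show opd: "open (h ` (U \<inter> fst d))" if d: "d \<in> A" for d
  proof -
    have "diffeo_on (snd c ` (U \<inter> fst d)) (h \<circ> chart_inv c)"
      by (rule diffeo_on_subset[OF H])
        (use U chart_homeo(1)[OF d] in \<open>auto intro!: open_chart_image'[OF c]\<close>)
    then have "open ((h \<circ> chart_inv c) ` snd c ` (U \<inter> fst d))" by (simp only: diffeo_on_def)
    moreover have "U \<inter> fst d \<subseteq> fst c" using U(2) by auto
    ultimately show ?thesis by (simp only: image_chart_comp[OF c])
  qed
  have "smooth_on (h ` (U \<inter> fst d)) (snd d \<circ> inv_into U h)" if d: "d \<in> A" for d
  proof (rule smooth_on_cong[OF opd[OF d] coord_map_inverse_eq[OF c d U(2) inj], THEN iffD2])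
    show "smooth_on (h ` (U \<inter> fst d)) (\<lambda>y. transition c d (inv_into (snd c ` U) (h \<circ> chart_inv c) y))"
    proof (rule smooth_on_compose[OF opd[OF d] _ transition_holomorphic(1)[OF c d]])
      show "smooth_on (h ` (U \<inter> fst d)) (inv_into (snd c ` U) (h \<circ> chart_inv c))"
        by (rule smooth_on_subset[of "h ` U"]) (use Hd in auto)
      show "inv_into (snd c ` U) (h \<circ> chart_inv c) ` h ` (U \<inter> fst d) \<subseteq> chart_image c (fst d)"
      proof (rule image_subsetI)
        fix y assume y: "y \<in> h ` (U \<inter> fst d)"
        then obtain q where q: "q \<in> U" "q \<in> fst d" "y = h q" by auto
        have "inv_into (snd c ` U) (h \<circ> chart_inv c) y = snd c q"
          using inv_into_chart_comp[OF c U(2) inj order_refl, of y] q inj by auto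
        then show "inv_into (snd c ` U) (h \<circ> chart_inv c) y \<in> chart_image c (fst d)" using q U by auto
      qed
    qed
  qed
  then show "coord_map U h"
    using Hd U inj by (simp add: coord_map_def smooth_fun_iff[OF c U])
qed

lemma holomorphic_funD:
  assumes "holomorphic_fun A V f" "d \<in> A"
  shows "smooth_on (chart_image d V) (f \<circ> chart_inv d)"
    "u \<in> chart_image d V \<Longrightarrow> FD (f \<circ> chart_inv d) u (J v) = \<i> * FD (f \<circ> chart_inv d) u v"
  using assms unfolding holomorphic_fun_def Cn_holomorphic_on_def by blast+

lemma holomorphic_funI:
  assumes c: "c \<in> A" and U: "open U" "U \<subseteq> fst c" and f: "Cn_holomorphic_on (snd c ` U) (f \<circ> chart_inv c)"
  shows "holomorphic_fun A U f"
  unfolding holomorphic_fun_def Cn_holomorphic_on_def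
proof (intro ballI conjI allI)
  fix d assume d: "d \<in> A"
  have sm: "smooth_on (snd c ` U) (f \<circ> chart_inv c)" using f by (simp add: Cn_holomorphic_on_def)
  show "smooth_on (chart_image d U) (f \<circ> chart_inv d)"
    by (rule smooth_on_chart_change[OF c d U sm])
  fix u v assume "u \<in> chart_image d U"
  then obtain q where q: "q \<in> U" "q \<in> fst d" "u = snd d q" by auto
  have qc: "q \<in> fst c" using q U by auto
  have "FD (f \<circ> chart_inv d) u v = FD (f \<circ> chart_inv c) (snd c q) (FD (transition d c) (snd d q) v)" for v
    using FD_eqI[OF chart_change_has_derivative[OF c d qc q(2) smooth_on_has_derivative[OF sm]]] q by simp
  moreover have "FD (transition d c) (snd d q) (J v) = J (FD (transition d c) (snd d q) v)"
    by (rule transition_holomorphic(2)[OF d c]) (use q qc in auto)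
  ultimately show "FD (f \<circ> chart_inv d) u (J v) = \<i> * FD (f \<circ> chart_inv d) u v"
    using f q by (simp add: Cn_holomorphic_on_def)
qed

lemma holomorphic_vecI:
  assumes c: "c \<in> A" and U: "open U" "U \<subseteq> fst c" and sm: "smooth_on (snd c ` U) (z \<circ> chart_inv c)"
    and cr: "\<And>u a. u \<in> snd c ` U \<Longrightarrow> FD (z \<circ> chart_inv c) u (J a) = J (FD (z \<circ> chart_inv c) u a)"
  shows "holomorphic_fun A U (\<lambda>q. z q $ i)"
proof (rule holomorphic_funI[OF c U])
  have "holomorphic_map_on (snd c ` U) (z \<circ> chart_inv c)"
    using holomorphic_map_on_iff[OF open_chart_image'[OF c U]] sm cr by blast
  then show "Cn_holomorphic_on (snd c ` U) ((\<lambda>q. z q $ i) \<circ> chart_inv c)"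
    by (simp add: holomorphic_map_on_def o_def)
qed

text \<open>The inverse of a complex linear differential is complex linear, and remains so after
  composition with the differential of a transition map; smoothness of the inverse is part of the
  diffeomorphism hypothesis.\<close>

lemma holomorphic_coordsI:
  assumes c: "c \<in> A" and U: "open U" "U \<subseteq> fst c" and z: "diffeo_on (snd c ` U) (z \<circ> chart_inv c)"
    and cr: "\<And>u a. u \<in> snd c ` U \<Longrightarrow> FD (z \<circ> chart_inv c) u (J a) = J (FD (z \<circ> chart_inv c) u a)"
  shows "holomorphic_coords A U z"
proof -
  note cm = coord_mapI[OF c U z]
  note cmd = cm(1)[unfolded coord_map_def]
  let ?Z = "z \<circ> chart_inv c"
  let ?g = "inv_into (snd c ` U) ?Z"
  have sm: "smooth_on (snd c ` U) ?Z" using z by (simp add: diffeo_on_def)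
  have "holomorphic_map_on (z ` (U \<inter> fst d)) (snd d \<circ> inv_into U z)" if d: "d \<in> A" for d
    unfolding holomorphic_map_on_iff[OF cm(2)[OF d]]
  proof (intro conjI ballI allI)
    show "smooth_on (z ` (U \<inter> fst d)) (snd d \<circ> inv_into U z)" using cmd d by blast
    fix y v assume y: "y \<in> z ` (U \<inter> fst d)"
    then obtain q where q: "q \<in> U" "q \<in> fst d" "y = z q" by auto
    have qc: "q \<in> fst c" using q U by auto
    have Zq: "?Z (snd c q) = y" using q qc c by simp
    have gy: "?g y = snd c q"
    proof -
      have "?g (?Z (snd c q)) = snd c q"
        by (rule inv_into_f_f) (use z q in \<open>auto simp: diffeo_on_def\<close>)
      then show ?thesis by (simp only: Zq)
    qed
    have dg: "(?g has_derivative FD ?g y) (at y)"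
    proof (rule smooth_on_has_derivative)
      show "smooth_on (?Z ` snd c ` U) ?g" using z unfolding diffeo_on_def by blast
      show "y \<in> ?Z ` snd c ` U" using q(1) Zq by (metis imageI)
    qed
    have "(transition c d \<circ> ?g has_derivative FD (transition c d) (snd c q) \<circ> FD ?g y) (at y)"
      using diff_chain_at[OF dg] transition_has_derivative[OF c d qc q(2)] by (simp only: gy)
    then have "((snd d \<circ> inv_into U z) has_derivative FD (transition c d) (snd c q) \<circ> FD ?g y) (at y)"
    proof (rule has_derivative_cong_open[OF cm(2)[OF d] y, THEN iffD2, rotated])
      fix x assume x: "x \<in> z ` (U \<inter> fst d)"
      show "(snd d \<circ> inv_into U z) x = (transition c d \<circ> ?g) x"
        using coord_map_inverse_eq[OF c d U(2) _ x] cmd by (simp only: o_apply)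
    qed
    then have FDF: "FD (snd d \<circ> inv_into U z) y = FD (transition c d) (snd c q) \<circ> FD ?g y" by (rule FD_eqI)
    have "FD ?g y (J v) = J (FD ?g y v)"
    proof -
      note inv = diffeo_on_FD_inverse[OF z, of "snd c q", unfolded Zq]
      have "J v = FD ?Z (snd c q) (J (FD ?g y v))" using cr[of "snd c q"] inv(2) q by simp
      then show ?thesis using inv(1) q by simp
    qed
    moreover have "FD (transition c d) (snd c q) (J w) = J (FD (transition c d) (snd c q) w)" for w
      by (rule transition_holomorphic(2)[OF c d]) (use q qc in auto)
    ultimately show "FD (snd d \<circ> inv_into U z) y (J v) = J (FD (snd d \<circ> inv_into U z) y v)"
      by (simp add: FDF)
  qed
  then show ?thesis
    using cmd holomorphic_vecI[OF c U sm cr] by (simp add: holomorphic_coords_def)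
qed

text \<open>The difference of the two functions has a complex linear differential \<open>D\<close>
  with real part zero. As \<open>Re (D (J a)) = - Im (D a)\<close>, the imaginary part vanishes too.
  So the difference is locally constant and, its real part being zero at \<open>p\<close>, purely
  imaginary.\<close>

lemma holomorphic_same_real_part:
  assumes f: "holomorphic_fun A V f" "open V" "p \<in> V" and f': "holomorphic_fun A V' f'" "open V'" "p \<in> V'"
    and Re: "\<And>q. q \<in> V \<Longrightarrow> q \<in> V' \<Longrightarrow> Re (f' q) = Re (f q)"
  shows "\<forall>\<^sub>F q in nhds p. f' q = f q + \<i> * of_real (Im (f' p - f p))"
proof -
  obtain c where c: "c \<in> A" "p \<in> fst c" using chart_exists by blast
  define S where "S = snd c ` (V \<inter> V' \<inter> fst c)"
  have op: "open (V \<inter> V' \<inter> fst c)" using f f' chart_homeo(1)[OF c(1)] by auto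
  have S: "open S" unfolding S_def by (rule open_chart_image'[OF c(1) op]) auto
  define g where "g u = f' (chart_inv c u) - f (chart_inv c u)" for u
  have sm: "smooth_on S (f \<circ> chart_inv c)" "smooth_on S (f' \<circ> chart_inv c)"
    unfolding S_def
    by (rule smooth_on_subset[OF holomorphic_funD(1)[OF f(1) c(1)]], blast)
      (rule smooth_on_subset[OF holomorphic_funD(1)[OF f'(1) c(1)]], blast)
  have d: "(g has_derivative (\<lambda>a. 0)) (at u)" if u: "u \<in> S" for u
  proof -
    define D where "D a = FD (f' \<circ> chart_inv c) u a - FD (f \<circ> chart_inv c) u a" for a
    have gD: "(g has_derivative D) (at u)"
      unfolding g_def[abs_def] D_def
      using has_derivative_diff[OF smooth_on_has_derivative[OF sm(2) u] smooth_on_has_derivative[OF sm(1) u]]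
      by (simp add: o_def)
    have "u \<in> chart_image c V" "u \<in> chart_image c V'" using u by (auto simp: S_def)
    then have DJ: "D (J a) = \<i> * D a" for a
      using holomorphic_funD(2)[OF f(1) c(1), of u] holomorphic_funD(2)[OF f'(1) c(1), of u]
      by (simp add: D_def right_diff_distrib)
    have "((\<lambda>u. Re (g u)) has_derivative (\<lambda>a. Re (D a))) (at u)"
      by (rule bounded_linear.has_derivative[OF bounded_linear_Re gD])
    moreover have "((\<lambda>u. Re (g u)) has_derivative (\<lambda>a. 0)) (at u)"
      by (rule has_derivative_cong_open[OF S u, THEN iffD2, OF _ has_derivative_const[of 0]])
        (use c Re in \<open>auto simp: S_def g_def\<close>)
    ultimately have ReD: "Re (D a) = 0" for a
      using has_derivative_unique by metis
    have "D a = 0" for a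
      using ReD[of a] ReD[of "J a"] by (simp add: DJ complex_eq_iff)
    then have "D = (\<lambda>a. 0)" by blast
    then show ?thesis using gD by simp
  qed
  have pS: "snd c p \<in> S" using c f f' by (auto simp: S_def)
  have "\<forall>\<^sub>F u in nhds (snd c p). (g has_derivative (\<lambda>a. 0)) (at u)"
    using d S pS by (auto simp: eventually_nhds)
  from locally_constant[OF this] obtain T where T: "open T" "snd c p \<in> T"
    "\<And>u. u \<in> T \<Longrightarrow> g u = g (snd c p)" unfolding eventually_nhds by blast
  define Q where "Q = chart_inv c ` (T \<inter> S)"
  have SD: "T \<inter> S \<subseteq> snd c ` fst c" by (auto simp: S_def)
  have Q: "open Q" "Q \<subseteq> fst c" "snd c ` Q = T \<inter> S"
    unfolding Q_def using open_chart_preimage[OF c(1) open_Int[OF T(1) S] SD] by blast+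
  have "f' q = f q + \<i> * of_real (Im (f' p - f p))" if q: "q \<in> Q" for q
  proof -
    have qc: "q \<in> fst c" and "snd c q \<in> T" using q Q by auto
    then have "f' q - f q = f' p - f p"
      using T(3)[of "snd c q"] c by (simp add: g_def)
    moreover have "f' p - f p = \<i> * of_real (Im (f' p - f p))"
      using Re[OF f(3) f'(3)] by (simp add: complex_eq_iff)
    ultimately show ?thesis by (metis add.commute diff_add_cancel)
  qed
  moreover have "p \<in> Q"
    unfolding Q_def using T(2) pS c by (intro image_eqI[of _ _ "snd c p"]) auto
  ultimately show ?thesis unfolding eventually_nhds using Q(1) by blast
qed

lemma holomorphic_fun_translate:
  assumes f: "holomorphic_fun A V f" and V: "open V'" "V' \<subseteq> V" and eq: "\<And>q. q \<in> V' \<Longrightarrow> f' q = f q + k"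
  shows "holomorphic_fun A V' f'"
  unfolding holomorphic_fun_def Cn_holomorphic_on_def
proof (intro ballI conjI allI)
  fix d assume d: "d \<in> A"
  note op = open_chart_image[OF d V(1)]
  have fd: "smooth_on (chart_image d V') (f \<circ> chart_inv d)"
    "\<And>u v. u \<in> chart_image d V' \<Longrightarrow> FD (f \<circ> chart_inv d) u (J v) = \<i> * FD (f \<circ> chart_inv d) u v"
    using holomorphic_funD[OF f d] V(2) smooth_on_subset[OF holomorphic_funD(1)[OF f d], of "chart_image d V'"]
    by blast+
  have eq': "(f' \<circ> chart_inv d) u = (f \<circ> chart_inv d) u + k" if "u \<in> chart_image d V'" for u
    using that d eq by auto
  show "smooth_on (chart_image d V') (f' \<circ> chart_inv d)"
    by (rule smooth_on_cong[OF op eq', THEN iffD2]) (use smooth_on_add[OF op fd(1)] in auto)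
  fix u v assume u: "u \<in> chart_image d V'"
  have "((\<lambda>u. (f \<circ> chart_inv d) u + k) has_derivative FD (f \<circ> chart_inv d) u) (at u)"
    using has_derivative_add[OF smooth_on_has_derivative[OF fd(1) u] has_derivative_const[of k]] by simp
  then have "((f' \<circ> chart_inv d) has_derivative FD (f \<circ> chart_inv d) u) (at u)"
    by (rule has_derivative_cong_open[OF op u eq', THEN iffD2, rotated])
  then show "FD (f' \<circ> chart_inv d) u (J v) = \<i> * FD (f' \<circ> chart_inv d) u v"
    using fd(2)[OF u] by (simp add: FD_eqI)
qed

end

section \<open>Special coordinates in a chart\<close>

lemma std_symplectic_bounded_bilinear: "bounded_bilinear (std_symplectic :: (real^'n) \<times> (real^'n) \<Rightarrow> _)"
proof -
  have "bilinear (std_symplectic :: (real^'n) \<times> (real^'n) \<Rightarrow> _)"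
    unfolding bilinear_def std_symplectic_def
    by (auto intro!: linearI simp: inner_add_left inner_add_right algebra_simps)
  then show ?thesis by (simp add: bilinear_conv_bounded_bilinear)
qed

text \<open>Pairing \<open>u\<close> with \<open>(- snd u, fst u)\<close> gives the squared norm of
  \<open>u\<close>, so a vector killed by \<open>L\<close> is zero. Injectivity is what makes
  \<open>L\<close> a change of coordinates.\<close>

lemma std_symplectic_preserving_inj:
  assumes L: "linear L" and s: "\<And>u v. std_symplectic (L u) (L v) = std_symplectic u v"
  shows "inj (L :: (real^'n) \<times> (real^'n) \<Rightarrow> (real^'n) \<times> (real^'n))"
proof -
  have "u = 0" if "L u = 0" for u
  proof -
    have "std_symplectic u (- snd u, fst u) = std_symplectic (L u) (L (- snd u, fst u))" by (simp add: s)
    also have "\<dots> = 0" by (simp add: that std_symplectic_def)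
    finally have "fst u \<bullet> fst u + snd u \<bullet> snd u = 0" by (simp add: std_symplectic_def)
    then have "fst u = 0" "snd u = 0"
      by (simp_all add: add_nonneg_eq_0_iff)
    then show ?thesis by (simp add: prod_eq_iff)
  qed
  then show ?thesis using linear_injective_0[OF L] by blast
qed

lemma affine_eq_pair_iff:
  fixes H :: "'v::real_normed_vector \<Rightarrow> (real^'n) \<times> (real^'n)"
  assumes S: "open S"
  shows "affine_eq \<Gamma> S H \<longleftrightarrow>
    (\<forall>i. affine_eq \<Gamma> S (\<lambda>u. fst (H u) $ i) \<and> affine_eq \<Gamma> S (\<lambda>u. snd (H u) $ i))"
proof
  assume H: "affine_eq \<Gamma> S H"
  have "bounded_linear (\<lambda>z :: (real^'n) \<times> (real^'n). fst z $ i)"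
    "bounded_linear (\<lambda>z :: (real^'n) \<times> (real^'n). snd z $ i)" for i
    by (intro bounded_linear_compose[OF bounded_linear_vec_nth] bounded_linear_fst bounded_linear_snd)+
  then show "\<forall>i. affine_eq \<Gamma> S (\<lambda>u. fst (H u) $ i) \<and> affine_eq \<Gamma> S (\<lambda>u. snd (H u) $ i)"
    using affine_eq_linear_compose[OF S H] by blast
next
  assume h: "\<forall>i. affine_eq \<Gamma> S (\<lambda>u. fst (H u) $ i) \<and> affine_eq \<Gamma> S (\<lambda>u. snd (H u) $ i)"
  have "affine_eq \<Gamma> S (\<lambda>u. \<Sum>i\<in>UNIV. (fst (H u) $ i) *\<^sub>R (axis i 1, 0 :: real^'n)
      + (snd (H u) $ i) *\<^sub>R (0 :: real^'n, axis i 1))"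
    by (intro affine_eq_sum[OF S] affine_eq_add[OF S] affine_eq_linear_compose[OF S _ bounded_linear_scaleR_left])
      (use h in auto)
  moreover have eq: "(\<Sum>i\<in>UNIV. (fst z $ i) *\<^sub>R (axis i 1, 0) + (snd z $ i) *\<^sub>R (0, axis i 1)) = z"
    for z :: "(real^'n) \<times> (real^'n)"
    by (simp add: prod_eq_iff vec_eq_iff axis_def sum.distrib fst_sum snd_sum if_distrib if_distribR sum.delta cong: if_cong)
  ultimately show "affine_eq \<Gamma> S H" by (simp only: eq)
qed

context special_complex_chart
begin

text \<open>
  \<open>dH \<circ> J\<close> is closed because \<open>\<nabla> dH = 0\<close> and \<open>\<Gamma> a (J b)\<close> is symmetric.
\<close>

lemma conjugate_exists:
  fixes H :: "complex^'n \<Rightarrow> 'w::euclidean_space"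
  assumes S: "open S" "S \<subseteq> D" "p \<in> S" and H: "affine_eq christoffel S H"
  obtains r G where "r > 0" "ball p r \<subseteq> S" "smooth_on (ball p r) G"
    "\<And>u a. u \<in> ball p r \<Longrightarrow> FD G u a = - FD H u (J a)"
proof -
  note sm = affine_eq_smooth[OF H]
  have hd: "((\<lambda>w. - FD H w (J b)) has_derivative (\<lambda>a. - FD H u (christoffel u a (J b)))) (at u)" if "u \<in> S" for u b
    by (rule has_derivative_minus[OF affine_eq_has_derivative2[OF H that]])
  have lin: "linear (\<lambda>a. - FD H u (J a))" if "u \<in> S" for u
    using linear_compose_neg[OF linear_compose[OF linear_J smooth_on_linear_FD[OF sm that]]] by (simp add: o_def)
  have smJ: "smooth_on S (\<lambda>u. - FD H u (J a))" for a
    by (rule smooth_on_linear_compose[OF S(1) bounded_linear_minus[OF bounded_linear_ident] smooth_on_FD[OF sm]])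
  have closed: "FD (\<lambda>w. - FD H w (J b)) u a = FD (\<lambda>w. - FD H w (J a)) u b" if "u \<in> S" for u a b
    unfolding FD_eqI[OF hd[OF that]] using christoffel_J[of u a b] that S(2) by auto
  obtain r G where r: "r > 0" "ball p r \<subseteq> S" "\<And>u. u \<in> ball p r \<Longrightarrow> (G has_derivative (\<lambda>a. - FD H u (J a))) (at u)"
    "smooth_on (ball p r) G"
    using closed_form_local_primitive[OF S(1,3) lin smJ closed] by metis
  show ?thesis by (rule that[OF r(1,2,4)]) (simp add: FD_eqI[OF r(3)])
qed

lemma affine_coords_chart:
  assumes xy: "affine_coords A nabla U x y" and V: "open V" "V \<subseteq> U" "V \<subseteq> fst c"
  shows "diffeo_on (snd c ` V) ((\<lambda>p. (x p, y p)) \<circ> chart_inv c)"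
    "affine_eq christoffel (snd c ` V) ((\<lambda>p. (x p, y p)) \<circ> chart_inv c)"
proof -
  have cm: "coord_map U (\<lambda>p. (x p, y p))"
    using xy by (simp add: affine_coords_def real_coords_iff)
  show "diffeo_on (snd c ` V) ((\<lambda>p. (x p, y p)) \<circ> chart_inv c)"
    by (rule coord_map_chart[OF c cm V]) simp
  have sub: "affine_fun A nabla V f" if "affine_fun A nabla U f" for f
    unfolding affine_fun_def
  proof (intro conjI allI impI)
    show "smooth_fun A V f"
      using that V(2) unfolding affine_fun_def smooth_fun_def by (auto intro: smooth_on_subset)
    fix V' assume V': "open V' \<and> V' \<subseteq> V"
    then have "open V' \<and> V' \<subseteq> U" using V(2) by auto
    then show "\<forall>X\<in>smooth_vfields A V'. \<forall>Y\<in>smooth_vfields A V'. \<forall>p\<in>V'.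
        lie_deriv A X (lie_deriv A Y f) p - lie_deriv A (nabla X Y) f p = 0"
      using that unfolding affine_fun_def by blast
  qed
  have "affine_eq christoffel (snd c ` V) ((\<lambda>p. x p $ i) \<circ> chart_inv c)"
    "affine_eq christoffel (snd c ` V) ((\<lambda>p. y p $ i) \<circ> chart_inv c)" for i
    using xy sub unfolding affine_coords_def affine_fun_iff[OF V(1,3), symmetric] by blast+
  then show "affine_eq christoffel (snd c ` V) ((\<lambda>p. (x p, y p)) \<circ> chart_inv c)"
    unfolding affine_eq_pair_iff[OF open_chart_image'[OF c V(1,3)]] by (simp add: o_def)
qed

lemma affine_coordsI:
  assumes V: "open V" "V \<subseteq> fst c"
    and H: "diffeo_on (snd c ` V) ((\<lambda>p. (x p, y p)) \<circ> chart_inv c)"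
      "affine_eq christoffel (snd c ` V) ((\<lambda>p. (x p, y p)) \<circ> chart_inv c)"
  shows "affine_coords A nabla V x y"
  unfolding affine_coords_def real_coords_iff affine_fun_iff[OF V]
  using coord_mapI(1)[OF c V H(1)] H(2)[unfolded affine_eq_pair_iff[OF open_chart_image'[OF c V]]]
  by (simp add: o_def)

lemma FD_components:
  assumes V: "open V" "V \<subseteq> fst c" and q: "q \<in> V" and v: "v \<in> tangent_space A q"
    and H: "smooth_on (snd c ` V) ((\<lambda>p. (x p, y p)) \<circ> chart_inv c)"
  shows "differential A (\<lambda>q. x q $ i) q v = fst (FD ((\<lambda>p. (x p, y p)) \<circ> chart_inv c) (snd c q) (v c)) $ i"
    "differential A (\<lambda>q. y q $ i) q v = snd (FD ((\<lambda>p. (x p, y p)) \<circ> chart_inv c) (snd c q) (v c)) $ i"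
proof -
  let ?H = "(\<lambda>p. (x p, y p)) \<circ> chart_inv c"
  have qc: "q \<in> fst c" using q V by auto
  have d: "(?H has_derivative FD ?H (snd c q)) (at (snd c q))"
    by (rule smooth_on_has_derivative[OF H]) (use q in auto)
  have dx: "(((\<lambda>q. x q $ i) \<circ> chart_inv c) has_derivative (\<lambda>a. fst (FD ?H (snd c q) a) $ i)) (at (snd c q))"
    using bounded_linear.has_derivative[OF bounded_linear_vec_nth has_derivative_fst[OF d]] by (simp add: o_def)
  have dy: "(((\<lambda>q. y q $ i) \<circ> chart_inv c) has_derivative (\<lambda>a. snd (FD ?H (snd c q) a) $ i)) (at (snd c q))"
    using bounded_linear.has_derivative[OF bounded_linear_vec_nth has_derivative_snd[OF d]] by (simp add: o_def)
  show "differential A (\<lambda>q. x q $ i) q v = fst (FD ?H (snd c q) (v c)) $ i"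
    using differential_eq[OF c qc v differentiableI[OF dx]] FD_eqI[OF dx] by simp
  show "differential A (\<lambda>q. y q $ i) q v = snd (FD ?H (snd c q) (v c)) $ i"
    using differential_eq[OF c qc v differentiableI[OF dy]] FD_eqI[OF dy] by simp
qed

end

section \<open>The symplectic form in a chart\<close>

locale special_symplectic_chart = special_complex_chart A nabla c
  for A :: "('a::{t2_space,second_countable_topology}, 'n::finite) chart set"
    and nabla :: "('a, 'n) vfield \<Rightarrow> ('a, 'n) vfield \<Rightarrow> ('a, 'n) vfield"
    and c :: "('a, 'n) chart" +
  fixes \<omega> :: "'a \<Rightarrow> ('a, 'n) tvec \<Rightarrow> ('a, 'n) tvec \<Rightarrow> real"
  assumes symplectic: "symplectic_form A \<omega>" and parallel: "parallel_form A nabla \<omega>"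
begin

definition chart_form :: "complex^'n \<Rightarrow> complex^'n \<Rightarrow> complex^'n \<Rightarrow> real" where
  "chart_form u a b = \<omega> (chart_inv c u) (E a (chart_inv c u)) (E b (chart_inv c u))"

lemma chart_form_eq:
  assumes q: "q \<in> fst c" and v: "v \<in> tangent_space A q" "w \<in> tangent_space A q"
  shows "\<omega> q v w = chart_form (snd c q) (v c) (w c)"
proof -
  have "v = E (v c) q" "w = E (w c) q"
    by (rule tangent_space_eqI[OF _ tangent_lift(1)[OF c q] c q], use v tangent_lift(2)[OF c q] in simp_all)+
  then show ?thesis using q c by (simp add: chart_form_def)
qed

lemmas symplectic_clauses = symplectic[unfolded symplectic_form_def]

lemma chart_form_skew:
  assumes "u \<in> D"
  shows "chart_form u a b = - chart_form u b a"
proof -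
  obtain q where q: "q \<in> fst c" "u = snd c q" using assms by auto
  note T = tangent_lift(1)[OF c q(1)]
  show ?thesis
    using symplectic_clauses[THEN conjunct2, THEN conjunct1, rule_format, OF T T, of a b]
    by (simp add: chart_form_def q(2) c chart_inv_chart[OF c q(1)])
qed

lemma linear_chart_form_left:
  assumes "u \<in> D"
  shows "linear (\<lambda>a. chart_form u a b)"
proof -
  obtain q where q: "q \<in> fst c" "u = snd c q" using assms by auto
  note T = tangent_lift(1)[OF c q(1)]
  have *: "chart_form u (r *\<^sub>R a + s *\<^sub>R a') b = r * chart_form u a b + s * chart_form u a' b" for r s a a'
  proof -
    have "E (r *\<^sub>R a + s *\<^sub>R a') q = (\<lambda>d. r *\<^sub>R E a q d + s *\<^sub>R E a' q d)"
      by (rule tangent_space_eqI[OF T tangent_space_linear[OF T T] c q(1)])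
        (simp add: tangent_lift(2)[OF c q(1)])
    then show ?thesis
      using symplectic_clauses[THEN conjunct1, rule_format, OF T T T, of r a s a' b]
      by (simp add: chart_form_def q(2) chart_inv_chart[OF c q(1)])
  qed
  show ?thesis
    using *[of 1 _ 1] *[of _ _ 0] by (intro linearI) simp_all
qed

lemma linear_chart_form_right:
  assumes "u \<in> D"
  shows "linear (chart_form u a)"
proof -
  have "chart_form u a = (\<lambda>b. - chart_form u b a)" using chart_form_skew[OF assms] by blast
  then show ?thesis using linear_compose_neg[OF linear_chart_form_left[OF assms, of a]] by simp
qed

lemma chart_form_nondeg:
  assumes "u \<in> D" "\<And>b. chart_form u a b = 0"
  shows "a = 0"
proof -
  obtain q where q: "q \<in> fst c" "u = snd c q" using assms by auto
  note T = tangent_lift(1)[OF c q(1)]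
  have "\<omega> q (E a q) v = 0" if "v \<in> tangent_space A q" for v
    unfolding chart_form_eq[OF q(1) T that] using assms(2) by (simp add: tangent_lift(2)[OF c q(1)] q(2))
  then have "E a q = (\<lambda>c. 0)"
    using symplectic_clauses[THEN conjunct2, THEN conjunct2, THEN conjunct1, rule_format, OF T] by blast
  from fun_cong[OF this, of c] show "a = 0" by (simp add: tangent_lift(2)[OF c q(1)])
qed

lemma chart_form_J:
  assumes "u \<in> D" and inv: "\<And>p u v. u \<in> tangent_space A p \<Longrightarrow> v \<in> tangent_space A p \<Longrightarrow> \<omega> p (J_vec u) (J_vec v) = \<omega> p u v"
  shows "chart_form u (J a) (J b) = chart_form u a b"
proof -
  obtain q where q: "q \<in> fst c" "u = snd c q" using assms by auto
  note T = tangent_lift(1)[OF c q(1)]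
  have "E (J a) q = J_vec (E a q)" for a
    by (rule tangent_space_eqI[OF T tangent_space_J[OF T] c q(1)]) (simp add: J_vec_def tangent_lift(2)[OF c q(1)])
  then show ?thesis using inv[OF T T] by (simp add: chart_form_def q(2) chart_inv_chart[OF c q(1)])
qed

text \<open>Parallelism of \<open>\<omega>\<close> evaluated on coordinate fields, where
  \<open>nabla (E a) (E b)\<close> is the lift of \<open>christoffel u a b\<close>. In this form
  \<open>\<omega>\<close> meets the uniqueness lemma for parallel forms.\<close>

lemma chart_form_has_derivative:
  assumes "u \<in> D"
  shows "((\<lambda>w. chart_form w b d) has_derivative
    (\<lambda>a. chart_form u (christoffel u a b) d + chart_form u b (christoffel u a d))) (at u)"
proof -
  obtain q where q: "q \<in> fst c" "u = snd c q" using assms by auto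
  note T = tangent_lift(1)[OF c q(1)]
  note Es = tangent_lift_smooth[OF c W]
  have sm: "smooth_fun A (fst c) (\<lambda>p. \<omega> p (E b p) (E d p))"
    using symplectic_clauses[THEN conjunct2, THEN conjunct2, THEN conjunct2, THEN conjunct1, rule_format, OF W(1) Es Es] .
  have eq: "(\<lambda>p. \<omega> p (E b p) (E d p)) \<circ> chart_inv c = (\<lambda>w. chart_form w b d)"
    by (simp add: chart_form_def o_def)
  have hd: "((\<lambda>w. chart_form w b d) has_derivative FD (\<lambda>w. chart_form w b d) u) (at u)"
    by (rule smooth_on_has_derivative[OF _ assms]) (use sm in \<open>simp only: smooth_fun_iff[OF c W] eq\<close>)
  have "FD (\<lambda>w. chart_form w b d) u a = chart_form u (christoffel u a b) d + chart_form u b (christoffel u a d)" for a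
  proof -
    have "lie_deriv A (E a) (\<lambda>p. \<omega> p (E b p) (E d p)) q = FD (\<lambda>w. chart_form w b d) u a"
      unfolding lie_deriv_eq[OF W Es sm q(1)] eq by (simp add: tangent_lift(2)[OF c q(1)] q(2))
    moreover have "lie_deriv A (E a) (\<lambda>p. \<omega> p (E b p) (E d p)) q
        - \<omega> q (nabla (E a) (E b) q) (E d q) - \<omega> q (E b q) (nabla (E a) (E d) q) = 0"
      using parallel[unfolded parallel_form_def, rule_format, OF W(1) Es Es Es q(1)] .
    ultimately show ?thesis
      unfolding nabla_E_field[OF q(1)] chart_form_eq[OF q(1) T T]
      by (simp add: tangent_lift(2)[OF c q(1)] q(2))
  qed
  then have "FD (\<lambda>w. chart_form w b d) u =
      (\<lambda>a. chart_form u (christoffel u a b) d + chart_form u b (christoffel u a d))" by blast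
  then show ?thesis using hd by simp
qed

definition special_chart :: "(complex^'n) set \<Rightarrow> (complex^'n \<Rightarrow> (real^'n) \<times> (real^'n)) \<Rightarrow> bool" where
  "special_chart S H \<longleftrightarrow> diffeo_on S H \<and> affine_eq christoffel S H \<and>
     (\<forall>u\<in>S. \<forall>a b. chart_form u a b = 2 * std_symplectic (FD H u a) (FD H u b))"

lemma special_chart_subset:
  "special_chart S H \<Longrightarrow> open T \<Longrightarrow> T \<subseteq> S \<Longrightarrow> special_chart T H"
  unfolding special_chart_def using diffeo_on_subset affine_eq_subset by blast

lemma special_chart_cong:
  assumes S: "open S" and eq: "\<And>u. u \<in> S \<Longrightarrow> F u = H u"
  shows "special_chart S F \<longleftrightarrow> special_chart S H"
proof -
  have "FD F u = FD H u" if "u \<in> S" for u by (rule FD_cong_open[OF S that eq])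
  moreover have "diffeo_on S F \<longleftrightarrow> diffeo_on S H" by (rule diffeo_on_cong[OF eq])
  moreover have "affine_eq christoffel S F \<longleftrightarrow> affine_eq christoffel S H" by (rule affine_eq_cong[OF S eq])
  ultimately show ?thesis unfolding special_chart_def by simp
qed

lemma real_special_coords_iff:
  assumes V: "open V" "V \<subseteq> fst c"
  shows "real_special_coords A nabla \<omega> V x y \<longleftrightarrow> special_chart (snd c ` V) ((\<lambda>p. (x p, y p)) \<circ> chart_inv c)"
proof -
  let ?H = "(\<lambda>p. (x p, y p)) \<circ> chart_inv c"
  have sum: "2 * (\<Sum>i\<in>UNIV. differential A (\<lambda>q. x q $ i) p u * differential A (\<lambda>q. y q $ i) p v -
      differential A (\<lambda>q. x q $ i) p v * differential A (\<lambda>q. y q $ i) p u) =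
      2 * std_symplectic (FD ?H (snd c p) (u c)) (FD ?H (snd c p) (v c))"
    if p: "p \<in> V" and uv: "u \<in> tangent_space A p" "v \<in> tangent_space A p"
      and H: "smooth_on (snd c ` V) ?H" for p u v
    unfolding FD_components[OF V p uv(1) H] FD_components[OF V p uv(2) H]
    by (simp add: std_symplectic_def inner_vec_def sum_subtractf)
  show ?thesis
  proof
    assume rs: "real_special_coords A nabla \<omega> V x y"
    then have ac: "affine_coords A nabla V x y" by (simp add: real_special_coords_def)
    note H = affine_coords_chart[OF ac V(1) order_refl V(2)]
    have sm: "smooth_on (snd c ` V) ?H" using H(1) by (simp add: diffeo_on_def)
    have "chart_form (snd c p) a b = 2 * std_symplectic (FD ?H (snd c p) a) (FD ?H (snd c p) b)"
      if p: "p \<in> V" for p a b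
    proof -
      have pc: "p \<in> fst c" using p V by auto
      note T = tangent_lift(1)[OF c pc]
      have "\<omega> p (E a p) (E b p) = 2 * (\<Sum>i\<in>UNIV.
          differential A (\<lambda>q. x q $ i) p (E a p) * differential A (\<lambda>q. y q $ i) p (E b p) -
          differential A (\<lambda>q. x q $ i) p (E b p) * differential A (\<lambda>q. y q $ i) p (E a p))"
        using rs T p unfolding real_special_coords_def by blast
      then show ?thesis
        unfolding sum[OF p T T sm] chart_form_eq[OF pc T T] tangent_lift(2)[OF c pc] .
    qed
    then show "special_chart (snd c ` V) ?H" using H by (auto simp: special_chart_def)
  next
    assume sc: "special_chart (snd c ` V) ?H"
    then have H: "diffeo_on (snd c ` V) ?H" "affine_eq christoffel (snd c ` V) ?H"
      by (simp_all add: special_chart_def)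
    have sm: "smooth_on (snd c ` V) ?H" using H(1) by (simp add: diffeo_on_def)
    show "real_special_coords A nabla \<omega> V x y"
      unfolding real_special_coords_def
    proof (intro conjI ballI)
      show "affine_coords A nabla V x y" by (rule affine_coordsI[OF V H])
      fix p u v assume p: "p \<in> V" and uv: "u \<in> tangent_space A p" "v \<in> tangent_space A p"
      have pc: "p \<in> fst c" using p V by auto
      show "\<omega> p u v = 2 * (\<Sum>i\<in>UNIV.
          differential A (\<lambda>q. x q $ i) p u * differential A (\<lambda>q. y q $ i) p v -
          differential A (\<lambda>q. x q $ i) p v * differential A (\<lambda>q. y q $ i) p u)"
        unfolding sum[OF p uv sm] chart_form_eq[OF pc uv] using sc p by (simp add: special_chart_def)
    qed
  qed
qed

lemma real_special_coords_subset:
  assumes rs: "real_special_coords A nabla \<omega> U x y" and V: "open V" "V \<subseteq> U" "V \<subseteq> fst c"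
  shows "special_chart (snd c ` V) ((\<lambda>p. (x p, y p)) \<circ> chart_inv c)"
proof -
  have ac: "affine_coords A nabla U x y" using rs by (simp add: real_special_coords_def)
  note H = affine_coords_chart[OF ac V]
  have "real_special_coords A nabla \<omega> V x y"
    using affine_coordsI[OF V(1,3) H] rs V(2) unfolding real_special_coords_def by blast
  then show ?thesis using real_special_coords_iff[OF V(1,3)] by blast
qed

text \<open>The last two clauses are stated at the base point: they will make the differentials of
  the two holomorphic extensions injective there, and the inverse function theorem then provides a
  neighbourhood. Their premise is \<open>J\<close>-invariance at \<open>p\<close>, so the lemma
  covers the symplectic and the Kaehler case together.\<close>

lemma special_chart_exists:
  assumes p: "p \<in> D"
  obtains S H where "open S" "p \<in> S" "S \<subseteq> D" "special_chart S H"
    "\<And>v. (\<forall>a b. chart_form p (J a) (J b) = chart_form p a b) \<Longrightarrow>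
      fst (FD H p v) = 0 \<Longrightarrow> fst (FD H p (J v)) = 0 \<Longrightarrow> v = 0"
    "\<And>v. (\<forall>a b. chart_form p (J a) (J b) = chart_form p a b) \<Longrightarrow>
      snd (FD H p v) = 0 \<Longrightarrow> snd (FD H p (J v)) = 0 \<Longrightarrow> v = 0"
proof -
  obtain L :: "complex^'n \<Rightarrow> (real^'n) \<times> (real^'n)" where L: "linear L" "inj L"
    "\<And>u v. chart_form p u v = 2 * std_symplectic (L u) (L v)"
    "\<And>v. (\<forall>u v. chart_form p (J u) (J v) = chart_form p u v) \<Longrightarrow> fst (L v) = 0 \<Longrightarrow> fst (L (J v)) = 0 \<Longrightarrow> v = 0"
    "\<And>v. (\<forall>u v. chart_form p (J u) (J v) = chart_form p u v) \<Longrightarrow> snd (L v) = 0 \<Longrightarrow> snd (L (J v)) = 0 \<Longrightarrow> v = 0"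
    using linear_darboux[OF linear_chart_form_left[OF p] chart_form_skew[OF p] chart_form_nondeg[OF p]] by blast
  obtain r H where H: "r > 0" "ball p r \<subseteq> D" "affine_eq christoffel (ball p r) H" "FD H p = L"
    using affine_map_exists[OF p L(1)] by blast
  note sm = affine_eq_smooth[OF H(3)]
  have pr: "p \<in> ball p r" using H(1) by simp
  interpret std: bounded_bilinear "std_symplectic :: (real^'n) \<times> (real^'n) \<Rightarrow> _"
    by (rule std_symplectic_bounded_bilinear)
  \<comment> \<open>The pullback of the constant form by the affine map \<open>H\<close> is
    parallel, since differentiating \<open>FD H u b\<close> along \<open>a\<close> inserts
    \<open>christoffel u a b\<close>. So \<open>\<theta>\<close> is parallel, and it vanishes at
    \<open>p\<close> by the choice of \<open>L\<close>.\<close>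
  define \<theta> where "\<theta> u a b = chart_form u a b - 2 * std_symplectic (FD H u a) (FD H u b)" for u a b
  have "\<forall>\<^sub>F u in nhds p. \<forall>a b. \<theta> u a b = 0"
  proof (rule parallel_form_zero[OF open_ball H(2) pr])
    fix u assume u: "u \<in> ball p r"
    have uD: "u \<in> D" using u H(2) by auto
    note linH = smooth_on_linear_FD[OF sm u]
    show "linear (\<lambda>a. \<theta> u a b)" for b
      unfolding \<theta>_def
      by (rule linearI) (simp_all add: linear_add[OF linear_chart_form_left[OF uD]] linear_scale[OF linear_chart_form_left[OF uD]]
          linear_add[OF linH] linear_scale[OF linH] std.add_left std.scaleR_left algebra_simps)
    show "linear (\<theta> u a)" for a
      unfolding \<theta>_def
      by (rule linearI) (simp_all add: linear_add[OF linear_chart_form_right[OF uD]] linear_scale[OF linear_chart_form_right[OF uD]]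
          linear_add[OF linH] linear_scale[OF linH] std.add_right std.scaleR_right algebra_simps)
    show "((\<lambda>w. \<theta> w b d) has_derivative (\<lambda>a. \<theta> u (christoffel u a b) d + \<theta> u b (christoffel u a d))) (at u)" for b d
    proof -
      have "((\<lambda>w. \<theta> w b d) has_derivative (\<lambda>a. chart_form u (christoffel u a b) d + chart_form u b (christoffel u a d)
          - 2 * (std_symplectic (FD H u b) (FD H u (christoffel u a d))
            + std_symplectic (FD H u (christoffel u a b)) (FD H u d)))) (at u)"
        unfolding \<theta>_def
        by (intro has_derivative_diff has_derivative_mult_right chart_form_has_derivative[OF uD]
            std.FDERIV affine_eq_has_derivative2[OF H(3) u])
      then show ?thesis by (simp add: \<theta>_def algebra_simps)
    qed
  next
    show "\<theta> p a b = 0" for a b by (simp add: \<theta>_def H(4) L(3))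
  qed
  then obtain S1 where S1: "open S1" "p \<in> S1" "\<And>u a b. u \<in> S1 \<Longrightarrow> \<theta> u a b = 0"
    unfolding eventually_nhds by blast
  obtain T where T: "p \<in> T" "T \<subseteq> ball p r" "diffeo_on T H"
    using smooth_inverse_function[OF open_ball pr sm] L(2) H(4) by auto
  define S where "S = S1 \<inter> T"
  have S: "open S" "p \<in> S" "S \<subseteq> T" "S \<subseteq> S1" using S1 T by (auto simp: S_def diffeo_on_def)
  have "special_chart S H"
    unfolding special_chart_def
  proof (intro conjI ballI allI)
    show "diffeo_on S H" by (rule diffeo_on_subset[OF T(3) S(1,3)])
    show "affine_eq christoffel S H" by (rule affine_eq_subset[OF H(3) order_trans[OF S(3) T(2)]])
    show "chart_form u a b = 2 * std_symplectic (FD H u a) (FD H u b)" if "u \<in> S" for u a b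
      using S1(3)[of u a b] that S(4) by (auto simp: \<theta>_def)
  qed
  then show ?thesis
    using that[OF S(1,2) _ _ L(4,5)[folded H(4)]] S(3) T(2) H(2) by blast
qed

text \<open>\<open>L\<close> is the differential of the coordinate change at \<open>H p\<close>. It
  is symplectic because both maps pull the standard form back to half of
  \<open>chart_form p\<close>. With \<open>b = F p - L (H p)\<close>, the map
  \<open>F - L H - b\<close> is affine and vanishes to first order at \<open>p\<close>, hence near
  it.\<close>

lemma special_chart_affine_unique:
  assumes H: "special_chart S H" and F: "special_chart S F" and S: "S \<subseteq> D" "p \<in> S"
  obtains L b where "linear L" "\<And>u v. std_symplectic (L u) (L v) = std_symplectic u v"
    "\<forall>\<^sub>F u in nhds p. F u = L (H u) + b"
proof -
  have Hd: "diffeo_on S H" "affine_eq christoffel S H" "diffeo_on S F" "affine_eq christoffel S F"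
    using H F by (simp_all add: special_chart_def)
  have op: "open S" using Hd by (simp add: diffeo_on_def)
  note inv = diffeo_on_FD_inverse[OF Hd(1) S(2)]
  have linM: "linear (FD (inv_into S H) (H p))"
    using Hd(1) S(2) unfolding diffeo_on_def by (intro smooth_on_linear_FD) auto
  define L where "L = (\<lambda>z. FD F p (FD (inv_into S H) (H p) z))"
  have L: "linear L"
    unfolding L_def
    using linear_compose[OF linM smooth_on_linear_FD[OF affine_eq_smooth[OF Hd(4)] S(2)]] by (simp add: o_def)
  have LH: "L (FD H p a) = FD F p a" for a by (simp add: L_def inv)
  have sp: "std_symplectic (L u) (L v) = std_symplectic u v" for u v
  proof -
    obtain a a' where a: "u = FD H p a" "v = FD H p a'" using inv(2) by metis
    have "2 * std_symplectic (FD F p a) (FD F p a') = 2 * std_symplectic (FD H p a) (FD H p a')"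
      using H F S(2) unfolding special_chart_def by metis
    then show ?thesis by (simp add: a LH)
  qed
  define f where "f u = F u + (- L (H u) + (L (H p) - F p))" for u
  have bL: "bounded_linear (\<lambda>z. - L z)" using linear_compose_neg[OF L] by (simp add: linear_conv_bounded_linear)
  have f: "affine_eq christoffel S f"
    unfolding f_def
    by (intro affine_eq_add[OF op] Hd(4) affine_eq_linear_compose[OF op Hd(2) bL] affine_eq_const[OF op])
  have FDf: "FD f p a = 0" for a
  proof -
    have "(f has_derivative (\<lambda>a. FD F p a + (- L (FD H p a) + 0))) (at p)"
      unfolding f_def
      by (intro has_derivative_add has_derivative_const bounded_linear.has_derivative[OF bL]
          smooth_on_has_derivative[OF affine_eq_smooth[OF Hd(2)] S(2)]
          smooth_on_has_derivative[OF affine_eq_smooth[OF Hd(4)] S(2)])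
    then show ?thesis by (simp add: FD_eqI LH)
  qed
  have "\<forall>\<^sub>F u in nhds p. f u = 0"
    by (rule affine_eq_zero[OF op S f _ FDf]) (simp add: f_def)
  then have "\<forall>\<^sub>F u in nhds p. F u = L (H u) + (F p - L (H p))"
    by eventually_elim (simp add: f_def algebra_simps)
  then show ?thesis using that L sp by blast
qed

lemma special_chart_affine_compose:
  assumes H: "special_chart S H" and L: "linear L"
    and sp: "\<And>u v. std_symplectic (L u) (L v) = std_symplectic u v"
  shows "special_chart S (\<lambda>u. L (H u) + b)"
proof -
  have Hd: "diffeo_on S H" "affine_eq christoffel S H" using H by (simp_all add: special_chart_def)
  have op: "open S" using Hd by (simp add: diffeo_on_def)
  have bL: "bounded_linear L" using L by (simp add: linear_conv_bounded_linear)
  have "FD (\<lambda>u. L (H u) + b) u a = L (FD H u a)" if "u \<in> S" for u a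
  proof -
    have "((\<lambda>u. L (H u) + b) has_derivative (\<lambda>a. L (FD H u a) + 0)) (at u)"
      by (intro has_derivative_add has_derivative_const bounded_linear.has_derivative[OF bL]
          smooth_on_has_derivative[OF affine_eq_smooth[OF Hd(2)] that])
    then show ?thesis by (simp add: FD_eqI)
  qed
  then show ?thesis
    using H unfolding special_chart_def
    by (simp add: sp diffeo_on_affine_compose[OF Hd(1) L std_symplectic_preserving_inj[OF L sp]]
        affine_eq_add[OF op affine_eq_linear_compose[OF op Hd(2) bL] affine_eq_const[OF op]])
qed

end

section \<open>Existence and uniqueness\<close>

lemma holomorphic_map_on_cong:
  fixes F H :: "complex^'n \<Rightarrow> complex^'m"
  assumes S: "open S" and eq: "\<And>u. u \<in> S \<Longrightarrow> F u = H u"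
  shows "holomorphic_map_on S F \<longleftrightarrow> holomorphic_map_on S H"
proof -
  have "FD F u = FD H u" if "u \<in> S" for u by (rule FD_cong_open[OF S that eq])
  then show ?thesis
    unfolding holomorphic_map_on_iff[OF S] using smooth_on_cong[OF S eq] by simp
qed

lemma holomorphic_map_on_subset:
  fixes F :: "complex^'n \<Rightarrow> complex^'m"
  shows "holomorphic_map_on S F \<Longrightarrow> T \<subseteq> S \<Longrightarrow> holomorphic_map_on T F"
  unfolding holomorphic_map_on_def Cn_holomorphic_on_def using smooth_on_subset by blast

context complex_mfd
begin

lemma eventually_nhds_chart:
  assumes c: "c \<in> A" "p \<in> fst c" and P: "\<forall>\<^sub>F u in nhds (snd c p). P u"
  shows "\<forall>\<^sub>F q in nhds p. q \<in> fst c \<and> P (snd c q)"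
proof -
  obtain T where T: "open T" "snd c p \<in> T" "\<And>u. u \<in> T \<Longrightarrow> P u"
    using P unfolding eventually_nhds by blast
  have op: "open (chart_inv c ` (T \<inter> snd c ` fst c))" and sub: "chart_inv c ` (T \<inter> snd c ` fst c) \<subseteq> fst c"
    using open_chart_preimage[OF c(1) open_Int[OF T(1) chart_homeo(2)[OF c(1)]]] by auto
  have "p \<in> chart_inv c ` (T \<inter> snd c ` fst c)"
    using T(2) c by (intro image_eqI[of _ _ "snd c p"]) auto
  moreover have "q \<in> fst c \<and> P (snd c q)" if q: "q \<in> chart_inv c ` (T \<inter> snd c ` fst c)" for q
  proof -
    obtain u where u: "u \<in> T" "u \<in> snd c ` fst c" "q = chart_inv c u" using q by blast
    then have "snd c q = u" using c(1) by simp
    then show ?thesis using T(3)[OF u(1)] q sub by blast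
  qed
  ultimately show ?thesis unfolding eventually_nhds using op by blast
qed

lemma holomorphic_vecI':
  assumes c: "c \<in> A" and U: "open U" "U \<subseteq> fst c" and z: "holomorphic_map_on (snd c ` U) (z \<circ> chart_inv c)"
  shows "holomorphic_fun A U (\<lambda>q. z q $ i)"
  using z unfolding holomorphic_map_on_iff[OF open_chart_image'[OF c U]]
  by (intro holomorphic_vecI[OF c U]) auto

lemma holomorphic_coordsI':
  assumes c: "c \<in> A" and U: "open U" "U \<subseteq> fst c" and z: "diffeo_on (snd c ` U) (z \<circ> chart_inv c)"
    and hol: "holomorphic_map_on (snd c ` U) (z \<circ> chart_inv c)"
  shows "holomorphic_coords A U z"
  using hol unfolding holomorphic_map_on_iff[OF open_chart_image'[OF c U]]
  by (intro holomorphic_coordsI[OF c U z]) auto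

text \<open>Two extensions differ near \<open>p\<close> by an imaginary constant in each of the
  finitely many components; conversely such a translation changes neither holomorphy nor real parts.
  Both sides speak of germs, so the converse may shrink the domain.\<close>

lemma holomorphic_extension_unique_iff:
  assumes V: "open V" "p \<in> V" "V \<subseteq> U" and ext: "holomorphic_extension A V x y z w"
  shows "(\<exists>V'. open V' \<and> p \<in> V' \<and> V' \<subseteq> U \<and> holomorphic_extension A V' x y z' w') \<longleftrightarrow>
    (\<exists>a b :: real^'n. \<forall>\<^sub>F q in nhds p. \<forall>i.
       z' q $ i = z q $ i + \<i> * of_real (a $ i) \<and> w' q $ i = w q $ i + \<i> * of_real (b $ i))"
    (is "?L \<longleftrightarrow> ?R")
proof
  assume ?L
  then obtain V' where V': "open V'" "p \<in> V'" "V' \<subseteq> U" "holomorphic_extension A V' x y z' w'" by blast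
  have Re: "Re (z' q $ i) = Re (z q $ i)" "Re (w' q $ i) = Re (w q $ i)" if "q \<in> V" "q \<in> V'" for q i
  proof -
    have "Re_vec (z q) = Re_vec (z' q)" "Re_vec (w q) = Re_vec (w' q)"
      using ext V'(4) that by (simp_all add: holomorphic_extension_def)
    then show "Re (z' q $ i) = Re (z q $ i)" "Re (w' q $ i) = Re (w q $ i)"
      by (simp_all add: Re_vec_def vec_eq_iff)
  qed
  have "\<forall>\<^sub>F q in nhds p. z' q $ i = z q $ i + \<i> * of_real (Im (z' p $ i - z p $ i))" for i
    by (rule holomorphic_same_real_part[OF _ V(1,2) _ V'(1,2) Re(1)])
      (use ext V'(4) in \<open>auto simp: holomorphic_extension_def\<close>)
  moreover have "\<forall>\<^sub>F q in nhds p. w' q $ i = w q $ i + \<i> * of_real (Im (w' p $ i - w p $ i))" for i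
    by (rule holomorphic_same_real_part[OF _ V(1,2) _ V'(1,2) Re(2)])
      (use ext V'(4) in \<open>auto simp: holomorphic_extension_def\<close>)
  ultimately have "\<forall>\<^sub>F q in nhds p. \<forall>i. z' q $ i = z q $ i + \<i> * of_real ((\<chi> i. Im (z' p $ i - z p $ i)) $ i) \<and>
      w' q $ i = w q $ i + \<i> * of_real ((\<chi> i. Im (w' p $ i - w p $ i)) $ i)"
    by (intro eventually_all_finite eventually_conj) simp_all
  then show ?R by blast
next
  assume ?R
  then obtain a b :: "real^'n" where ab: "\<forall>\<^sub>F q in nhds p. \<forall>i.
       z' q $ i = z q $ i + \<i> * of_real (a $ i) \<and> w' q $ i = w q $ i + \<i> * of_real (b $ i)" by blast
  then obtain T where T: "open T" "p \<in> T" "\<And>q i. q \<in> T \<Longrightarrow> z' q $ i = z q $ i + \<i> * of_real (a $ i)"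
    "\<And>q i. q \<in> T \<Longrightarrow> w' q $ i = w q $ i + \<i> * of_real (b $ i)"
    unfolding eventually_nhds by blast
  have "holomorphic_extension A (T \<inter> V) x y z' w'"
    unfolding holomorphic_extension_def
  proof (intro conjI allI ballI)
    show "holomorphic_fun A (T \<inter> V) (\<lambda>q. z' q $ i)" for i
      by (rule holomorphic_fun_translate[of V "\<lambda>q. z q $ i"])
        (use ext T V in \<open>auto simp: holomorphic_extension_def\<close>)
    show "holomorphic_fun A (T \<inter> V) (\<lambda>q. w' q $ i)" for i
      by (rule holomorphic_fun_translate[of V "\<lambda>q. w q $ i"])
        (use ext T V in \<open>auto simp: holomorphic_extension_def\<close>)
    fix q assume q: "q \<in> T \<inter> V"
    then have "Re_vec (z q) = x q" "Re_vec (w q) = y q"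
      using ext by (auto simp: holomorphic_extension_def)
    moreover have "Re_vec (z' q) = Re_vec (z q)" "Re_vec (w' q) = Re_vec (w q)"
      using T(3,4) q by (simp_all add: Re_vec_def vec_eq_iff)
    ultimately show "Re_vec (z' q) = x q" "Re_vec (w' q) = y q" by simp_all
  qed
  then show ?L using T V by (intro exI[of _ "T \<inter> V"]) auto
qed

end

context special_complex_chart
begin

text \<open>The conjugate of the pair-valued map \<open>H\<close> supplies both imaginary parts at
  once. The differentials at \<open>p\<close> are recorded because, in the Kaehler case, their
  injectivity is what makes \<open>Z\<close> and \<open>Wh\<close> local coordinates.\<close>

lemma holomorphic_pair_exists:
  fixes H :: "complex^'n \<Rightarrow> (real^'n) \<times> (real^'n)"
  assumes S: "open S" "S \<subseteq> D" "p \<in> S" and H: "affine_eq christoffel S H"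
  obtains r Z Wh where "r > 0" "ball p r \<subseteq> S" "holomorphic_map_on (ball p r) Z" "holomorphic_map_on (ball p r) Wh"
    "\<And>u. Re_vec (Z u) = fst (H u)" "\<And>u. Re_vec (Wh u) = snd (H u)"
    "\<And>a. FD Z p a = cvec (fst (FD H p a)) (- fst (FD H p (J a)))"
    "\<And>a. FD Wh p a = cvec (snd (FD H p a)) (- snd (FD H p (J a)))"
proof -
  obtain r G where r: "r > 0" "ball p r \<subseteq> S" "smooth_on (ball p r) G"
    "\<And>u a. u \<in> ball p r \<Longrightarrow> FD G u a = - FD H u (J a)"
    using conjugate_exists[OF S H] by blast
  have smH: "smooth_on (ball p r) H" by (rule smooth_on_subset[OF affine_eq_smooth[OF H] r(2)])
  have comp: "smooth_on (ball p r) (\<lambda>u. fst (F u))" "smooth_on (ball p r) (\<lambda>u. snd (F u))"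
    "u \<in> ball p r \<Longrightarrow> FD (\<lambda>u. fst (F u)) u a = fst (FD F u a)"
    "u \<in> ball p r \<Longrightarrow> FD (\<lambda>u. snd (F u)) u a = snd (FD F u a)"
    if F: "smooth_on (ball p r) F" for F :: "complex^'n \<Rightarrow> (real^'n) \<times> (real^'n)" and u a
    using smooth_on_linear_compose[OF open_ball bounded_linear_fst F]
      smooth_on_linear_compose[OF open_ball bounded_linear_snd F]
      FD_eqI[OF has_derivative_fst[OF smooth_on_has_derivative[OF F]]]
      FD_eqI[OF has_derivative_snd[OF smooth_on_has_derivative[OF F]]]
    by simp_all
  have cr: "FD (\<lambda>u. fst (G u)) u a = - FD (\<lambda>u. fst (H u)) u (J a)"
    "FD (\<lambda>u. snd (G u)) u a = - FD (\<lambda>u. snd (H u)) u (J a)" if u: "u \<in> ball p r" for u a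
    by (simp_all add: comp[OF r(3)] comp[OF smH] r(4) u del: mem_ball)
  have pr: "p \<in> ball p r" using r(1) by simp
  note Z = cvec_holomorphic[OF open_ball comp(1)[OF smH] comp(1)[OF r(3)] cr(1)]
  note Wh = cvec_holomorphic[OF open_ball comp(2)[OF smH] comp(2)[OF r(3)] cr(2)]
  show ?thesis
  proof (rule that[OF r(1,2)])
    show "holomorphic_map_on (ball p r) (\<lambda>u. cvec (fst (H u)) (fst (G u)))"
      unfolding holomorphic_map_on_iff[OF open_ball] using Z(1,3) by blast
    show "holomorphic_map_on (ball p r) (\<lambda>u. cvec (snd (H u)) (snd (G u)))"
      unfolding holomorphic_map_on_iff[OF open_ball] using Wh(1,3) by blast
    show "FD (\<lambda>u. cvec (fst (H u)) (fst (G u))) p a = cvec (fst (FD H p a)) (- fst (FD H p (J a)))" for a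
      using Z(2)[OF _ pr, of a] by (simp add: comp(3)[OF smH pr] comp(3)[OF r(3) pr] r(4)[OF pr])
    show "FD (\<lambda>u. cvec (snd (H u)) (snd (G u))) p a = cvec (snd (FD H p a)) (- snd (FD H p (J a)))" for a
      using Wh(2)[OF _ pr, of a] by (simp add: comp(4)[OF smH pr] comp(4)[OF r(3) pr] r(4)[OF pr])
  qed simp_all
qed

lemma holomorphic_extension_exists:
  assumes xy: "affine_coords A nabla U x y" and p: "p \<in> U" "p \<in> fst c"
  shows "\<exists>V z w. open V \<and> p \<in> V \<and> V \<subseteq> U \<and> holomorphic_extension A V x y z w"
proof -
  define V0 where "V0 = U \<inter> fst c"
  have "open U" using xy by (simp add: affine_coords_def real_coords_iff coord_map_def)
  then have V0: "open V0" "V0 \<subseteq> U" "V0 \<subseteq> fst c" "p \<in> V0" using W p by (auto simp: V0_def)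
  define H where "H = (\<lambda>p. (x p, y p)) \<circ> chart_inv c"
  have H: "affine_eq christoffel (snd c ` V0) H"
    unfolding H_def by (rule affine_coords_chart(2)[OF xy V0(1-3)])
  have S: "open (snd c ` V0)" "snd c ` V0 \<subseteq> D" "snd c p \<in> snd c ` V0"
    using open_chart_image'[OF c V0(1,3)] V0 by auto
  obtain r Z Wh where Z: "r > 0" "ball (snd c p) r \<subseteq> snd c ` V0"
    "holomorphic_map_on (ball (snd c p) r) Z" "holomorphic_map_on (ball (snd c p) r) Wh"
    "\<And>u. Re_vec (Z u) = fst (H u)" "\<And>u. Re_vec (Wh u) = snd (H u)"
    using holomorphic_pair_exists[OF S H] by metis
  define V where "V = chart_inv c ` ball (snd c p) r"
  have V: "open V" "V \<subseteq> fst c" "snd c ` V = ball (snd c p) r"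
    unfolding V_def using open_chart_preimage[OF c open_ball order_trans[OF Z(2) S(2)]] by blast+
  have VU: "V \<subseteq> U"
  proof
    fix q assume "q \<in> V"
    then obtain u where u: "u \<in> ball (snd c p) r" "q = chart_inv c u" by (auto simp: V_def)
    then obtain q' where q': "q' \<in> V0" "u = snd c q'" using Z(2) by blast
    then have "q = q'" using u V0(3) c by auto
    then show "q \<in> U" using q' V0 by auto
  qed
  have pV: "p \<in> V"
    unfolding V_def using Z(1) p c by (intro image_eqI[of _ _ "snd c p"]) auto
  have inv: "snd c (chart_inv c u) = u" if "u \<in> snd c ` V" for u
    using that V(2) c by auto
  have "holomorphic_extension A V x y (\<lambda>q. Z (snd c q)) (\<lambda>q. Wh (snd c q))"
    unfolding holomorphic_extension_def
  proof (intro conjI allI ballI)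
    have "holomorphic_map_on (snd c ` V) ((\<lambda>q. F (snd c q)) \<circ> chart_inv c)"
      if F: "holomorphic_map_on (ball (snd c p) r) F" for F :: "complex^'n \<Rightarrow> complex^'n"
      by (rule holomorphic_map_on_cong[OF open_chart_image'[OF c V(1,2)], THEN iffD2, of _ F])
        (use F inv V(3) in auto)
    then show "holomorphic_fun A V (\<lambda>q. Z (snd c q) $ i)" "holomorphic_fun A V (\<lambda>q. Wh (snd c q) $ i)" for i
      using holomorphic_vecI'[OF c V(1,2)] Z(3,4) by blast+
    fix q assume "q \<in> V"
    then have "q \<in> fst c" using V by auto
    then show "Re_vec (Z (snd c q)) = x q" "Re_vec (Wh (snd c q)) = y q"
      by (simp_all add: Z(5,6) H_def c)
  qed
  then show ?thesis using V(1) pV VU by blast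
qed

end

context special_symplectic_chart
begin

lemma real_special_coords_of_chart:
  assumes S: "open S" "S \<subseteq> D" and H: "special_chart S H"
  shows "real_special_coords A nabla \<omega> (chart_inv c ` S) (\<lambda>q. fst (H (snd c q))) (\<lambda>q. snd (H (snd c q)))"
proof -
  note U = open_chart_preimage[OF c S]
  have "special_chart S ((\<lambda>p. (fst (H (snd c p)), snd (H (snd c p)))) \<circ> chart_inv c)"
    by (rule special_chart_cong[OF S(1), THEN iffD2, OF _ H]) (use S c in \<open>auto simp: subset_iff\<close>)
  then show ?thesis unfolding real_special_coords_iff[OF U(1,2)] U(3) .
qed

lemma real_special_coords_exist:
  assumes p: "p \<in> fst c"
  shows "\<exists>U x y. p \<in> U \<and> real_special_coords A nabla \<omega> U x y"
proof -
  have pD: "snd c p \<in> D" using p by simp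
  obtain S H where S: "open S" "snd c p \<in> S" "S \<subseteq> D" "special_chart S H"
    by (rule special_chart_exists[OF pD])
  have "p \<in> chart_inv c ` S"
    using S(2) p c by (intro image_eqI[of _ _ "snd c p"]) auto
  then show ?thesis using real_special_coords_of_chart[OF S(1,3,4)] by blast
qed

lemma real_special_coords_open: "real_special_coords A nabla \<omega> U x y \<Longrightarrow> open U"
  by (simp add: real_special_coords_def affine_coords_def real_coords_iff coord_map_def)

text \<open>On a common domain inside one chart the forward direction is the rigidity of affine maps
  with given first-order data. Conversely, composition with an affine symplectic map preserves the
  affine equation, the diffeomorphism property and the form.\<close>

lemma real_special_coords_unique_iff:
  assumes p: "p \<in> fst c" "p \<in> U" and xy: "real_special_coords A nabla \<omega> U x y"
  shows "(\<exists>U'. p \<in> U' \<and> real_special_coords A nabla \<omega> U' x' y') \<longleftrightarrow>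
    (\<exists>g. affine_symplectic g \<and> (\<forall>\<^sub>F q in nhds p. (x' q, y' q) = g (x q, y q)))" (is "?L \<longleftrightarrow> ?R")
proof
  assume ?L
  then obtain U' where U': "p \<in> U'" "real_special_coords A nabla \<omega> U' x' y'" by blast
  define V where "V = U \<inter> U' \<inter> fst c"
  have V: "open V" "V \<subseteq> U" "V \<subseteq> U'" "V \<subseteq> fst c" "p \<in> V"
    using real_special_coords_open[OF xy] real_special_coords_open[OF U'(2)] W p U' by (auto simp: V_def)
  have S: "snd c ` V \<subseteq> D" "snd c p \<in> snd c ` V" using V by auto
  obtain L b where L: "linear L" "\<And>u v. std_symplectic (L u) (L v) = std_symplectic u v"
    "\<forall>\<^sub>F u in nhds (snd c p). ((\<lambda>p. (x' p, y' p)) \<circ> chart_inv c) u = L (((\<lambda>p. (x p, y p)) \<circ> chart_inv c) u) + b"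
    using special_chart_affine_unique[OF real_special_coords_subset[OF xy V(1,2,4)]
        real_special_coords_subset[OF U'(2) V(1,3,4)] S] by blast
  have "\<forall>\<^sub>F q in nhds p. (x' q, y' q) = (\<lambda>z. L z + b) (x q, y q)"
    using eventually_nhds_chart[OF c p(1) L(3)] by eventually_elim (use c in auto)
  moreover have "affine_symplectic (\<lambda>z. L z + b)" using L(1,2) unfolding affine_symplectic_def by blast
  ultimately show ?R by blast
next
  assume ?R
  then obtain L b where L: "linear L" "\<And>u v. std_symplectic (L u) (L v) = std_symplectic u v"
    and ev: "\<forall>\<^sub>F q in nhds p. (x' q, y' q) = L (x q, y q) + b"
    unfolding affine_symplectic_def by auto
  obtain T where T: "open T" "p \<in> T" "\<And>q. q \<in> T \<Longrightarrow> (x' q, y' q) = L (x q, y q) + b"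
    using ev unfolding eventually_nhds by blast
  define V where "V = T \<inter> U \<inter> fst c"
  have V: "open V" "V \<subseteq> U" "V \<subseteq> T" "V \<subseteq> fst c" "p \<in> V"
    using real_special_coords_open[OF xy] W p T by (auto simp: V_def)
  note op = open_chart_image'[OF c V(1,4)]
  have "special_chart (snd c ` V) (\<lambda>u. L (((\<lambda>p. (x p, y p)) \<circ> chart_inv c) u) + b)"
    by (rule special_chart_affine_compose[OF real_special_coords_subset[OF xy V(1,2,4)] L])
  then have "special_chart (snd c ` V) ((\<lambda>p. (x' p, y' p)) \<circ> chart_inv c)"
  proof (rule special_chart_cong[OF op, THEN iffD2, rotated])
    fix u assume "u \<in> snd c ` V"
    then have "chart_inv c u \<in> T" using V c by (auto simp: subset_iff)
    then show "((\<lambda>p. (x' p, y' p)) \<circ> chart_inv c) u = L (((\<lambda>p. (x p, y p)) \<circ> chart_inv c) u) + b"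
      using T(3) by simp
  qed
  then have "real_special_coords A nabla \<omega> V x' y'" unfolding real_special_coords_iff[OF V(1,4)] .
  then show ?L using V(5) by blast
qed

text \<open>A vector \<open>v\<close> in the kernel of the differential of \<open>Z\<close> at the
  point has both \<open>v\<close> and \<open>J v\<close> in the kernel of the first half of
  \<open>FD H\<close>, so it is zero by total reality; likewise for \<open>Wh\<close> with the
  second half. Each map has its own domain of invertibility, and the special coordinates restrict to
  the intersection \<open>R\<close>.\<close>

lemma conjugate_pair_exists:
  assumes p: "p \<in> fst c"
    and inv: "\<And>p u v. u \<in> tangent_space A p \<Longrightarrow> v \<in> tangent_space A p \<Longrightarrow> \<omega> p (J_vec u) (J_vec v) = \<omega> p u v"
  shows "\<exists>U x y z w. p \<in> U \<and> real_special_coords A nabla \<omega> U x y \<and>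
    holomorphic_extension A U x y z w \<and> conjugate_pair A nabla \<omega> U z w"
proof -
  define p' where "p' = snd c p"
  have pD: "p' \<in> D" using p by (simp add: p'_def)
  have J: "\<forall>a b. chart_form p' (J a) (J b) = chart_form p' a b" using chart_form_J[OF pD inv] by blast
  obtain S H where S: "open S" "p' \<in> S" "S \<subseteq> D" and H: "special_chart S H"
    and tr: "\<And>v. fst (FD H p' v) = 0 \<Longrightarrow> fst (FD H p' (J v)) = 0 \<Longrightarrow> v = 0"
      "\<And>v. snd (FD H p' v) = 0 \<Longrightarrow> snd (FD H p' (J v)) = 0 \<Longrightarrow> v = 0"
    using special_chart_exists[OF pD] J by metis
  have aff: "affine_eq christoffel S H" using H by (simp add: special_chart_def)
  obtain r Z Wh where Z: "r > 0" "ball p' r \<subseteq> S" "holomorphic_map_on (ball p' r) Z" "holomorphic_map_on (ball p' r) Wh"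
    "\<And>u. Re_vec (Z u) = fst (H u)" "\<And>u. Re_vec (Wh u) = snd (H u)"
    "\<And>a. FD Z p' a = cvec (fst (FD H p' a)) (- fst (FD H p' (J a)))"
    "\<And>a. FD Wh p' a = cvec (snd (FD H p' a)) (- snd (FD H p' (J a)))"
    using holomorphic_pair_exists[OF S(1,3,2) aff] by metis
  have pr: "p' \<in> ball p' r" using Z(1) by simp
  have sm: "smooth_on (ball p' r) Z" "smooth_on (ball p' r) Wh"
    using Z(3,4) by (simp_all add: holomorphic_map_on_iff)
  have injZ: "inj (FD Z p')"
    unfolding linear_injective_0[OF smooth_on_linear_FD[OF sm(1) pr]] Z(7) cvec_eq_0_iff using tr(1) by simp
  have injW: "inj (FD Wh p')"
    unfolding linear_injective_0[OF smooth_on_linear_FD[OF sm(2) pr]] Z(8) cvec_eq_0_iff using tr(2) by simp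
  obtain T1 where T1: "p' \<in> T1" "T1 \<subseteq> ball p' r" "diffeo_on T1 Z"
    using smooth_inverse_function[OF open_ball pr sm(1) injZ refl] by blast
  obtain T2 where T2: "p' \<in> T2" "T2 \<subseteq> ball p' r" "diffeo_on T2 Wh"
    using smooth_inverse_function[OF open_ball pr sm(2) injW refl] by blast
  define R where "R = T1 \<inter> T2"
  have R: "open R" "p' \<in> R" "R \<subseteq> T1" "R \<subseteq> T2" "R \<subseteq> ball p' r" "R \<subseteq> S" "R \<subseteq> D"
    using T1 T2 Z(2) S(3) by (auto simp: R_def diffeo_on_def)
  define U where "U = chart_inv c ` R"
  have U: "open U" "U \<subseteq> fst c" "snd c ` U = R"
    unfolding U_def using open_chart_preimage[OF c R(1,7)] by blast+
  have pU: "p \<in> U"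
    unfolding U_def using R(2) p c by (intro image_eqI[of _ _ p']) (auto simp: p'_def)
  have rs: "real_special_coords A nabla \<omega> U (\<lambda>q. fst (H (snd c q))) (\<lambda>q. snd (H (snd c q)))"
    unfolding U_def by (rule real_special_coords_of_chart[OF R(1,7) special_chart_subset[OF H R(1,6)]])
  have inv_c: "snd c (chart_inv c u) = u" if "u \<in> R" for u using that R(7) c by auto
  have hol: "holomorphic_map_on (snd c ` U) ((\<lambda>q. F (snd c q)) \<circ> chart_inv c)"
    if F: "holomorphic_map_on (ball p' r) F" for F :: "complex^'n \<Rightarrow> complex^'n"
    unfolding U(3)
    by (rule holomorphic_map_on_cong[OF R(1), THEN iffD2, of _ F])
      (use inv_c holomorphic_map_on_subset[OF F R(5)] in auto)
  have dif: "diffeo_on (snd c ` U) ((\<lambda>q. F (snd c q)) \<circ> chart_inv c)"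
    if F: "diffeo_on T F" "R \<subseteq> T" for F :: "complex^'n \<Rightarrow> complex^'n" and T
    unfolding U(3)
    by (rule diffeo_on_cong[THEN iffD2, of _ _ F]) (use inv_c diffeo_on_subset[OF F(1) R(1) F(2)] in auto)
  have "holomorphic_extension A U (\<lambda>q. fst (H (snd c q))) (\<lambda>q. snd (H (snd c q))) (\<lambda>q. Z (snd c q)) (\<lambda>q. Wh (snd c q))"
    using holomorphic_vecI'[OF c U(1,2) hol[OF Z(3)]] holomorphic_vecI'[OF c U(1,2) hol[OF Z(4)]] Z(5,6)
    by (simp add: holomorphic_extension_def)
  moreover have "conjugate_pair A nabla \<omega> U (\<lambda>q. Z (snd c q)) (\<lambda>q. Wh (snd c q))"
    using holomorphic_coordsI'[OF c U(1,2) dif[OF T1(3) R(3)] hol[OF Z(3)]]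
      holomorphic_coordsI'[OF c U(1,2) dif[OF T2(3) R(4)] hol[OF Z(4)]] rs
    by (simp add: conjugate_pair_def Z(5,6))
  ultimately show ?thesis using pU rs by blast
qed

end

text \<open>All three parts are local at a point, so one chart around it is fixed and the results of
  the corresponding chart locale are read off.\<close>

theorem theorem1:
  fixes A :: "('a::{t2_space,second_countable_topology}, 'n::finite) chart set"
    and nabla :: "('a, 'n) vfield \<Rightarrow> ('a, 'n) vfield \<Rightarrow> ('a, 'n) vfield"
    and \<omega> :: "'a \<Rightarrow> ('a, 'n) tvec \<Rightarrow> ('a, 'n) tvec \<Rightarrow> real"
  shows
    "(special_symplectic_manifold A nabla \<omega> \<longrightarrow>
       (\<forall>p. (\<exists>U x y. p \<in> U \<and> real_special_coords A nabla \<omega> U x y) \<and>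
          (\<forall>U x y x' y'. p \<in> U \<and> real_special_coords A nabla \<omega> U x y \<longrightarrow>
             ((\<exists>U'. p \<in> U' \<and> real_special_coords A nabla \<omega> U' x' y') \<longleftrightarrow>
              (\<exists>g. affine_symplectic g \<and>
                 (\<forall>\<^sub>F q in nhds p. (x' q, y' q) = g (x q, y q)))))))
     \<and>
     (special_complex_manifold A nabla \<longrightarrow>
       (\<forall>U x y p. affine_coords A nabla U x y \<and> p \<in> U \<longrightarrow>
          (\<exists>V z w. open V \<and> p \<in> V \<and> V \<subseteq> U \<and> holomorphic_extension A V x y z w) \<and>
          (\<forall>V z w z' w'. open V \<and> p \<in> V \<and> V \<subseteq> U \<and> holomorphic_extension A V x y z w \<longrightarrow>
             ((\<exists>V'. open V' \<and> p \<in> V' \<and> V' \<subseteq> U \<and> holomorphic_extension A V' x y z' w') \<longleftrightarrow>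
              (\<exists>a b :: real^'n. \<forall>\<^sub>F q in nhds p. \<forall>i.
                 z' q $ i = z q $ i + \<i> * of_real (a $ i) \<and>
                 w' q $ i = w q $ i + \<i> * of_real (b $ i))))))
     \<and>
     (special_kaehler_manifold A nabla \<omega> \<longrightarrow>
       (\<forall>p. \<exists>U x y z w. p \<in> U \<and> real_special_coords A nabla \<omega> U x y \<and>
          holomorphic_extension A U x y z w \<and> conjugate_pair A nabla \<omega> U z w))"
proof (intro conjI impI allI)
  fix p assume m: "special_symplectic_manifold A nabla \<omega>"
  then interpret complex_mfd A
    by unfold_locales (simp add: special_symplectic_manifold_def special_complex_manifold_def)
  obtain c where chart: "c \<in> A" "p \<in> fst c" using chart_exists by blast
  interpret special_symplectic_chart A nabla c \<omega>
    using m chart by unfold_locales (simp_all add: special_symplectic_manifold_def)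
  show "\<exists>U x y. p \<in> U \<and> real_special_coords A nabla \<omega> U x y"
    by (rule real_special_coords_exist[OF chart(2)])
  show "(\<exists>U'. p \<in> U' \<and> real_special_coords A nabla \<omega> U' x' y') \<longleftrightarrow>
      (\<exists>g. affine_symplectic g \<and> (\<forall>\<^sub>F q in nhds p. (x' q, y' q) = g (x q, y q)))"
    if "p \<in> U \<and> real_special_coords A nabla \<omega> U x y" for U x y x' y'
    using that by (intro real_special_coords_unique_iff[OF chart(2)]) auto
next
  fix U x y p assume m: "special_complex_manifold A nabla" and xy: "affine_coords A nabla U x y \<and> p \<in> U"
  interpret complex_mfd A
    using m by unfold_locales (simp add: special_complex_manifold_def)
  obtain c where chart: "c \<in> A" "p \<in> fst c" using chart_exists by blast
  interpret special_complex_chart A nabla c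
    using m chart by unfold_locales
  show "\<exists>V z w. open V \<and> p \<in> V \<and> V \<subseteq> U \<and> holomorphic_extension A V x y z w"
    using xy chart(2) by (intro holomorphic_extension_exists) auto
  show "(\<exists>V'. open V' \<and> p \<in> V' \<and> V' \<subseteq> U \<and> holomorphic_extension A V' x y z' w') \<longleftrightarrow>
      (\<exists>a b :: real^'n. \<forall>\<^sub>F q in nhds p. \<forall>i.
         z' q $ i = z q $ i + \<i> * of_real (a $ i) \<and> w' q $ i = w q $ i + \<i> * of_real (b $ i))"
    if "open V \<and> p \<in> V \<and> V \<subseteq> U \<and> holomorphic_extension A V x y z w" for V z w z' w'
    using that by (intro holomorphic_extension_unique_iff) auto
next
  fix p assume m: "special_kaehler_manifold A nabla \<omega>"
  then interpret complex_mfd A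
    by unfold_locales
      (simp add: special_kaehler_manifold_def special_symplectic_manifold_def special_complex_manifold_def)
  obtain c where chart: "c \<in> A" "p \<in> fst c" using chart_exists by blast
  interpret special_symplectic_chart A nabla c \<omega>
    using m chart by unfold_locales (simp_all add: special_kaehler_manifold_def special_symplectic_manifold_def)
  show "\<exists>U x y z w. p \<in> U \<and> real_special_coords A nabla \<omega> U x y \<and>
      holomorphic_extension A U x y z w \<and> conjugate_pair A nabla \<omega> U z w"
    using m by (intro conjugate_pair_exists[OF chart(2)]) (simp add: special_kaehler_manifold_def)
qed

end
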